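(* Let $n=2\bar n$ and let $H:\mathbb{R}^n\times\mathbb{R}\to\mathbb{R}$ be analytic; consider the Hamiltonian system $\dot x=f(x;\mu)$ with $f(x;\mu)=J_n(\mathrm{D}_xH(x;\mu))^*$, $\mu\in\mathbb{R}$. Assume that: (M1) $x=0$ is a hyperbolic saddle at $\mu=0$ (so that $\mathrm{D}_xf(0;0)$ has $\bar n$ eigenvalues with negative and $\bar n$ with positive real part); (M2) $x=0$ has a homoclinic orbit $x^{\mathrm h}(t)$ at $\mu=0$; (M3) with $n_0=2$: the variational equation $\dot\xi=\mathrm{D}_xf(x^{\mathrm h}(t);0)\xi$ has exactly two independent bounded solutions $\varphi_1(t)=\dot x^{\mathrm h}(t)$ and $\varphi_2(t)$. Put $$a_2=-\int_{-\infty}^\infty\langle J_n\varphi_2(t),\mathrm{D}_\mu f(x^{\mathrm h}(t);0)\rangle\,\mathrm dt,\qquad b_2=-\tfrac12\int_{-\infty}^\infty\langle J_n\varphi_2(t),\mathrm{D}_x^2f(x^{\mathrm h}(t);0)(\varphi_2(t),\varphi_2(t))\rangle\,\mathrm dt,$$ and suppose $a_2\neq0$ and $b_2\ne0$. Then a saddle-node bifurcation of homoclinic orbits occurs at $\mu=0$. Moreover, it is supercritical or subcritical, depending on whether $a_2b_2<0$ or $a_2b_2>0$.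
   Context: $J_n=\begin{pmatrix}0&\mathrm{id}_{\bar n}\\-\mathrm{id}_{\bar n}&0\end{pmatrix}$; $*$ denotes transpose; $\langle\cdot,\cdot\rangle$ is the Euclidean inner product. Throughout, $x=0$ is an equilibrium for all $\mu$ near $0$, i.e. $f(0;\mu)=0$. A saddle-node bifurcation of homoclinic orbits occurs at $\mu=0$ if for some open interval $I\ni0$ there is a differentiable function $\phi:I\to\mathbb{R}$ with $\phi(0)=0$, $\phi'(0)=0$, $\phi''(0)\ne0$ such that for $\alpha\in I$ the system with $\mu=\phi(\alpha)$ has a homoclinic orbit to $x=0$ of the form $x=x^{\mathrm h}(t)+\alpha\varphi_2(t)+O(\sqrt{\alpha^4+|\mu|^2})$ (the remainder being measured in the sup norm over $t\in\mathbb{R}$), with $\alpha=0$ giving $x^{\mathrm h}$. It is supercritical if $\phi''(0)>0$ (the bifurcating orbits exist for $\mu>0$) and subcritical if $\phi''(0)<0$ (they exist for $\mu<0$). *)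

theory Defs
  imports "HOL-Analysis.Analysis"
begin

text \<open>Real analyticity on a whole Euclidean space. The functions \<open>k\<close> are multi-indices; they
  are required to vanish off the basis so that each multi-index is counted once.\<close>

definition real_analytic :: "('a::euclidean_space \<Rightarrow> real) \<Rightarrow> bool" where
  "real_analytic g \<longleftrightarrow>
     (\<forall>p. \<exists>r>0. \<exists>c :: ('a \<Rightarrow> nat) \<Rightarrow> real. \<forall>x\<in>ball p r.
        ((\<lambda>k. c k * (\<Prod>b\<in>Basis. ((x - p) \<bullet> b) ^ k b)) has_sum g x)
          {k. \<forall>b. b \<notin> Basis \<longrightarrow> k b = 0})"

text \<open>Phase space is \<open>real ^ ('m + 'm)\<close>, of even dimension \<open>2 * CARD('m)\<close>; the two summands
  of the index type are the two blocks.\<close>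

definition symplectic_J :: "real ^ ('m::finite + 'm) ^ ('m + 'm)" where
  "symplectic_J = (\<chi> i j. case (i, j) of
       (Inl a, Inr b) \<Rightarrow> (if a = b then 1 else 0)
     | (Inr a, Inl b) \<Rightarrow> (if a = b then - 1 else 0)
     | _ \<Rightarrow> 0)"

definition hamiltonian_field ::
    "((real ^ ('m::finite + 'm)) \<times> real \<Rightarrow> real) \<Rightarrow> real ^ ('m + 'm) \<Rightarrow> real \<Rightarrow> real ^ ('m + 'm)" where
  "hamiltonian_field H x \<mu> =
     symplectic_J *v (\<chi> i. frechet_derivative (\<lambda>y. H (y, \<mu>)) (at x) (axis i 1))"

definition charpoly :: "complex ^ 'n ^ 'n \<Rightarrow> complex poly" where
  "charpoly A = det (\<chi> i j. (if i = j then [:0, 1:] else 0) - [:A $ i $ j:])"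

text \<open>Number of complex eigenvalues in \<open>S\<close>, counted with algebraic multiplicity.\<close>

definition eigenvalue_count :: "real ^ 'n ^ 'n \<Rightarrow> complex set \<Rightarrow> nat" where
  "eigenvalue_count A S =
     (let p = charpoly (map_matrix complex_of_real A) in \<Sum>z\<in>{z\<in>S. poly p z = 0}. order z p)"

definition hyperbolic_saddle ::
    "(real ^ 'n \<Rightarrow> real ^ 'n) \<Rightarrow> real ^ 'n \<Rightarrow> nat \<Rightarrow> nat \<Rightarrow> bool" where
  "hyperbolic_saddle g p n_s n_u \<longleftrightarrow>
     g p = 0 \<and>
     eigenvalue_count (jacobian g (at p)) {z. Re z = 0} = 0 \<and>
     eigenvalue_count (jacobian g (at p)) {z. Re z < 0} = n_s \<and>
     eigenvalue_count (jacobian g (at p)) {z. Re z > 0} = n_u \<and>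
     n_s > 0 \<and> n_u > 0"

definition homoclinic_orbit ::
    "('a::real_normed_vector \<Rightarrow> 'a) \<Rightarrow> 'a \<Rightarrow> (real \<Rightarrow> 'a) \<Rightarrow> bool" where
  "homoclinic_orbit g p x \<longleftrightarrow>
     (\<forall>t. (x has_vector_derivative g (x t)) (at t)) \<and>
     (x \<longlongrightarrow> p) at_top \<and> (x \<longlongrightarrow> p) at_bot \<and> (\<exists>t. x t \<noteq> p)"

definition bounded_solutions ::
    "(real \<Rightarrow> 'a::real_normed_vector \<Rightarrow> 'a) \<Rightarrow> (real \<Rightarrow> 'a) set" where
  "bounded_solutions A =
     {\<xi>. (\<forall>t. (\<xi> has_vector_derivative A t (\<xi> t)) (at t)) \<and> bounded (range \<xi>)}"

text \<open>Explicit coordinates are used because function types carry no vector space structure in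
  the library.\<close>

definition two_element_basis ::
    "(real \<Rightarrow> 'a::real_vector) set \<Rightarrow> (real \<Rightarrow> 'a) \<Rightarrow> (real \<Rightarrow> 'a) \<Rightarrow> bool" where
  "two_element_basis V \<phi>\<^sub>1 \<phi>\<^sub>2 \<longleftrightarrow>
     \<phi>\<^sub>1 \<in> V \<and> \<phi>\<^sub>2 \<in> V \<and>
     (\<forall>c\<^sub>1 c\<^sub>2. (\<forall>t. c\<^sub>1 *\<^sub>R \<phi>\<^sub>1 t + c\<^sub>2 *\<^sub>R \<phi>\<^sub>2 t = 0) \<longrightarrow> c\<^sub>1 = 0 \<and> c\<^sub>2 = 0) \<and>
     (\<forall>\<xi>\<in>V. \<exists>c\<^sub>1 c\<^sub>2. \<forall>t. \<xi> t = c\<^sub>1 *\<^sub>R \<phi>\<^sub>1 t + c\<^sub>2 *\<^sub>R \<phi>\<^sub>2 t)"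

definition second_derivative ::
    "('a::real_normed_vector \<Rightarrow> 'a) \<Rightarrow> 'a \<Rightarrow> 'a \<Rightarrow> 'a \<Rightarrow> 'a" where
  "second_derivative g x v w =
     frechet_derivative (\<lambda>y. frechet_derivative g (at y) v) (at x) w"

text \<open>The saddle-node bifurcation of homoclinic orbits to the origin at parameter value 0, realised
  by \<open>\<phi>\<close> on the open interval \<open>I\<close>: \<open>x \<alpha>\<close> is the homoclinic orbit at parameter value \<open>\<phi> \<alpha>\<close>.
  The remainder is of the stated order as \<open>\<alpha>\<close> tends to 0, uniformly in \<open>t\<close>.\<close>

definition saddle_node_homoclinic ::
    "('a::real_normed_vector \<Rightarrow> real \<Rightarrow> 'a) \<Rightarrow> (real \<Rightarrow> 'a) \<Rightarrow> (real \<Rightarrow> 'a) \<Rightarrow>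
     real set \<Rightarrow> (real \<Rightarrow> real) \<Rightarrow> bool" where
  "saddle_node_homoclinic f xh \<phi>\<^sub>2 I \<phi> \<longleftrightarrow>
     open I \<and> is_interval I \<and> 0 \<in> I \<and>
     (\<forall>\<alpha>\<in>I. \<phi> differentiable (at \<alpha>)) \<and> (deriv \<phi>) differentiable (at 0) \<and>
     \<phi> 0 = 0 \<and> deriv \<phi> 0 = 0 \<and> deriv (deriv \<phi>) 0 \<noteq> 0 \<and>
     (\<exists>x :: real \<Rightarrow> real \<Rightarrow> 'a.
        x 0 = xh \<and>
        (\<forall>\<alpha>\<in>I. homoclinic_orbit (\<lambda>y. f y (\<phi> \<alpha>)) 0 (x \<alpha>)) \<and>
        (\<exists>C. \<forall>\<^sub>F \<alpha> in nhds 0. \<forall>t.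
           norm (x \<alpha> t - xh t - \<alpha> *\<^sub>R \<phi>\<^sub>2 t) \<le> C * sqrt (\<alpha> ^ 4 + \<bar>\<phi> \<alpha>\<bar> ^ 2)))"

definition supercritical :: "(real \<Rightarrow> real) \<Rightarrow> bool" where
  "supercritical \<phi> \<longleftrightarrow> deriv (deriv \<phi>) 0 > 0"

definition subcritical :: "(real \<Rightarrow> real) \<Rightarrow> bool" where
  "subcritical \<phi> \<longleftrightarrow> deriv (deriv \<phi>) 0 < 0"

end

theory Submission
  imports Defs "HOL-Complex_Analysis.Great_Picard" "HOL-Computational_Algebra.Fundamental_Theorem_Algebra"
begin

text \<open>Only existence has to be shown, so the parameter may be prescribed as \<open>\<mu> = \<nu> \<alpha>\<^sup>2\<close> with
  \<open>\<nu> = - b\<^sub>2 / a\<^sub>2\<close>, and the orbit is sought as \<open>x = xh + \<alpha> \<phi>\<^sub>2 + \<alpha>\<^sup>2 v\<close>. With \<open>\<rho>\<close> a positive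
  integrable weight, \<open>\<psi> = J \<xi>\<close> solves the adjoint equation whenever \<open>\<xi>\<close> solves the variational
  equation, so bordering the latter by \<open>\<rho> J \<eta>\<close> and \<open>\<rho> J \<phi>\<^sub>2\<close>, where \<open>\<eta> = \<phi>\<^sub>1 - \<kappa> \<phi>\<^sub>2\<close> is
  \<open>\<rho>\<close>-orthogonal to \<open>\<phi>\<^sub>2\<close>, gives an injective operator. Because the linearization tends to a
  hyperbolic matrix at both ends, that operator is a compact perturbation of the identity after
  inverting the constant-coefficient part; hence it is invertible on bounded functions, and neither
  flows nor exponential dichotomies are needed. The choice of \<open>\<nu>\<close> makes the solvability condition
  for \<open>\<phi>\<^sub>2\<close> hold at lowest order, and since \<open>b\<^sub>2 \<noteq> 0\<close> the next order determines the
  \<open>\<phi>\<^sub>2\<close>-component of \<open>v\<close>, so \<open>v\<close> is the fixed point of a map with contraction constant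
  \<open>O(\<alpha>)\<close>. The multiplier of \<open>\<rho> J \<eta>\<close> vanishes by conservation of energy.\<close>

section \<open>Multivariate power series\<close>

text \<open>The rescaling comes from the solvability condition for \<open>\<phi>\<^sub>2\<close>.
  With \<open>\<mu> = \<nu> \<alpha>\<^sup>2\<close> its terms of order
  \<open>\<alpha>\<^sup>2\<close> add up to \<open>- \<nu> a\<^sub>2 - b\<^sub>2\<close>. The zero
  of this expression is the prescribed \<open>\<nu>\<close>, and the second derivative
  \<open>2 \<nu>\<close> of the parabola has the sign opposite to
  \<open>a\<^sub>2 b\<^sub>2\<close>, which is the criterion for super- or subcriticality. One order
  higher, the coefficient of the \<open>\<phi>\<^sub>2\<close>-component of \<open>v\<close> is
  \<open>- 2 b\<^sub>2\<close>; the factor 2 arises because the quadratic term is differentiated.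
  Passing from \<open>\<phi>\<^sub>1\<close> to \<open>\<eta>\<close> makes the Gram matrix of the
  bordering diagonal, so each multiplier is read off from a single pairing. No rate of decay is
  computed anywhere. Solutions are shown only to be bounded and to tend to 0, and the weight makes
  their pairings converge. Smoothness enters through bounds on balls for the field and its first two
  derivatives, which are uniform in time because the orbit is bounded.\<close>

definition multi_indices :: "('a::euclidean_space \<Rightarrow> nat) set" where
  "multi_indices = {k. \<forall>b. b \<notin> Basis \<longrightarrow> k b = 0}"

definition monomial :: "('a::euclidean_space \<Rightarrow> nat) \<Rightarrow> 'a \<Rightarrow> real" where
  "monomial k y = (\<Prod>b\<in>Basis. (y \<bullet> b) ^ k b)"

definition power_series_at :: "('a::euclidean_space \<Rightarrow> real) \<Rightarrow> 'a \<Rightarrow> (('a \<Rightarrow> nat) \<Rightarrow> real) \<Rightarrow> real \<Rightarrow> bool" where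
  "power_series_at g p c r \<longleftrightarrow> r > 0 \<and> (\<forall>x\<in>ball p r. ((\<lambda>k. c k * monomial k (x - p)) has_sum g x) multi_indices)"

lemma real_analytic_iff:
  fixes g :: "'a::euclidean_space \<Rightarrow> real"
  shows "real_analytic g \<longleftrightarrow> (\<forall>p. \<exists>c r. power_series_at g p c r)"
proof -
  have *: "(\<exists>r>0. \<exists>c. Q r c) \<longleftrightarrow> (\<exists>c r. r > 0 \<and> Q r c)"
    for Q :: "real \<Rightarrow> (('a \<Rightarrow> nat) \<Rightarrow> real) \<Rightarrow> bool"
    by blast
  show ?thesis
    unfolding real_analytic_def power_series_at_def multi_indices_def monomial_def * ..
qed

abbreviation total_degree :: "('a::euclidean_space \<Rightarrow> nat) \<Rightarrow> nat" where
  "total_degree k \<equiv> \<Sum>b\<in>Basis. k b"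

lemma abs_monomial_le:
  assumes "\<And>b. b \<in> Basis \<Longrightarrow> \<bar>y \<bullet> b\<bar> \<le> q"
  shows "\<bar>monomial k y\<bar> \<le> q ^ total_degree k"
proof -
  have "\<bar>monomial k y\<bar> = (\<Prod>b\<in>Basis. \<bar>y \<bullet> b\<bar> ^ k b)"
    by (simp add: monomial_def abs_prod power_abs)
  also have "\<dots> \<le> (\<Prod>b\<in>Basis. q ^ k b)"
    using assms by (intro prod_mono) (auto intro!: power_mono)
  finally show ?thesis by (simp add: power_sum)
qed

text \<open>At the diagonal point \<open>p + s (1, ..., 1)\<close> every monomial equals
  \<open>s\<close> to its total degree, and an unconditionally summable real family is absolutely
  summable. Dividing \<open>r\<close> by twice the dimension keeps this point in the ball.\<close>

lemma power_series_at_abs_summable: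
  fixes g :: "'a::euclidean_space \<Rightarrow> real"
  assumes "power_series_at g p c r"
  obtains s where "s > 0" "s \<le> r" "(\<lambda>k. \<bar>c k\<bar> * s ^ total_degree k) summable_on multi_indices"
proof -
  have r: "r > 0" using assms by (simp add: power_series_at_def)
  define s where "s = r / (2 * DIM('a))"
  have s: "s > 0" using r by (simp add: s_def)
  have D1: "real DIM('a) \<ge> 1" using DIM_positive[where 'a='a] by linarith
  have sr: "s \<le> r" proof -
    have "r * 1 \<le> r * (2 * real DIM('a))" using r D1 by (intro mult_left_mono) linarith+
    then show ?thesis by (simp add: s_def divide_le_eq)
  qed
  define y :: 'a where "y = s *\<^sub>R (\<Sum>b\<in>Basis. b)"
  have yb: "y \<bullet> b = s" if "b \<in> Basis" for b
    using that by (simp add: y_def inner_sum_left inner_Basis if_distrib cong: if_cong)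
  have "norm y \<le> s * (\<Sum>b\<in>Basis. norm (b::'a))"
    unfolding y_def norm_scaleR using s by (intro mult_mono norm_sum) auto
  also have "\<dots> = r / 2" using DIM_positive[where 'a='a] by (simp add: s_def)
  finally have "p + y \<in> ball p r" using r by (simp add: dist_norm)
  then have "((\<lambda>k. c k * monomial k y) has_sum g (p + y)) multi_indices"
    using assms unfolding power_series_at_def by force
  then have "(\<lambda>k. c k * monomial k y) summable_on multi_indices" by (rule has_sum_imp_summable)
  moreover have "monomial k y = s ^ total_degree k" for k
    by (simp add: monomial_def yb power_sum)
  ultimately have "(\<lambda>k. c k * s ^ total_degree k) summable_on multi_indices" by simp
  then have "(\<lambda>k. norm (c k * s ^ total_degree k)) summable_on multi_indices"
    by (rule summable_on_iff_abs_summable_on_real[THEN iffD1])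
  then have "(\<lambda>k. \<bar>c k\<bar> * s ^ total_degree k) summable_on multi_indices"
    using s by (simp add: abs_mult)
  with s sr that show thesis by blast
qed

lemma has_sum_abs_le:
  fixes f h :: "'b \<Rightarrow> real"
  assumes "(f has_sum a) A" "(h has_sum b) A" "\<And>k. k \<in> A \<Longrightarrow> \<bar>f k\<bar> \<le> h k"
  shows "\<bar>a\<bar> \<le> b"
proof -
  have "a \<le> b" by (rule has_sum_mono[OF assms(1,2)]) (use assms(3) abs_le_D1 in blast)
  moreover have "- a \<le> b"
    by (rule has_sum_mono[where f = "\<lambda>k. - f k" and g = h and A = A])
      (use assms in \<open>auto simp: has_sum_uminus abs_le_iff\<close>)
  ultimately show ?thesis by simp
qed

lemma has_sum_minus:
  fixes f h :: "'b \<Rightarrow> real"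
  assumes "(f has_sum a) A" "(h has_sum b) A"
  shows "((\<lambda>k. f k - h k) has_sum (a - b)) A"
  using has_sum_add[OF assms(1) has_sum_uminusI[OF assms(2)]] by simp

definition unit_index :: "'a \<Rightarrow> 'a \<Rightarrow> nat" where "unit_index b = (\<lambda>_. 0)(b := 1)"

lemma total_degree_le_1_cases:
  fixes k :: "'a::euclidean_space \<Rightarrow> nat"
  assumes "k \<in> multi_indices" "total_degree k < 2"
  shows "k \<in> insert (\<lambda>_. 0) (unit_index ` Basis)"
proof (cases "total_degree k = 0")
  case True
  then have "\<forall>b\<in>Basis. k b = 0" by simp
  then have "k = (\<lambda>_. 0)" using assms(1) by (auto simp: multi_indices_def)
  then show ?thesis by simp
next
  case False
  then have "total_degree k = Suc 0" using assms(2) by linarith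
  then obtain b where b: "b \<in> Basis" "k b = Suc 0" "\<forall>b'\<in>Basis. b \<noteq> b' \<longrightarrow> k b' = 0"
    by (subst (asm) sum_eq_Suc0_iff) auto
  then have "k = unit_index b" using assms(1) unfolding multi_indices_def unit_index_def
    by (intro ext) (metis (mono_tags, lifting) One_nat_def fun_upd_apply mem_Collect_eq)
  then show ?thesis using b by blast
qed

lemma monomial_unit_index: "b \<in> Basis \<Longrightarrow> monomial (unit_index b) y = y \<bullet> b"
  unfolding monomial_def unit_index_def
  by (subst prod.remove[of _ b]) auto

text \<open>Once the terms of degree 0 and 1 are split off, every remaining term has degree at least
  2. For \<open>norm y < s\<close> it is therefore at most \<open>(norm y / s)^2\<close> times the
  corresponding term of the absolutely convergent series, which gives a quadratic remainder.\<close>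

lemma power_series_at_has_derivative:
  fixes g :: "'a::euclidean_space \<Rightarrow> real"
  assumes "power_series_at g p c r"
  shows "(g has_derivative (\<lambda>h. \<Sum>b\<in>Basis. (h \<bullet> b) * c (unit_index b))) (at p)"
proof -
  obtain s where s: "s > 0" "s \<le> r" and sum: "(\<lambda>k. \<bar>c k\<bar> * s ^ total_degree k) summable_on multi_indices"
    using power_series_at_abs_summable[OF assms] .
  define F where "F = insert (\<lambda>_. 0) (unit_index ` (Basis :: 'a set))"
  have F: "finite F" "F \<subseteq> multi_indices" by (auto simp: F_def multi_indices_def unit_index_def)
  define L where "L = (\<lambda>h::'a. \<Sum>b\<in>Basis. (h \<bullet> b) * c (unit_index b))"
  have sumF: "(\<Sum>k\<in>F. c k * monomial k y) = c (\<lambda>_. 0) + L y" for y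
  proof -
    have "inj_on unit_index (Basis::'a set)"
      unfolding inj_on_def unit_index_def fun_upd_def by (metis zero_neq_one)
    moreover have "(\<lambda>_. 0) \<notin> unit_index ` (Basis::'a set)"
      unfolding unit_index_def image_iff by (metis fun_upd_same zero_neq_one)
    ultimately show ?thesis unfolding F_def L_def
      by (simp add: sum.reindex monomial_unit_index monomial_def[of "\<lambda>_. 0"] mult.commute cong: sum.cong)
  qed
  define M where "M = (\<Sum>\<^sub>\<infinity>k\<in>multi_indices - F. \<bar>c k\<bar> * s ^ total_degree k)"
  have M: "((\<lambda>k. \<bar>c k\<bar> * s ^ total_degree k) has_sum M) (multi_indices - F)"
    unfolding M_def by (intro has_sum_infsum summable_on_subset_banach[OF sum]) auto
  have rem: "\<bar>g (p + y) - (c (\<lambda>_. 0) + L y)\<bar> \<le> (norm y)\<^sup>2 * (M / s\<^sup>2)" if y: "norm y < s" for y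
  proof -
    have "p + y \<in> ball p r" using y s by (simp add: dist_norm)
    then have "((\<lambda>k. c k * monomial k y) has_sum g (p + y)) multi_indices"
      using assms unfolding power_series_at_def by force
    from has_sum_Diff[OF this has_sum_finite[OF F(1)] F(2)]
    have 1: "((\<lambda>k. c k * monomial k y) has_sum (g (p + y) - (c (\<lambda>_. 0) + L y))) (multi_indices - F)"
      by (simp add: sumF)
    have 2: "((\<lambda>k. (norm y / s)\<^sup>2 * (\<bar>c k\<bar> * s ^ total_degree k)) has_sum (norm y / s)\<^sup>2 * M) (multi_indices - F)"
      by (rule has_sum_cmult_right[OF M])
    have "\<bar>g (p + y) - (c (\<lambda>_. 0) + L y)\<bar> \<le> (norm y / s)\<^sup>2 * M"
    proof (rule has_sum_abs_le[OF 1 2])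
      fix k assume k: "k \<in> multi_indices - F"
      then have d: "total_degree k \<ge> 2" using total_degree_le_1_cases[of k] unfolding F_def by force
      have "\<bar>monomial k y\<bar> \<le> norm y ^ total_degree k"
        by (rule abs_monomial_le) (simp add: Basis_le_norm)
      also have "\<dots> = (norm y / s) ^ total_degree k * s ^ total_degree k"
        using s by (simp add: power_divide)
      also have "\<dots> \<le> (norm y / s)\<^sup>2 * s ^ total_degree k"
        using s y d by (intro mult_right_mono power_decreasing) auto
      finally have "\<bar>c k\<bar> * \<bar>monomial k y\<bar> \<le> \<bar>c k\<bar> * ((norm y / s)\<^sup>2 * s ^ total_degree k)"
        by (intro mult_left_mono) auto
      then show "\<bar>c k * monomial k y\<bar> \<le> (norm y / s)\<^sup>2 * (\<bar>c k\<bar> * s ^ total_degree k)"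
        by (simp add: abs_mult mult_ac)
    qed
    then show ?thesis by (simp add: power_divide)
  qed
  have L0: "L 0 = 0" by (simp add: L_def)
  have g0: "g p = c (\<lambda>_. 0)" using rem[of 0] s L0 by simp
  have "(g has_derivative L) (at p)"
  proof (rule has_derivativeI_sandwich[of s])
    show "bounded_linear L" unfolding L_def
      by (intro bounded_linear_sum bounded_linear_mult_const bounded_linear_inner_left)
    show "((\<lambda>y. norm (y - p) * (M / s\<^sup>2)) \<longlongrightarrow> 0) (at p)"
      by (rule tendsto_eq_intros tendsto_norm_zero LIM_zero tendsto_ident_at refl)+ simp
    fix y assume "y \<noteq> p" "dist y p < s"
    then show "norm (g y - g p - L (y - p)) / norm (y - p) \<le> norm (y - p) * (M / s\<^sup>2)"
      using rem[of "y - p"] by (simp add: dist_norm g0 divide_le_eq power2_eq_square diff_diff_eq mult_ac)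
  qed (use s in auto)
  then show ?thesis by (simp add: L_def)
qed

text \<open>Pays for the quadratic factor that appears when the error of termwise differentiation is
  estimated on half the radius.\<close>

lemma two_power_ge_square: "real n ^ 2 \<le> 2 * 2 ^ n"
proof (induction n rule: less_induct)
  case (less n)
  show ?case
  proof (cases "n < 4")
    case True
    then have "n = 0 \<or> n = 1 \<or> n = 2 \<or> n = 3" by linarith
    then show ?thesis by auto
  next
    case False
    then obtain m where m: "n = Suc m" "m \<ge> 3" by (cases n) auto
    have "real m * (real m - 2) \<ge> 3 * 1" using m by (intro mult_mono) auto
    then have "real (Suc m) ^ 2 \<le> 2 * real m ^ 2" by (simp add: power2_eq_square algebra_simps)
    also have "\<dots> \<le> 2 * (2 * 2 ^ m)" using less.IH[of m] m by simp
    finally show ?thesis using m by simp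
  qed
qed

text \<open>Termwise differentiation along \<open>b\<close>. The difference quotient is compared
  with the differentiated series, and the polynomial factors in \<open>k b\<close> are absorbed by
  \<open>2 ^ total_degree k\<close>, gained by halving the radius. Since \<open>g\<close> is
  differentiable near \<open>p\<close> as well, the limit of the quotient is the value of
  \<open>frechet_derivative\<close> throughout the ball.\<close>

lemma power_series_at_partial:
  fixes g :: "'a::euclidean_space \<Rightarrow> real"
  assumes g: "power_series_at g p c r" and diff: "\<And>x. g differentiable (at x)" and b: "b \<in> Basis"
  shows "\<exists>r'. power_series_at (\<lambda>x. frechet_derivative g (at x) b) p
           (\<lambda>k. real (Suc (k b)) * c (k(b := Suc (k b)))) r'"
proof -
  obtain s where s: "s > 0" "s \<le> r" and sum: "(\<lambda>k. \<bar>c k\<bar> * s ^ total_degree k) summable_on multi_indices"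
    using power_series_at_abs_summable[OF g] .
  define q where "q = s / 2"
  have q: "q > 0" using s by (simp add: q_def)
  have qs: "q ^ n * 2 ^ n = s ^ n" for n by (simp add: q_def flip: power_mult_distrib)
  define M where "M = (\<Sum>\<^sub>\<infinity>k\<in>multi_indices. \<bar>c k\<bar> * s ^ total_degree k)"
  have M: "((\<lambda>k. \<bar>c k\<bar> * s ^ total_degree k) has_sum M) multi_indices"
    unfolding M_def by (intro has_sum_infsum sum)
  define P where "P k y = (\<Prod>b'\<in>Basis - {b}. (y \<bullet> b') ^ k b')" for k and y :: 'a
  have mono: "monomial k y = (y \<bullet> b) ^ k b * P k y" for k y
    unfolding monomial_def P_def by (rule prod.remove) (use b in auto)
  have Pq: "\<bar>P k y\<bar> \<le> q ^ (\<Sum>b'\<in>Basis - {b}. k b')" if "norm y < q" for k y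
  proof -
    have "\<bar>P k y\<bar> = (\<Prod>b'\<in>Basis - {b}. \<bar>y \<bullet> b'\<bar> ^ k b')"
      by (simp add: P_def abs_prod power_abs)
    also have "\<dots> \<le> (\<Prod>b'\<in>Basis - {b}. q ^ k b')"
      using Basis_le_norm[of _ y] that by (intro prod_mono) (force intro!: power_mono)+
    finally show ?thesis by (simp add: power_sum)
  qed
  have deg: "total_degree k = k b + (\<Sum>b'\<in>Basis - {b}. k b')" for k :: "'a \<Rightarrow> nat"
    by (rule sum.remove) (use b in auto)
  \<comment> \<open>The derivative along \<open>b\<close> of the term with index \<open>k\<close>.
    At \<open>k b = 0\<close> the truncated exponent does no harm, since the factor
    \<open>real (k b)\<close> is 0.\<close>
  define T where "T k y = c k * (real (k b) * (y \<bullet> b) ^ (k b - 1) * P k y)" for k y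
  have "((\<lambda>k. (real (Suc (k b)) * c (k(b := Suc (k b)))) * monomial k (x - p)) has_sum
          frechet_derivative g (at x) b) multi_indices" if x: "x \<in> ball p q" for x
  proof -
    define y where "y = x - p"
    have y: "norm y < q" using x by (simp add: y_def dist_norm norm_minus_commute)
    have yb: "\<bar>y \<bullet> b\<bar> \<le> q" using Basis_le_norm[OF b, of y] y by simp
    have Tb: "\<bar>T k y\<bar> \<le> (1 / q) * (\<bar>c k\<bar> * s ^ total_degree k)" for k
    proof (cases "k b")
      case 0 then show ?thesis using s q by (simp add: T_def)
    next
      case (Suc j)
      have "real (k b) \<le> 2 ^ total_degree k"
        using deg[of k] less_exp[of "total_degree k"] 
        by (metis add_leE less_imp_le of_nat_le_iff of_nat_numeral of_nat_power order_trans le_add1)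
      then have "real (k b) * \<bar>y \<bullet> b\<bar> ^ j * \<bar>P k y\<bar> \<le> 2 ^ total_degree k * q ^ j * q ^ (\<Sum>b'\<in>Basis - {b}. k b')"
        using Pq[OF y] yb q by (intro mult_mono power_mono) auto
      also have "\<dots> = s ^ total_degree k / q"
        using q deg[of k] Suc qs[of "total_degree k"] by (simp add: power_add field_simps)
      finally have "\<bar>c k\<bar> * (real (k b) * \<bar>y \<bullet> b\<bar> ^ j * \<bar>P k y\<bar>) \<le> \<bar>c k\<bar> * (s ^ total_degree k / q)"
        by (intro mult_left_mono) auto
      then show ?thesis by (simp add: T_def Suc abs_mult power_abs mult_ac)
    qed
    have "(\<lambda>k. norm (T k y)) summable_on multi_indices"
      by (rule Infinite_Sum.abs_summable_on_comparison_test'[of "\<lambda>k. (1 / q) * (\<bar>c k\<bar> * s ^ total_degree k)"])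
        (rule summable_on_cmult_right[OF sum], use Tb in simp)
    then obtain D where D: "((\<lambda>k. T k y) has_sum D) multi_indices"
      using summable_on_iff_abs_summable_on_real summable_iff_has_sum_infsum by blast
    have quot: "\<bar>(g (x + h *\<^sub>R b) - g x) / h - D\<bar> \<le> (\<bar>h\<bar> * 2 / q\<^sup>2) * M"
      if h: "h \<noteq> 0" "norm y + \<bar>h\<bar> < q" for h
    proof -
      have n2: "norm (y + h *\<^sub>R b) \<le> norm y + \<bar>h\<bar>" 
        using norm_triangle_ineq[of y "h *\<^sub>R b"] b by simp
      have hb: "\<bar>y \<bullet> b + h\<bar> \<le> q" using Basis_le_norm[OF b, of "y + h *\<^sub>R b"] b n2 h(2)
        by (simp add: inner_add_left)
      have "x \<in> ball p r" "x + h *\<^sub>R b \<in> ball p r"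
        using n2 h(2) y s by (auto simp: y_def dist_norm norm_minus_commute q_def algebra_simps)
      then have 1: "((\<lambda>k. c k * monomial k y) has_sum g x) multi_indices"
         and 2: "((\<lambda>k. c k * monomial k (y + h *\<^sub>R b)) has_sum g (x + h *\<^sub>R b)) multi_indices"
        using g unfolding power_series_at_def y_def by (auto simp: algebra_simps)
      have 3: "((\<lambda>k. (1 / h) * (c k * monomial k (y + h *\<^sub>R b) - c k * monomial k y) - T k y) has_sum
          (1 / h) * (g (x + h *\<^sub>R b) - g x) - D) multi_indices"
        by (intro has_sum_minus has_sum_cmult_right 1 2 D)
      have 4: "((\<lambda>k. (\<bar>h\<bar> * 2 / q\<^sup>2) * (\<bar>c k\<bar> * s ^ total_degree k)) has_sum (\<bar>h\<bar> * 2 / q\<^sup>2) * M) multi_indices"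
        by (rule has_sum_cmult_right[OF M])
      have "\<bar>(1 / h) * (g (x + h *\<^sub>R b) - g x) - D\<bar> \<le> (\<bar>h\<bar> * 2 / q\<^sup>2) * M"
      proof (rule has_sum_abs_le[OF 3 4])
        fix k :: "'a \<Rightarrow> nat"
        let ?z = "y \<bullet> b" and ?n = "k b" and ?m = "\<Sum>b'\<in>Basis - {b}. k b'"
        have Peq: "P k (y + h *\<^sub>R b) = P k y"
          unfolding P_def by (rule prod.cong) (use b in \<open>auto simp: inner_add_left inner_Basis\<close>)
        have eq: "(1 / h) * (c k * monomial k (y + h *\<^sub>R b) - c k * monomial k y) - T k y =
            c k * P k y * (((?z + h) ^ ?n - ?z ^ ?n) / h - real ?n * ?z ^ (?n - Suc 0))"
          unfolding mono Peq T_def using b by (simp add: inner_add_left field_simps)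
        have td: "\<bar>((?z + h) ^ ?n - ?z ^ ?n) / h - real ?n * ?z ^ (?n - Suc 0)\<bar>
            \<le> real ?n * real (?n - Suc 0) * q ^ (?n - 2) * \<bar>h\<bar>"
          using lemma_termdiff3[of h ?z q ?n] h(1) yb hb by simp
        have *: "q ^ ?m * (real ?n * real (?n - Suc 0) * q ^ (?n - 2)) \<le> 2 / q\<^sup>2 * s ^ total_degree k"
        proof (cases "?n < 2")
          case True
          then have "?n = 0 \<or> ?n - Suc 0 = 0" by linarith
          then show ?thesis using s by auto
        next
          case False
          then obtain j where j: "?n = j + 2" by (metis add.commute le_Suc_ex not_le)
          have "real ?n * real (?n - Suc 0) \<le> real (total_degree k) * real (total_degree k)"
            using deg[of k] by (intro mult_mono of_nat_mono) (linarith | simp)+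
          also have "\<dots> \<le> 2 * 2 ^ total_degree k"
            using two_power_ge_square[of "total_degree k"] by (simp only: power2_eq_square)
          finally have "q ^ ?m * (real ?n * real (?n - Suc 0) * q ^ j) \<le> q ^ ?m * (2 * 2 ^ total_degree k * q ^ j)"
            using q by (intro mult_left_mono mult_right_mono) auto
          also have "\<dots> = 2 / q\<^sup>2 * (q ^ total_degree k * 2 ^ total_degree k)"
            unfolding deg[of k] j using q by (simp add: power_add power2_eq_square field_simps)
          finally show ?thesis using j qs by simp
        qed
        have "\<bar>(1 / h) * (c k * monomial k (y + h *\<^sub>R b) - c k * monomial k y) - T k y\<bar>
           \<le> \<bar>c k\<bar> * q ^ ?m * (real ?n * real (?n - Suc 0) * q ^ (?n - 2) * \<bar>h\<bar>)"
          unfolding eq abs_mult[of "c k * P k y"] abs_mult[of "c k" "P k y"]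
          using Pq[OF y, of k] td q by (intro mult_mono mult_left_mono) auto
        also have "\<dots> = (\<bar>c k\<bar> * \<bar>h\<bar>) * (q ^ ?m * (real ?n * real (?n - Suc 0) * q ^ (?n - 2)))" by simp
        also have "\<dots> \<le> (\<bar>c k\<bar> * \<bar>h\<bar>) * (2 / q\<^sup>2 * s ^ total_degree k)"
          using * by (intro mult_left_mono) auto
        finally show "\<bar>(1 / h) * (c k * monomial k (y + h *\<^sub>R b) - c k * monomial k y) - T k y\<bar>
            \<le> \<bar>h\<bar> * 2 / q\<^sup>2 * (\<bar>c k\<bar> * s ^ total_degree k)" by (simp add: mult_ac)
      qed
      then show ?thesis by simp
    qed
    have lim: "((\<lambda>h. (g (x + h *\<^sub>R b) - g x) / h) \<longlongrightarrow> D) (at 0)"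
    proof (rule LIM_zero_cancel, rule Lim_null_comparison)
      show "((\<lambda>h. (\<bar>h\<bar> * 2 / q\<^sup>2) * M) \<longlongrightarrow> 0) (at 0)"
        by (rule tendsto_eq_intros tendsto_rabs_zero refl | use q in force)+
      show "\<forall>\<^sub>F h in at 0. norm ((g (x + h *\<^sub>R b) - g x) / h - D) \<le> (\<bar>h\<bar> * 2 / q\<^sup>2) * M"
        unfolding eventually_at by (rule exI[of _ "q - norm y"]) (use quot y in \<open>auto simp: dist_norm\<close>)
    qed
    have "(g has_derivative frechet_derivative g (at x)) (at x)"
      using diff frechet_derivative_works by blast
    then have gd: "(g has_derivative frechet_derivative g (at x)) (at (x + 0 *\<^sub>R b))" by simp
    have "((\<lambda>h. g (x + h *\<^sub>R b)) has_derivative (\<lambda>h. frechet_derivative g (at x) (h *\<^sub>R b))) (at 0)"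
      by (rule has_derivative_compose[where f = "\<lambda>h. x + h *\<^sub>R b" and g = g, OF _ gd])
        (auto intro!: derivative_eq_intros)
    moreover have "(\<lambda>h. frechet_derivative g (at x) (h *\<^sub>R b)) = (*) (frechet_derivative g (at x) b)"
      using linear_frechet_derivative[OF diff] by (auto simp: linear_scale)
    ultimately have "((\<lambda>h. g (x + h *\<^sub>R b)) has_real_derivative frechet_derivative g (at x) b) (at 0)"
      by (simp add: has_field_derivative_def)
    then have "((\<lambda>h. (g (x + h *\<^sub>R b) - g x) / h) \<longlongrightarrow> frechet_derivative g (at x) b) (at 0)"
      by (simp add: DERIV_def)
    then have D': "D = frechet_derivative g (at x) b" using lim LIM_unique by blast
    have inj: "inj_on (\<lambda>k::'a\<Rightarrow>nat. k(b := Suc (k b))) multi_indices"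
    proof (rule inj_onI)
      fix k l :: "'a \<Rightarrow> nat" assume eq: "k(b := Suc (k b)) = l(b := Suc (l b))"
      show "k = l"
      proof
        fix a show "k a = l a" using fun_cong[OF eq, of a] by (cases "a = b") auto
      qed
    qed
    \<comment> \<open>The shift raises the \<open>b\<close>-entry by one. Indices outside its image
      have \<open>k b = 0\<close> and contribute 0, so the sum may be restricted to the image and
      then reindexed.\<close>
    have "((\<lambda>k. T k y) has_sum D) ((\<lambda>k::'a\<Rightarrow>nat. k(b := Suc (k b))) ` multi_indices)"
    proof (subst has_sum_cong_neutral[where T = multi_indices and g = "\<lambda>k. T k y"])
      fix k :: "'a \<Rightarrow> nat" assume k: "k \<in> multi_indices - (\<lambda>k. k(b := Suc (k b))) ` multi_indices"
      have "k b = 0"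
      proof (rule ccontr)
        assume "k b \<noteq> 0"
        then have "k = (k(b := k b - 1))(b := Suc ((k(b := k b - 1)) b))" by auto
        moreover have "k(b := k b - 1) \<in> multi_indices" using k b by (auto simp: multi_indices_def)
        ultimately show False using k by blast
      qed
      then show "T k y = 0" by (simp add: T_def)
    next
      show "((\<lambda>k. T k y) has_sum D) multi_indices" by (rule D)
    qed (use b in \<open>auto simp: multi_indices_def split: if_splits\<close>)
    then have "((\<lambda>k. T (k(b := Suc (k b))) y) has_sum D) multi_indices"
      unfolding has_sum_reindex[OF inj] by (simp add: o_def)
    moreover have "T (k(b := Suc (k b))) y = (real (Suc (k b)) * c (k(b := Suc (k b)))) * monomial k y" for k
    proof -
      have "P (k(b := Suc (k b))) y = P k y" unfolding P_def by (rule prod.cong) auto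
      then show ?thesis by (simp add: T_def mono)
    qed
    ultimately show ?thesis by (simp add: D' y_def)
  qed
  then show ?thesis using q unfolding power_series_at_def by blast
qed

lemma real_analytic_differentiable:
  assumes "real_analytic g" shows "g differentiable (at x)"
proof -
  obtain c r where "power_series_at g x c r" using assms real_analytic_iff by metis
  from power_series_at_has_derivative[OF this] show ?thesis by (rule differentiableI)
qed

lemma real_analytic_partial:
  assumes "real_analytic g" "b \<in> Basis"
  shows "real_analytic (\<lambda>x. frechet_derivative g (at x) b)"
  unfolding real_analytic_iff
proof
  fix p
  obtain c r where "power_series_at g p c r" using assms(1) real_analytic_iff by metis
  from power_series_at_partial[OF this real_analytic_differentiable[OF assms(1)] assms(2)]
  show "\<exists>c r. power_series_at (\<lambda>x. frechet_derivative g (at x) b) p c r" by blast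
qed

lemma power_series_at_frechet_derivative:
  assumes "power_series_at g p c r" "b \<in> Basis"
  shows "frechet_derivative g (at p) b = c (unit_index b)"
proof -
  have "frechet_derivative g (at p) = (\<lambda>h. \<Sum>b\<in>Basis. (h \<bullet> b) * c (unit_index b))"
    using power_series_at_has_derivative[OF assms(1)] frechet_derivative_at by metis
  then show ?thesis using assms(2)
    by (simp add: inner_Basis if_distrib[of "\<lambda>x. x * _"] cong: if_cong)
qed

text \<open>Differentiating the series once in each order leads to the same coefficient of
  \<open>c\<close>, the one at the sum of the two unit indices, each time with factor 1 because the
  directions differ.\<close>

lemma real_analytic_partial_commute:
  assumes g: "real_analytic g" and b: "b \<in> Basis" "b' \<in> Basis"
  shows "frechet_derivative (\<lambda>x. frechet_derivative g (at x) b) (at p) b' =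
         frechet_derivative (\<lambda>x. frechet_derivative g (at x) b') (at p) b"
proof (cases "b = b'")
  case False
  obtain c r where c: "power_series_at g p c r" using g real_analytic_iff by metis
  have 1: "(unit_index b')(b := Suc 0) = (unit_index b)(b' := Suc 0)"
    using False by (auto simp: unit_index_def fun_eq_iff)
  obtain r1 where r1: "power_series_at (\<lambda>x. frechet_derivative g (at x) b) p
           (\<lambda>k. real (Suc (k b)) * c (k(b := Suc (k b)))) r1"
    using power_series_at_partial[OF c real_analytic_differentiable[OF g] b(1)] by blast
  obtain r2 where r2: "power_series_at (\<lambda>x. frechet_derivative g (at x) b') p
           (\<lambda>k. real (Suc (k b')) * c (k(b' := Suc (k b')))) r2"
    using power_series_at_partial[OF c real_analytic_differentiable[OF g] b(2)] by blast
  have 0: "unit_index b' b = 0" "unit_index b b' = 0" using False by (auto simp: unit_index_def)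
  show ?thesis
    by (simp only: power_series_at_frechet_derivative[OF r1 b(2)] power_series_at_frechet_derivative[OF r2 b(1)] 0 1)
qed auto

lemma real_analytic_uminus:
  assumes "real_analytic g" shows "real_analytic (\<lambda>x. - g x)"
proof -
  have "power_series_at (\<lambda>x. - g x) p (\<lambda>k. - c k) r" if "power_series_at g p c r" for p c r
    using that unfolding power_series_at_def by (auto dest: has_sum_uminusI)
  then show ?thesis using assms unfolding real_analytic_iff by metis
qed

lemma real_analytic_frechet_derivative_eq:
  fixes g :: "'a::euclidean_space \<Rightarrow> real"
  assumes "real_analytic g"
  shows "frechet_derivative g (at x) v = (\<Sum>b\<in>Basis. (v \<bullet> b) * frechet_derivative g (at x) b)"
proof -
  interpret linear "frechet_derivative g (at x)"
    by (rule linear_frechet_derivative[OF real_analytic_differentiable[OF assms]])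
  have "frechet_derivative g (at x) v = frechet_derivative g (at x) (\<Sum>b\<in>Basis. (v \<bullet> b) *\<^sub>R b)"
    by (simp add: euclidean_representation)
  then show ?thesis by (simp add: sum scale)
qed

lemma real_analytic_continuous_on:
  assumes "real_analytic g" shows "continuous_on S g"
  using real_analytic_differentiable[OF assms]
  by (simp add: continuous_at_imp_continuous_on differentiable_imp_continuous_within)

lemma real_analytic_lipschitz:
  fixes g :: "'a::euclidean_space \<Rightarrow> real"
  assumes g: "real_analytic g"
  obtains C where "C \<ge> 0" "\<And>y. norm y \<le> R \<Longrightarrow> \<bar>g y\<bar> \<le> C"
    "\<And>y v. norm y \<le> R \<Longrightarrow> \<bar>frechet_derivative g (at y) v\<bar> \<le> C * norm v"
    "\<And>y z. norm y \<le> R \<Longrightarrow> norm z \<le> R \<Longrightarrow> \<bar>g y - g z\<bar> \<le> C * norm (y - z)"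
proof -
  have bnd: "\<exists>C. \<forall>y\<in>cball 0 R. \<bar>h y\<bar> \<le> C" if "real_analytic h" for h :: "'a \<Rightarrow> real"
  proof -
    have "compact (h ` cball 0 R)"
      by (intro compact_continuous_image real_analytic_continuous_on that) auto
    then show ?thesis using compact_imp_bounded[THEN bounded_iff[THEN iffD1]] by (metis imageI real_norm_def)
  qed
  from bnd[OF g] obtain C0 where C0: "\<And>y. y \<in> cball 0 R \<Longrightarrow> \<bar>g y\<bar> \<le> C0" by blast
  have "\<forall>b\<in>Basis. \<exists>C. \<forall>y\<in>cball 0 R. \<bar>frechet_derivative g (at y) b\<bar> \<le> C"
    using bnd[OF real_analytic_partial[OF g]] by blast
  then obtain B where B: "\<And>b y. b \<in> Basis \<Longrightarrow> y \<in> cball 0 R \<Longrightarrow> \<bar>frechet_derivative g (at y) b\<bar> \<le> B b"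
    by metis
  define C where "C = max (max C0 0) (\<Sum>b\<in>Basis. \<bar>B b\<bar>)"
  have D: "\<bar>frechet_derivative g (at y) v\<bar> \<le> C * norm v" if "norm y \<le> R" for y v
  proof -
    have "\<bar>frechet_derivative g (at y) v\<bar> \<le> (\<Sum>b\<in>Basis. \<bar>(v \<bullet> b) * frechet_derivative g (at y) b\<bar>)"
      by (subst real_analytic_frechet_derivative_eq[OF g]) (rule sum_abs)
    also have "\<dots> \<le> (\<Sum>b\<in>Basis. norm v * \<bar>B b\<bar>)"
    proof (rule sum_mono)
      fix b :: 'a assume b: "b \<in> Basis"
      have "\<bar>frechet_derivative g (at y) b\<bar> \<le> \<bar>B b\<bar>" using B[OF b, of y] that by auto
      then show "\<bar>(v \<bullet> b) * frechet_derivative g (at y) b\<bar> \<le> norm v * \<bar>B b\<bar>"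
        unfolding abs_mult using Basis_le_norm[OF b, of v] by (intro mult_mono) auto
    qed
    also have "\<dots> = (\<Sum>b\<in>Basis. \<bar>B b\<bar>) * norm v" by (simp add: sum_distrib_left mult.commute)
    also have "\<dots> \<le> C * norm v" by (intro mult_right_mono) (auto simp: C_def)
    finally show ?thesis .
  qed
  show thesis
  proof (rule that[of C])
    show "C \<ge> 0" by (simp add: C_def)
    show "\<bar>g y\<bar> \<le> C" if "norm y \<le> R" for y using C0[of y] that by (simp add: C_def)
    show "\<bar>frechet_derivative g (at y) v\<bar> \<le> C * norm v" if "norm y \<le> R" for y v
      by (rule D[OF that])
    show "\<bar>g y - g z\<bar> \<le> C * norm (y - z)" if "norm y \<le> R" "norm z \<le> R" for y z
    proof -
      have "norm (g y - g z) \<le> C * norm (y - z)"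
      proof (rule differentiable_bound[of "cball 0 R" g "\<lambda>x. frechet_derivative g (at x)"])
        show "(g has_derivative frechet_derivative g (at x)) (at x within cball 0 R)" for x
          using real_analytic_differentiable[OF g] frechet_derivative_works has_derivative_at_withinI by blast
        show "onorm (frechet_derivative g (at x)) \<le> C" if "x \<in> cball 0 R" for x
          using D[of x] that by (intro onorm_le) auto
      qed (use that in auto)
      then show ?thesis by simp
    qed
  qed
qed

text \<open>The partial derivatives are again analytic, hence Lipschitz on the ball. Along the
  segment from \<open>z\<close> to \<open>y\<close> the derivative therefore differs from the one at
  \<open>z\<close> by at most a multiple of \<open>norm (y - z)\<close>, and the mean value
  inequality supplies the second factor.\<close>

lemma real_analytic_linearization:
  fixes g :: "'a::euclidean_space \<Rightarrow> real"
  assumes g: "real_analytic g"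
  obtains C where "C \<ge> 0"
    "\<And>y z. norm y \<le> R \<Longrightarrow> norm z \<le> R \<Longrightarrow>
       \<bar>g y - g z - frechet_derivative g (at z) (y - z)\<bar> \<le> C * (norm (y - z))\<^sup>2"
proof -
  have "\<forall>b\<in>Basis. \<exists>C\<ge>0. \<forall>y z. norm y \<le> R \<longrightarrow> norm z \<le> R \<longrightarrow>
      \<bar>frechet_derivative g (at y) b - frechet_derivative g (at z) b\<bar> \<le> C * norm (y - z)"
  proof
    fix b :: 'a assume "b \<in> Basis"
    from real_analytic_lipschitz[OF real_analytic_partial[OF g this], of R]
    show "\<exists>C\<ge>0. \<forall>y z. norm y \<le> R \<longrightarrow> norm z \<le> R \<longrightarrow>
      \<bar>frechet_derivative g (at y) b - frechet_derivative g (at z) b\<bar> \<le> C * norm (y - z)"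
      by metis
  qed
  then obtain B where B: "\<And>b. b \<in> Basis \<Longrightarrow> B b \<ge> 0"
     "\<And>b y z. b \<in> Basis \<Longrightarrow> norm y \<le> R \<Longrightarrow> norm z \<le> R \<Longrightarrow>
      \<bar>frechet_derivative g (at y) b - frechet_derivative g (at z) b\<bar> \<le> B b * norm (y - z)"
    by metis
  define C where "C = (\<Sum>b\<in>Basis. B b)"
  have C0: "C \<ge> 0" unfolding C_def using B(1) by (rule sum_nonneg)
  have DL: "\<bar>frechet_derivative g (at y) v - frechet_derivative g (at z) v\<bar> \<le> C * norm (y - z) * norm v"
    if "norm y \<le> R" "norm z \<le> R" for y z v
  proof -
    have "\<bar>frechet_derivative g (at y) v - frechet_derivative g (at z) v\<bar>
       = \<bar>\<Sum>b\<in>Basis. (v \<bullet> b) * (frechet_derivative g (at y) b - frechet_derivative g (at z) b)\<bar>"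
      by (simp add: real_analytic_frechet_derivative_eq[OF g, where v = v] right_diff_distrib sum_subtractf)
    also have "\<dots> \<le> (\<Sum>b\<in>Basis. \<bar>(v \<bullet> b) * (frechet_derivative g (at y) b - frechet_derivative g (at z) b)\<bar>)"
      by (rule sum_abs)
    also have "\<dots> \<le> (\<Sum>b\<in>Basis. norm v * (B b * norm (y - z)))"
      unfolding abs_mult using B that Basis_le_norm[of _ v] by (intro sum_mono mult_mono) auto
    also have "\<dots> = C * norm (y - z) * norm v"
      by (simp add: C_def sum_distrib_right sum_distrib_left mult_ac)
    finally show ?thesis .
  qed
  show thesis
  proof (rule that[OF C0])
    fix y z :: 'a assume yz: "norm y \<le> R" "norm z \<le> R"
    let ?S = "closed_segment z y"
    have S: "x \<in> ?S \<Longrightarrow> norm x \<le> R \<and> norm (x - z) \<le> norm (y - z)" for x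
      using yz closed_segment_subset[of z "cball 0 R" y] segment_bound1[of x z y] by auto
    have "norm (g y - g z - frechet_derivative g (at z) (y - z)) \<le> norm (y - z) * (C * norm (y - z))"
    proof (rule differentiable_bound_linearization[of z y ?S g "\<lambda>x. frechet_derivative g (at x)"])
      show "z + t *\<^sub>R (y - z) \<in> ?S" if "t \<in> {0..1}" for t
        using that by (auto simp: in_segment algebra_simps intro!: exI[of _ t])
      show "(g has_derivative frechet_derivative g (at x)) (at x within ?S)" for x
        using real_analytic_differentiable[OF g] frechet_derivative_works has_derivative_at_withinI by blast
      show "onorm (frechet_derivative g (at x) - frechet_derivative g (at z)) \<le> C * norm (y - z)"
        if "x \<in> ?S" for x
      proof (rule onorm_le)
        fix v
        have "\<bar>frechet_derivative g (at x) v - frechet_derivative g (at z) v\<bar> \<le> C * norm (x - z) * norm v"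
          using DL S[OF that] yz by blast
        also have "\<dots> \<le> C * norm (y - z) * norm v"
          using S[OF that] C0 by (intro mult_right_mono mult_left_mono) auto
        finally show "norm ((frechet_derivative g (at x) - frechet_derivative g (at z)) v) \<le> C * norm (y - z) * norm v"
          by simp
      qed
    qed auto
    then show "\<bar>g y - g z - frechet_derivative g (at z) (y - z)\<bar> \<le> C * (norm (y - z))\<^sup>2"
      by (simp add: power2_eq_square mult_ac)
  qed
qed

section \<open>Analytic maps into Euclidean space\<close>

definition analytic_map :: "('a::euclidean_space \<Rightarrow> real ^ 'n) \<Rightarrow> bool" where
  "analytic_map F \<longleftrightarrow> (\<forall>i. real_analytic (\<lambda>z. F z $ i))"

lemma analytic_map_nth: "analytic_map F \<Longrightarrow> real_analytic (\<lambda>z. F z $ i)"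
  by (simp add: analytic_map_def)

lemma has_derivative_vec_nth_iff:
  fixes F :: "'a::real_normed_vector \<Rightarrow> real ^ 'n"
  shows "(F has_derivative F') (at z) \<longleftrightarrow> (\<forall>i. ((\<lambda>z. F z $ i) has_derivative (\<lambda>v. F' v $ i)) (at z))"
  by (subst has_derivative_componentwise_within) (simp add: Basis_vec_def inner_axis)

lemma analytic_map_frechet_derivative_nth:
  fixes F :: "'a::euclidean_space \<Rightarrow> real ^ 'n"
  assumes "analytic_map F"
  shows "(F has_derivative (\<lambda>v. \<chi> i. frechet_derivative (\<lambda>z. F z $ i) (at z) v)) (at z)"
    and "frechet_derivative F (at z) v $ i = frechet_derivative (\<lambda>z. F z $ i) (at z) v"
proof -
  show *: "(F has_derivative (\<lambda>v. \<chi> i. frechet_derivative (\<lambda>z. F z $ i) (at z) v)) (at z)"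
    using real_analytic_differentiable[OF analytic_map_nth[OF assms]] frechet_derivative_works
    by (auto simp: has_derivative_vec_nth_iff)
  show "frechet_derivative F (at z) v $ i = frechet_derivative (\<lambda>z. F z $ i) (at z) v"
    by (simp flip: frechet_derivative_at[OF *])
qed

lemma analytic_map_has_derivative:
  assumes "analytic_map F" shows "(F has_derivative frechet_derivative F (at z)) (at z)"
  using analytic_map_frechet_derivative_nth(1)[OF assms] frechet_derivative_works differentiableI by blast

lemma analytic_map_partial:
  assumes "analytic_map F" "b \<in> Basis"
  shows "analytic_map (\<lambda>z. frechet_derivative F (at z) b)"
  unfolding analytic_map_def analytic_map_frechet_derivative_nth(2)[OF assms(1)]
  using real_analytic_partial[OF analytic_map_nth[OF assms(1)] assms(2)] by blast

lemma analytic_map_frechet_derivative_eq: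
  fixes F :: "'a::euclidean_space \<Rightarrow> real ^ 'n"
  assumes "analytic_map F"
  shows "frechet_derivative F (at z) v = (\<Sum>b\<in>Basis. (v \<bullet> b) *\<^sub>R frechet_derivative F (at z) b)"
  by (simp add: vec_eq_iff analytic_map_frechet_derivative_nth(2)[OF assms]
      real_analytic_frechet_derivative_eq[OF analytic_map_nth[OF assms], where v = v])

lemma analytic_map_second_derivative:
  fixes F :: "'a::euclidean_space \<Rightarrow> real ^ 'n"
  assumes F: "analytic_map F"
  shows "((\<lambda>y. frechet_derivative F (at y) v) has_derivative
      (\<lambda>u. \<Sum>b\<in>Basis. (v \<bullet> b) *\<^sub>R frechet_derivative (\<lambda>y. frechet_derivative F (at y) b) (at z) u)) (at z)"
  unfolding analytic_map_frechet_derivative_eq[OF F, where v = v]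
  by (intro has_derivative_sum has_derivative_scaleR_right
      analytic_map_has_derivative[OF analytic_map_partial[OF F]]) auto

text \<open>The direction \<open>v\<close> is frozen before the second differentiation. Expanding it
  in the basis turns it into scalar coefficients, and this is the source of linearity, bounds and
  continuity in \<open>v\<close>.\<close>

lemma second_derivative_eq_sum:
  fixes F :: "'a::euclidean_space \<Rightarrow> real ^ 'n"
  assumes F: "analytic_map F"
  shows "frechet_derivative (\<lambda>y. frechet_derivative F (at y) v) (at z) u =
      (\<Sum>b\<in>Basis. (v \<bullet> b) *\<^sub>R frechet_derivative (\<lambda>y. frechet_derivative F (at y) b) (at z) u)"
  by (rule fun_cong[OF frechet_derivative_at[OF analytic_map_second_derivative[OF F], symmetric]])

lemma norm_vec_le_of_nth:
  fixes x :: "real ^ 'n"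
  assumes "\<And>i. \<bar>x $ i\<bar> \<le> B i * a"
  shows "norm x \<le> (\<Sum>i\<in>UNIV. B i) * a"
proof -
  have "norm x \<le> (\<Sum>i\<in>UNIV. \<bar>x $ i\<bar>)" by (rule norm_le_l1_cart)
  also have "\<dots> \<le> (\<Sum>i\<in>UNIV. B i * a)" by (intro sum_mono assms)
  finally show ?thesis by (simp add: sum_distrib_right)
qed

lemma analytic_map_lipschitz:
  fixes F :: "'a::euclidean_space \<Rightarrow> real ^ 'n"
  assumes F: "analytic_map F"
  obtains C where "C \<ge> 0" 
    "\<And>y v. norm y \<le> R \<Longrightarrow> norm (frechet_derivative F (at y) v) \<le> C * norm v"
    "\<And>y z. norm y \<le> R \<Longrightarrow> norm z \<le> R \<Longrightarrow> norm (F y - F z) \<le> C * norm (y - z)"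
    "\<And>y z. norm y \<le> R \<Longrightarrow> norm z \<le> R \<Longrightarrow>
       norm (F y - F z - frechet_derivative F (at z) (y - z)) \<le> C * (norm (y - z))\<^sup>2"
proof -
  have "\<exists>C\<ge>0. (\<forall>y v. norm y \<le> R \<longrightarrow> \<bar>frechet_derivative (\<lambda>z. F z $ i) (at y) v\<bar> \<le> C * norm v)
      \<and> (\<forall>y z. norm y \<le> R \<longrightarrow> norm z \<le> R \<longrightarrow> \<bar>F y $ i - F z $ i\<bar> \<le> C * norm (y - z))" for i
    using real_analytic_lipschitz[OF analytic_map_nth[OF F, of i], of R] by metis
  then obtain A where A: "\<And>i. A i \<ge> 0"
      "\<And>i y v. norm y \<le> R \<Longrightarrow> \<bar>frechet_derivative (\<lambda>z. F z $ i) (at y) v\<bar> \<le> A i * norm v"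
      "\<And>i y z. norm y \<le> R \<Longrightarrow> norm z \<le> R \<Longrightarrow> \<bar>F y $ i - F z $ i\<bar> \<le> A i * norm (y - z)"
    by metis
  have "\<exists>C\<ge>0. \<forall>y z. norm y \<le> R \<longrightarrow> norm z \<le> R \<longrightarrow>
      \<bar>F y $ i - F z $ i - frechet_derivative (\<lambda>z. F z $ i) (at z) (y - z)\<bar> \<le> C * (norm (y - z))\<^sup>2" for i
    using real_analytic_linearization[OF analytic_map_nth[OF F, of i], of R] by metis
  then obtain B where B: "\<And>i. B i \<ge> 0" "\<And>i y z. norm y \<le> R \<Longrightarrow> norm z \<le> R \<Longrightarrow>
      \<bar>F y $ i - F z $ i - frechet_derivative (\<lambda>z. F z $ i) (at z) (y - z)\<bar> \<le> B i * (norm (y - z))\<^sup>2"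
    by metis
  define C where "C = max (\<Sum>i\<in>UNIV. A i) (\<Sum>i\<in>UNIV. B i)"
  have CA: "(\<Sum>i\<in>UNIV. A i) * a \<le> C * a" and CB: "(\<Sum>i\<in>UNIV. B i) * a \<le> C * a" if "a \<ge> 0" for a
    using that by (auto simp: C_def intro!: mult_right_mono)
  show thesis
  proof (rule that[of C])
    show "C \<ge> 0" using sum_nonneg[of UNIV A] A(1) by (simp add: C_def le_max_iff_disj)
    show "norm (frechet_derivative F (at y) v) \<le> C * norm v" if "norm y \<le> R" for y v
      using A(2)[OF that]
      by (intro order_trans[OF norm_vec_le_of_nth CA]) (auto simp: analytic_map_frechet_derivative_nth(2)[OF F])
    show "norm (F y - F z) \<le> C * norm (y - z)" if "norm y \<le> R" "norm z \<le> R" for y z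
      using A(3)[OF that] by (intro order_trans[OF norm_vec_le_of_nth CA]) auto
    show "norm (F y - F z - frechet_derivative F (at z) (y - z)) \<le> C * (norm (y - z))\<^sup>2"
      if "norm y \<le> R" "norm z \<le> R" for y z
      using B(2)[OF that]
      by (intro order_trans[OF norm_vec_le_of_nth CB]) (auto simp: analytic_map_frechet_derivative_nth(2)[OF F])
  qed
qed

text \<open>The last bound is of third-derivative type: a first-order Taylor estimate for the
  derivative itself. It is what makes the nonlinear remainder cubic in the amplitude.\<close>

lemma analytic_map_derivative_lipschitz:
  fixes F :: "'a::euclidean_space \<Rightarrow> real ^ 'n"
  assumes F: "analytic_map F"
  obtains C where "C \<ge> 0" 
    "\<And>y u v. norm y \<le> R \<Longrightarrow>
       norm (frechet_derivative (\<lambda>y. frechet_derivative F (at y) v) (at y) u) \<le> C * norm v * norm u"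
    "\<And>y z v. norm y \<le> R \<Longrightarrow> norm z \<le> R \<Longrightarrow>
       norm (frechet_derivative F (at y) v - frechet_derivative F (at z) v) \<le> C * norm v * norm (y - z)"
    "\<And>y z v. norm y \<le> R \<Longrightarrow> norm z \<le> R \<Longrightarrow>
       norm (frechet_derivative F (at y) v - frechet_derivative F (at z) v
         - frechet_derivative (\<lambda>y. frechet_derivative F (at y) v) (at z) (y - z)) \<le> C * norm v * (norm (y - z))\<^sup>2"
proof -
  let ?D = "\<lambda>b y. frechet_derivative F (at y) b"
  define P where "P b C \<longleftrightarrow> C \<ge> 0 \<and> (\<forall>y v. norm y \<le> R \<longrightarrow> norm (frechet_derivative (?D b) (at y) v) \<le> C * norm v)
    \<and> (\<forall>y z. norm y \<le> R \<longrightarrow> norm z \<le> R \<longrightarrow> norm (?D b y - ?D b z) \<le> C * norm (y - z))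
    \<and> (\<forall>y z. norm y \<le> R \<longrightarrow> norm z \<le> R \<longrightarrow>
       norm (?D b y - ?D b z - frechet_derivative (?D b) (at z) (y - z)) \<le> C * (norm (y - z))\<^sup>2)" for b C
  have "\<exists>C. P b C" if b: "b \<in> Basis" for b
    unfolding P_def by (rule analytic_map_lipschitz[OF analytic_map_partial[OF F b], of R]) blast
  then have "\<forall>b\<in>Basis. \<exists>C. P b C" by blast
  from bchoice[OF this] obtain A where PA: "\<forall>b\<in>Basis. P b (A b)" ..
  have A: "\<And>b. b \<in> Basis \<Longrightarrow> A b \<ge> 0"
    "\<And>b y v. b \<in> Basis \<Longrightarrow> norm y \<le> R \<Longrightarrow> norm (frechet_derivative (?D b) (at y) v) \<le> A b * norm v"
    "\<And>b y z. b \<in> Basis \<Longrightarrow> norm y \<le> R \<Longrightarrow> norm z \<le> R \<Longrightarrow> norm (?D b y - ?D b z) \<le> A b * norm (y - z)"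
    "\<And>b y z. b \<in> Basis \<Longrightarrow> norm y \<le> R \<Longrightarrow> norm z \<le> R \<Longrightarrow>
       norm (?D b y - ?D b z - frechet_derivative (?D b) (at z) (y - z)) \<le> A b * (norm (y - z))\<^sup>2"
    using PA unfolding P_def by simp_all
  define C where "C = (\<Sum>b\<in>Basis. A b)"
  have sumb: "norm (\<Sum>b\<in>Basis. (v \<bullet> b) *\<^sub>R X b) \<le> C * norm v * a"
    if "\<And>b. b \<in> Basis \<Longrightarrow> norm (X b) \<le> A b * a" for v and X :: "'a \<Rightarrow> real ^ 'n" and a
  proof -
    have "norm (\<Sum>b\<in>Basis. (v \<bullet> b) *\<^sub>R X b) \<le> (\<Sum>b\<in>Basis. norm ((v \<bullet> b) *\<^sub>R X b))"
      by (rule norm_sum)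
    also have "\<dots> \<le> (\<Sum>b\<in>Basis. norm v * (A b * a))"
    proof (rule sum_mono)
      fix b :: 'a assume b: "b \<in> Basis"
      show "norm ((v \<bullet> b) *\<^sub>R X b) \<le> norm v * (A b * a)"
        unfolding norm_scaleR by (rule mult_mono[OF Basis_le_norm[OF b] that[OF b]]) simp_all
    qed
    finally show ?thesis by (simp add: C_def sum_distrib_right sum_distrib_left mult_ac)
  qed
  note eq = analytic_map_frechet_derivative_eq[OF F] second_derivative_eq_sum[OF F]
  show thesis
  proof (rule that[of C])
    show "C \<ge> 0" unfolding C_def using A(1) by (rule sum_nonneg)
    fix y z u v :: 'a
    assume y: "norm y \<le> R"
    show "norm (frechet_derivative (?D v) (at y) u) \<le> C * norm v * norm u"
      unfolding eq(2)[where v = v] by (rule sumb) (use A(2) y in auto)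
    assume z: "norm z \<le> R"
    have "?D v y - ?D v z = (\<Sum>b\<in>Basis. (v \<bullet> b) *\<^sub>R (?D b y - ?D b z))"
      by (simp add: eq(1)[where v = v] sum_subtractf scaleR_diff_right)
    then show "norm (?D v y - ?D v z) \<le> C * norm v * norm (y - z)"
      by (simp only:) (rule sumb, use A(3) y z in auto)
    have "?D v y - ?D v z - frechet_derivative (?D v) (at z) (y - z) =
        (\<Sum>b\<in>Basis. (v \<bullet> b) *\<^sub>R (?D b y - ?D b z - frechet_derivative (?D b) (at z) (y - z)))"
      unfolding eq(2)[where v = v and z = z and u = "y - z"]
      unfolding eq(1)[where v = v and z = z] eq(1)[where v = v and z = y]
      by (simp add: sum_subtractf scaleR_diff_right)
    then show "norm (?D v y - ?D v z - frechet_derivative (?D v) (at z) (y - z)) \<le> C * norm v * (norm (y - z))\<^sup>2"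
      by (simp only:) (rule sumb, use A(4) y z in auto)
  qed
qed

lemma analytic_map_continuous_on:
  fixes F :: "'a::euclidean_space \<Rightarrow> real ^ 'n"
  assumes F: "analytic_map F" and z: "continuous_on S z"
  shows "continuous_on S (\<lambda>t. F (z t))"
proof -
  have "continuous_on S (\<lambda>t. \<chi> i. F (z t) $ i)"
    by (intro continuous_on_vec_lambda
        continuous_on_compose2[OF real_analytic_continuous_on[OF analytic_map_nth[OF F], of UNIV] z]) auto
  then show ?thesis by simp
qed

lemma analytic_map_derivative_continuous_on:
  fixes F :: "'a::euclidean_space \<Rightarrow> real ^ 'n"
  assumes F: "analytic_map F" and z: "continuous_on S z" and v: "continuous_on S v"
  shows "continuous_on S (\<lambda>t. frechet_derivative F (at (z t)) (v t))"
proof -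
  have "continuous_on S (\<lambda>t. \<Sum>b\<in>Basis. (v t \<bullet> b) *\<^sub>R frechet_derivative F (at (z t)) b)"
    by (intro continuous_on_sum continuous_on_scaleR continuous_on_inner continuous_on_const v
        analytic_map_continuous_on[OF analytic_map_partial[OF F] z])
  then show ?thesis by (simp only: analytic_map_frechet_derivative_eq[OF F, where v = "v _"])
qed

lemma analytic_map_second_derivative_continuous_on:
  fixes F :: "'a::euclidean_space \<Rightarrow> real ^ 'n"
  assumes F: "analytic_map F" and z: "continuous_on S z" and v: "continuous_on S v" and u: "continuous_on S u"
  shows "continuous_on S (\<lambda>t. frechet_derivative (\<lambda>y. frechet_derivative F (at y) (v t)) (at (z t)) (u t))"
proof -
  have "continuous_on S (\<lambda>t. \<Sum>b\<in>Basis. (v t \<bullet> b) *\<^sub>R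
      frechet_derivative (\<lambda>y. frechet_derivative F (at y) b) (at (z t)) (u t))"
    by (intro continuous_on_sum continuous_on_scaleR continuous_on_inner continuous_on_const v
        analytic_map_derivative_continuous_on[OF analytic_map_partial[OF F] z u])
  then show ?thesis by (simp only: second_derivative_eq_sum[OF F, where v = "v _"])
qed

section \<open>Compact perturbations of the identity\<close>

text \<open>The injective case of the Fredholm alternative, by Riesz's argument. If
  \<open>Q = I - K\<close> were not bounded below, compactness would produce a unit vector in its
  kernel. If \<open>Q\<close> were not onto, the ranges of its powers would decrease strictly, and
  almost orthogonal unit vectors chosen in them would have images under \<open>K\<close> without a
  convergent subsequence.\<close>

lemma riesz_schauder_inverse:
  fixes K :: "'a::banach \<Rightarrow> 'a"
  assumes K: "bounded_linear K"
    and compact: "\<And>X::nat \<Rightarrow> 'a. (\<And>n. norm (X n) \<le> 1) \<Longrightarrow> \<exists>r l. strict_mono r \<and> (\<lambda>n. K (X (r n))) \<longlonglongrightarrow> l"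
    and inj: "\<And>x. x - K x = 0 \<Longrightarrow> x = 0"
  obtains W where "bounded_linear W" "\<And>h. W h - K (W h) = h"
proof -
  define Q where "Q = (\<lambda>x. x - K x)"
  interpret K: bounded_linear K by (rule K)
  have Q: "bounded_linear Q" unfolding Q_def
    by (intro bounded_linear_sub bounded_linear_ident K)
  interpret Q: bounded_linear Q by (rule Q)
  have injQ: "inj Q"
    using inj linear_injective_0[OF Q.linear_axioms] by (simp add: Q_def)
  have "\<exists>c>0. \<forall>x. norm (Q x) \<ge> c * norm x"
  proof (rule ccontr)
    assume "\<not> ?thesis"
    then have "\<forall>n::nat. \<exists>x. norm (Q x) < inverse (real (Suc n)) * norm x"
      by (meson inverse_positive_iff_positive not_le of_nat_0_less_iff zero_less_Suc)
    then obtain y where y: "\<And>n::nat. norm (Q (y n)) < inverse (real (Suc n)) * norm (y n)" by metis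
    have ynz: "y n \<noteq> 0" for n using y[of n] by auto
    define x where "x n = y n /\<^sub>R norm (y n)" for n
    have nx: "norm (x n) = 1" for n using ynz by (simp add: x_def)
    have Qx: "norm (Q (x n)) < inverse (real (Suc n))" for n
      using y[of n] ynz[of n] by (simp add: x_def Q.scaleR field_simps)
    obtain r l where r: "strict_mono r" and l: "(\<lambda>n. K (x (r n))) \<longlonglongrightarrow> l"
      using compact[of x] nx by (metis order_refl)
    have "(\<lambda>n. Q (x n)) \<longlonglongrightarrow> 0"
      by (rule Lim_null_comparison[OF _ LIMSEQ_inverse_real_of_nat]) (use Qx in \<open>auto intro!: eventuallyI less_imp_le\<close>)
    then have "(\<lambda>n. Q (x (r n))) \<longlonglongrightarrow> 0" using r LIMSEQ_subseq_LIMSEQ[of _ 0 r] by (auto simp: o_def)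
    from tendsto_add[OF this l] have xl: "(\<lambda>n. x (r n)) \<longlonglongrightarrow> l" by (simp add: Q_def)
    have "(\<lambda>n. Q (x (r n))) \<longlonglongrightarrow> Q l" by (rule Q.tendsto[OF xl])
    then have "Q l = 0" using \<open>(\<lambda>n. Q (x (r n))) \<longlonglongrightarrow> 0\<close> LIMSEQ_unique by blast
    then have "l = 0" using inj by (simp add: Q_def)
    moreover have "norm l = 1" using tendsto_norm[OF xl] nx by (simp add: LIMSEQ_const_iff)
    ultimately show False by simp
  qed
  then obtain c where c: "c > 0" "\<And>x. norm (Q x) \<ge> c * norm x" by blast
  define X where "X n = (Q ^^ n) ` UNIV" for n :: nat
  have X0: "X 0 = UNIV" by (simp add: X_def)
  have XS: "X (Suc n) = Q ` X n" for n by (auto simp: X_def)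
  have sub: "subspace (X n)" for n
    by (induction n) (auto simp: X0 XS intro: Q.linear_axioms linear_subspace_image)
  \<comment> \<open>The lower bound for \<open>Q\<close> preserves completeness of images, so the
    ranges are closed and points outside them have positive distance.\<close>
  have complX: "complete (X n)" for n
    by (induction n) (auto simp: X0 XS complete_UNIV intro!: complete_isometric_image[OF c(1) sub Q] c(2))
  have dec: "X (Suc n) \<subseteq> X n" for n
    by (induction n) (auto simp: X0 XS)
  have decm: "X m \<subseteq> X n" if "n \<le> m" for n m
    using that dec by (rule lift_Suc_antimono_le[rotated])
  have surj: "Q ` UNIV = UNIV"
  proof (rule ccontr)
    assume ns: "Q ` UNIV \<noteq> UNIV"
    have strict: "X (Suc n) \<noteq> X n" for n
    proof (induction n)
      case 0 then show ?case using ns by (simp add: X0 XS)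
    next
      case (Suc n) then show ?case using injQ by (metis XS inj_image_eq_iff)
    qed
    have "\<exists>x\<in>X n. norm x = 1 \<and> (\<forall>z\<in>X (Suc n). norm (x - z) \<ge> 1/2)" for n
    proof -
      obtain u where u: "u \<in> X n" "u \<notin> X (Suc n)" using strict[of n] dec[of n] by blast
      have cl: "closed (X (Suc n))" using complX complete_imp_closed by blast
      have ne: "X (Suc n) \<noteq> {}" using sub subspace_0 by blast
      define d where "d = infdist u (X (Suc n))"
      have d: "d > 0" unfolding d_def
        using cl ne u(2) by (metis in_closed_iff_infdist_zero infdist_nonneg less_eq_real_def)
      \<comment> \<open>Being within twice the distance is enough: after \<open>u - z\<close> is
        normalized, the distance to the smaller range is still at least 1/2.\<close>
      obtain z where z: "z \<in> X (Suc n)" "dist u z < 2 * d"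
      proof -
        have "\<exists>z\<in>X (Suc n). dist u z < 2 * d"
          unfolding d_def using ne d unfolding d_def infdist_def
          by (auto simp: cInf_less_iff[symmetric] image_iff intro!: bdd_below_image_dist)
            (smt (verit, best) cINF_less_iff bdd_below_image_dist ne)
        then show ?thesis using that by blast
      qed
      have uz: "u - z \<noteq> 0" using u z by auto
      define x where "x = (u - z) /\<^sub>R norm (u - z)"
      have "x \<in> X n" unfolding x_def using u(1) z(1) dec[of n] sub[of n]
        by (auto intro!: subspace_scale subspace_diff)
      moreover have "norm x = 1" using uz by (simp add: x_def)
      moreover have "norm (x - w) \<ge> 1/2" if w: "w \<in> X (Suc n)" for w
      proof -
        have "z + norm (u - z) *\<^sub>R w \<in> X (Suc n)"
          using z(1) w sub[of "Suc n"] by (auto intro!: subspace_add subspace_scale)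
        then have "d \<le> dist u (z + norm (u - z) *\<^sub>R w)" unfolding d_def by (rule infdist_le)
        also have "\<dots> = norm (norm (u - z) *\<^sub>R (x - w))"
          using uz by (simp add: dist_norm x_def algebra_simps)
        also have "\<dots> = norm (u - z) * norm (x - w)" by simp
        finally have "d \<le> norm (u - z) * norm (x - w)" .
        moreover have "norm (u - z) < 2 * d" using z(2) by (simp add: dist_norm)
        then have "norm (u - z) * norm (x - w) \<le> 2 * d * norm (x - w)" by (intro mult_right_mono) auto
        ultimately have "d * 1 \<le> d * (2 * norm (x - w))" by (simp add: algebra_simps)
        then show ?thesis using d by (simp only: mult_le_cancel_left_pos)
      qed
      ultimately show ?thesis by blast
    qed
    then obtain x where x: "\<And>n. x n \<in> X n" "\<And>n. norm (x n) = 1"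
        "\<And>n z. z \<in> X (Suc n) \<Longrightarrow> norm (x n - z) \<ge> 1/2" by metis
    \<comment> \<open>\<open>K (x n) - K (x m)\<close> equals
      \<open>x n - (Q (x n) + x m - Q (x m))\<close>, and the bracket lies in
      \<open>X (Suc n)\<close> because \<open>n < m\<close>.\<close>
    have sep: "norm (K (x n) - K (x m)) \<ge> 1/2" if "n < m" for n m
    proof -
      have xm: "x m \<in> X (Suc n)" using x(1)[of m] decm[of "Suc n" m] that by auto
      have "Q (x n) \<in> X (Suc n)" using x(1) by (simp add: XS)
      moreover have "Q (x m) \<in> X (Suc n)" using xm dec XS by blast
      ultimately have "Q (x n) + x m - Q (x m) \<in> X (Suc n)"
        using xm sub[of "Suc n"] by (auto intro!: subspace_add subspace_diff)
      from x(3)[OF this] show ?thesis by (simp add: Q_def algebra_simps)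
    qed
    obtain r l where r: "strict_mono r" and l: "(\<lambda>n. K (x (r n))) \<longlonglongrightarrow> l"
      using compact[of x] x(2) by (metis order_refl)
    obtain N where N: "\<And>m n. m \<ge> N \<Longrightarrow> n \<ge> N \<Longrightarrow> dist (K (x (r m))) (K (x (r n))) < 1/2"
      using LIMSEQ_imp_Cauchy[OF l] unfolding Cauchy_def by (meson half_gt_zero_iff zero_less_one)
    have "r N < r (Suc N)" using r by (simp add: strict_mono_Suc_iff)
    from sep[OF this] N[of N "Suc N"] show False by (simp add: dist_norm)
  qed
  define W where "W = inv Q"
  have QW: "Q (W h) = h" for h unfolding W_def using surj by (simp add: surj_f_inv_f)
  have WQ: "W (Q h) = h" for h unfolding W_def using injQ by simp
  have "bounded_linear W"
  proof (rule bounded_linear_intro)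
    show "W (x + y) = W x + W y" for x y by (metis Q.add QW WQ)
    show "W (a *\<^sub>R x) = a *\<^sub>R W x" for a x by (metis Q.scaleR QW WQ)
    show "norm (W x) \<le> norm x * (1/c)" for x using c(2)[of "W x"] c(1) by (simp add: QW field_simps)
  qed
  with QW show thesis using that unfolding Q_def by blast
qed

section \<open>Bounded solutions of hyperbolic linear systems\<close>

lemma antiderivative_on_line:
  fixes h :: "real \<Rightarrow> 'a::euclidean_space"
  assumes h: "continuous_on UNIV h"
  obtains F where "\<And>t. (F has_vector_derivative h t) (at t)"
proof -
  define F where "F t = integral {0..t} h - integral {t..0} h" for t
  have int: "h integrable_on {a..b}" for a b
    using h by (intro integrable_continuous_interval continuous_on_subset[OF h]) auto
  have "(F has_vector_derivative h t) (at t)" for t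
  proof -
    \<comment> \<open>Near \<open>t\<close> the two one-sided integrals merge into one integral from
      \<open>-N\<close> up to a constant, to which the fundamental theorem applies. The extra 1 puts
      \<open>t\<close> in the interior.\<close>
    define N where "N = \<bar>t\<bar> + 1"
    have eq: "F s = integral {-N..s} h - integral {-N..0} h" if "s \<in> {-N..N}" for s
    proof (cases "s \<ge> 0")
      case True
      then have "integral {-N..0} h + integral {0..s} h = integral {-N..s} h"
        by (intro Henstock_Kurzweil_Integration.integral_combine int) (auto simp: N_def)
      moreover have "integral {s..0} h = 0" using True by (cases "s = 0") auto
      ultimately show ?thesis by (simp add: F_def algebra_simps)
    next
      case False
      then have "integral {-N..s} h + integral {s..0} h = integral {-N..0} h"
        using that by (intro Henstock_Kurzweil_Integration.integral_combine int) auto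
      moreover have "integral {0..s} h = 0" using False by auto
      ultimately show ?thesis by (simp add: F_def algebra_simps)
    qed
    have t: "t \<in> {-N<..<N}" by (auto simp: N_def)
    have "((\<lambda>s. integral {-N..s} h) has_vector_derivative h t) (at t within {-N..N})"
      using t by (intro integral_has_vector_derivative continuous_on_subset[OF h]) auto
    then have "((\<lambda>s. integral {-N..s} h) has_vector_derivative h t) (at t)"
      using t at_within_Icc_at[of "-N" t N] by simp
    then have "((\<lambda>s. integral {-N..s} h - integral {-N..0} h) has_vector_derivative h t) (at t)"
      by (auto intro!: derivative_eq_intros)
    then show ?thesis
      by (rule has_vector_derivative_transform_within_open[of _ _ _ "{-N<..<N}"]) (use t eq in auto)
  qed
  then show thesis using that by blast
qed

text \<open>Controls the tail of the variation-of-constants integral for an unstable mode. A forcing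
  growing at a rate \<open>\<gamma>\<close> below \<open>Re l\<close> still leaves an exponentially
  decaying integrand to the right of \<open>t\<close>.\<close>

lemma exp_weighted_increment:
  fixes F :: "real \<Rightarrow> complex"
  assumes F: "\<And>t. (F has_vector_derivative exp (- (l * of_real t)) * g t) (at t)"
    and a: "\<gamma> < Re l" and g: "\<And>s. norm (g s) \<le> m * exp (\<gamma> * \<bar>s - t\<bar>)" and t': "t \<le> t'"
  shows "norm (F t' - F t) \<le> m / (Re l - \<gamma>) * exp (- (Re l * t))"
proof -
  have m: "m \<ge> 0" using order_trans[OF norm_ge_zero g[of t]] by simp
  define A where "A = Re l - \<gamma>"
  have A: "A > 0" using a by (simp add: A_def)
  show ?thesis
  proof (cases "t < t'")
    case False
    then show ?thesis using t' m a by simp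
  next
    case True
    \<comment> \<open>An antiderivative of the majorant of the integrand, so that the mean value
      inequality can replace the estimation of an integral.\<close>
    define p where "p s = - (m / A) * exp (- \<gamma> * t) * exp (- A * s)" for s
    have p': "(p has_vector_derivative m * exp (- \<gamma> * t) * exp (- A * s)) (at s)" for s
      unfolding p_def has_real_derivative_iff_has_vector_derivative[symmetric]
      by (rule derivative_eq_intros refl | use A in simp)+
    have "norm (F t' - F t) \<le> p t' - p t"
    proof (rule differentiable_bound_general[OF True])
      show "continuous_on {t..t'} F"
        using F has_vector_derivative_continuous continuous_at_imp_continuous_on by blast
      show "continuous_on {t..t'} p"
        using p' has_vector_derivative_continuous continuous_at_imp_continuous_on by blast
      show "(F has_vector_derivative exp (- (l * of_real s)) * g s) (at s)" for s by (rule F)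
      show "(p has_vector_derivative m * exp (- \<gamma> * t) * exp (- A * s)) (at s)" for s by (rule p')
      show "norm (exp (- (l * of_real s)) * g s) \<le> m * exp (- \<gamma> * t) * exp (- A * s)" if "t < s" for s
      proof -
        have "norm (exp (- (l * of_real s)) * g s) = exp (- (Re l * s)) * norm (g s)"
          by (simp add: norm_mult)
        also have "\<dots> \<le> exp (- (Re l * s)) * (m * exp (\<gamma> * \<bar>s - t\<bar>))"
          using g by (intro mult_left_mono) auto
        also have "\<dots> = m * (exp (- (Re l * s)) * exp (\<gamma> * (s - t)))" using that by simp
        also have "\<dots> = m * (exp (- \<gamma> * t) * exp (- A * s))"
          by (simp add: A_def algebra_simps flip: exp_add)
        finally show ?thesis by simp
      qed
    qed
    also have "\<dots> = (m / A) * exp (- \<gamma> * t) * exp (- A * t) - (m / A) * exp (- \<gamma> * t) * exp (- A * t')"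
      by (simp add: p_def)
    also have "\<dots> \<le> (m / A) * (exp (- \<gamma> * t) * exp (- A * t))"
    proof -
      have "0 \<le> (m / A) * exp (- \<gamma> * t) * exp (- A * t')" using m A by (intro mult_nonneg_nonneg) auto
      then show ?thesis by (simp only: mult.assoc)
    qed
    also have "exp (- \<gamma> * t) * exp (- A * t) = exp (- (Re l * t))"
      by (simp add: A_def algebra_simps flip: exp_add)
    finally show ?thesis by (simp add: A_def)
  qed
qed

text \<open>The solution is minus the integral over [t, infinity) of
  \<open>exp (l * (t - s)) * g s\<close>. The improper integral appears as \<open>L - F t\<close>,
  with \<open>L\<close> the limit of an antiderivative, and the weighted bound is the increment
  bound carried to that limit.\<close>

lemma scalar_bounded_solution_unstable:
  fixes g :: "real \<Rightarrow> complex"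
  assumes \<gamma>: "0 < \<gamma>" "\<gamma> < Re l" and g: "continuous_on UNIV g" "bounded (range g)"
  obtains u where "\<And>t. (u has_vector_derivative l * u t + g t) (at t)"
    "\<And>t m. (\<And>s. norm (g s) \<le> m * exp (\<gamma> * \<bar>s - t\<bar>)) \<Longrightarrow> norm (u t) \<le> m / (Re l - \<gamma>)"
proof -
  have "continuous_on UNIV (\<lambda>t. exp (- (l * of_real t)) * g t)"
    by (intro continuous_intros g)
  from antiderivative_on_line[OF this] obtain F
    where F: "\<And>t. (F has_vector_derivative exp (- (l * of_real t)) * g t) (at t)" by metis
  note incr = exp_weighted_increment[OF F \<gamma>(2)]
  obtain B where B: "\<And>s. norm (g s) \<le> B" using g(2) unfolding bounded_iff by auto
  have B0: "B \<ge> 0" using order_trans[OF norm_ge_zero B] .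
  have gB: "norm (g s) \<le> B * exp (\<gamma> * \<bar>s - t\<bar>)" for s t
  proof -
    have "B * 1 \<le> B * exp (\<gamma> * \<bar>s - t\<bar>)" using B0 \<gamma> by (intro mult_left_mono) auto
    then show ?thesis using B[of s] by simp
  qed
  have dist: "norm (F t' - F t) \<le> B / (Re l - \<gamma>) * exp (- (Re l * t))" if "t \<le> t'" for t t'
    by (rule incr[OF gB that])
  have lim0: "(\<lambda>n. B / (Re l - \<gamma>) * exp (- (Re l * real n))) \<longlonglongrightarrow> 0"
  proof -
    have "filterlim (\<lambda>n. Re l * real n) at_top sequentially"
      using \<gamma> by (intro filterlim_tendsto_pos_mult_at_top[OF tendsto_const _ filterlim_real_sequentially]) auto
    then have "(\<lambda>n. exp (- (Re l * real n))) \<longlonglongrightarrow> 0"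
      by (intro filterlim_compose[OF exp_at_bot]) (simp add: filterlim_uminus_at_bot)
    then show ?thesis using tendsto_mult_right_zero by blast
  qed
  have "Cauchy (\<lambda>n. F (real n))"
  proof (rule metric_CauchyI)
    fix e :: real assume "e > 0"
    from order_tendstoD(2)[OF lim0 this] obtain N where
      N: "\<And>n. n \<ge> N \<Longrightarrow> B / (Re l - \<gamma>) * exp (- (Re l * real n)) < e"
      unfolding eventually_sequentially by blast
    show "\<exists>N. \<forall>m\<ge>N. \<forall>n\<ge>N. dist (F (real m)) (F (real n)) < e"
    proof (intro exI[of _ N] allI impI)
      fix m n assume "N \<le> m" "N \<le> n"
      then show "dist (F (real m)) (F (real n)) < e"
        using dist[of "real n" "real m"] dist[of "real m" "real n"] N[of m] N[of n]
        by (cases "n \<le> m") (auto simp: dist_norm norm_minus_commute intro: le_less_trans)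
    qed
  qed
  then obtain L where L: "(\<lambda>n. F (real n)) \<longlonglongrightarrow> L" using Cauchy_convergent convergent_def by blast
  have Ldist: "norm (L - F t) \<le> K" if "\<And>t'. t \<le> t' \<Longrightarrow> norm (F t' - F t) \<le> K" for t K
  proof (rule Lim_bounded)
    show "(\<lambda>n. norm (F (real n) - F t)) \<longlonglongrightarrow> norm (L - F t)" by (intro tendsto_intros L)
    show "\<forall>n\<ge>nat \<lceil>t\<rceil>. norm (F (real n) - F t) \<le> K"
      by (intro allI impI that) linarith
  qed
  define u where "u t = - (exp (l * of_real t) * (L - F t))" for t
  show thesis
  proof (rule that[of u])
    fix t
    have e: "((\<lambda>t. exp (l * of_real t)) has_vector_derivative exp (l * of_real t) * l) (at t)"
      by (rule has_vector_derivative_real_field[unfolded o_def, of "\<lambda>z. exp (l * z)"])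
        (auto intro!: derivative_eq_intros)
    have "(u has_vector_derivative - (exp (l * of_real t) * (0 - exp (- (l * of_real t)) * g t) +
        exp (l * of_real t) * l * (L - F t))) (at t)"
      unfolding u_def
      by (intro has_vector_derivative_minus has_vector_derivative_mult has_vector_derivative_diff
          has_vector_derivative_const F e)
    also have "- (exp (l * of_real t) * (0 - exp (- (l * of_real t)) * g t) +
        exp (l * of_real t) * l * (L - F t)) = l * u t + g t"
      by (simp add: u_def exp_minus field_simps)
    finally show "(u has_vector_derivative l * u t + g t) (at t)" .
  next
    fix t m assume m: "\<And>s. norm (g s) \<le> m * exp (\<gamma> * \<bar>s - t\<bar>)"
    have "norm (L - F t) \<le> m / (Re l - \<gamma>) * exp (- (Re l * t))"
      by (rule Ldist) (rule incr[OF m])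
    then have "exp (Re l * t) * norm (L - F t) \<le> exp (Re l * t) * (m / (Re l - \<gamma>) * exp (- (Re l * t)))"
      by (intro mult_left_mono) auto
    also have "exp (Re l * t) * (m / (Re l - \<gamma>) * exp (- (Re l * t))) =
        m / (Re l - \<gamma>) * (exp (Re l * t) * exp (- (Re l * t)))" by (simp only: mult_ac)
    also have "\<dots> = m / (Re l - \<gamma>)" by (simp flip: exp_add)
    finally show "norm (u t) \<le> m / (Re l - \<gamma>)" by (simp add: u_def norm_mult)
  qed
qed

text \<open>Reversing time exchanges stable and unstable modes and respects the weight, which
  depends only on the distance to its centre.\<close>

lemma scalar_bounded_solution:
  fixes g :: "real \<Rightarrow> complex"
  assumes \<gamma>: "0 < \<gamma>" "\<gamma> < \<bar>Re l\<bar>" and g: "continuous_on UNIV g" "bounded (range g)"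
  obtains u where "\<And>t. (u has_vector_derivative l * u t + g t) (at t)"
    "\<And>t m. (\<And>s. norm (g s) \<le> m * exp (\<gamma> * \<bar>s - t\<bar>)) \<Longrightarrow> norm (u t) \<le> m / (\<bar>Re l\<bar> - \<gamma>)"
proof (cases "Re l > 0")
  case True
  then show thesis using scalar_bounded_solution_unstable[of \<gamma> l g] assms that by auto
next
  case False
  have "continuous_on UNIV (\<lambda>s. - g (- s))"
    by (intro continuous_intros continuous_on_compose2[OF g(1)]) auto
  moreover have "bounded (range (\<lambda>s. - g (- s)))" using g(2) by (auto simp: bounded_iff)
  ultimately obtain u where u: "\<And>t. (u has_vector_derivative - l * u t + - g (- t)) (at t)"
    "\<And>t m. (\<And>s. norm (- g (- s)) \<le> m * exp (\<gamma> * \<bar>s - t\<bar>)) \<Longrightarrow> norm (u t) \<le> m / (Re (- l) - \<gamma>)"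
    using scalar_bounded_solution_unstable[of \<gamma> "- l" "\<lambda>s. - g (- s)"] \<gamma> False by auto
  show thesis
  proof (rule that[of "\<lambda>t. u (- t)"])
    fix t
    have "((u \<circ> uminus) has_vector_derivative (- 1) *\<^sub>R (- l * u (- t) + - g (- (- t)))) (at t)"
      by (rule vector_diff_chain_at[where f = uminus and g = u, OF _ u(1)[of "- t"]])
        (auto intro!: derivative_eq_intros)
    then show "((\<lambda>t. u (- t)) has_vector_derivative l * u (- t) + g t) (at t)"
      by (simp add: o_def add.commute)
  next
    fix t m assume m: "\<And>s. norm (g s) \<le> m * exp (\<gamma> * \<bar>s - t\<bar>)"
    have "norm (- g (- s)) \<le> m * exp (\<gamma> * \<bar>s - (- t)\<bar>)" for s
      using m[of "- s"] by (simp add: abs_minus_commute add.commute)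
    from u(2)[OF this] show "norm (u (- t)) \<le> m / (\<bar>Re l\<bar> - \<gamma>)" using False by simp
  qed
qed

text \<open>The vector \<open>p(A) v\<close>, that is, the polynomial evaluated at the matrix and
  applied to \<open>v\<close>.\<close>

definition horner :: "complex ^ 'n ^ 'n \<Rightarrow> complex poly \<Rightarrow> complex ^ 'n \<Rightarrow> complex ^ 'n" where
  "horner A p v = (\<Sum>i\<le>degree p. coeff p i *s (((*v) A ^^ i) v))"

lemma horner_altdef:
  assumes "degree p \<le> n"
  shows "horner A p v = (\<Sum>i\<le>n. coeff p i *s (((*v) A ^^ i) v))"
  unfolding horner_def using assms
  by (intro sum.mono_neutral_left) (auto simp: coeff_eq_0)

text \<open>A linear factor can be applied to \<open>v\<close> first or last. The first form
  replaces \<open>v\<close> by \<open>A *v v - l *s v\<close>, the second exhibits an eigenvector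
  equation; the induction over roots uses one or the other according to the real part of the
  root.\<close>

lemma horner_factor:
  "horner A ([:- l, 1:] * q) v = horner A q (A *v v - l *s v)"
  "horner A ([:- l, 1:] * q) v = A *v horner A q v - l *s horner A q v"
proof -
  define n where "n = degree q"
  have pow_lin: "((*v) A ^^ i) (x - y) = ((*v) A ^^ i) x - ((*v) A ^^ i) y"
    "((*v) A ^^ i) (c *s x) = c *s ((*v) A ^^ i) x" for i x y c
    by (induction i) (simp_all add: matrix_vector_mult_diff_distrib vector_scalar_commute)
  have pow_comm: "((*v) A ^^ i) (A *v x) = A *v ((*v) A ^^ i) x" for i x
    by (metis funpow_swap1)
  have "degree ([:- l, 1:] * q) \<le> Suc n"
    using degree_mult_le[of "[:- l, 1:]" q] by (simp add: n_def)
  then have "horner A ([:- l, 1:] * q) v =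
      (\<Sum>i\<le>Suc n. (coeff (pCons 0 q) i - l * coeff q i) *s (((*v) A ^^ i) v))"
    by (simp add: horner_altdef[where n = "Suc n"] mult_pCons_left)
  also have "\<dots> = (\<Sum>i\<le>Suc n. coeff (pCons 0 q) i *s (((*v) A ^^ i) v)) - l *s (\<Sum>i\<le>Suc n. coeff q i *s (((*v) A ^^ i) v))"
    by (simp only: vector_sub_rdistrib sum_subtractf vec.scale_sum_right vector_smult_assoc)
  also have "(\<Sum>i\<le>Suc n. coeff (pCons 0 q) i *s (((*v) A ^^ i) v)) = (\<Sum>i\<le>n. coeff q i *s (((*v) A ^^ i) (A *v v)))"
    by (subst sum.atMost_Suc_shift) (simp add: pow_comm)
  also have "(\<Sum>i\<le>Suc n. coeff q i *s (((*v) A ^^ i) v)) = (\<Sum>i\<le>n. coeff q i *s (((*v) A ^^ i) v))"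
    by (simp add: n_def coeff_eq_0)
  finally have *: "horner A ([:- l, 1:] * q) v =
      (\<Sum>i\<le>n. coeff q i *s (((*v) A ^^ i) (A *v v))) - l *s (\<Sum>i\<le>n. coeff q i *s (((*v) A ^^ i) v))" .
  show "horner A ([:- l, 1:] * q) v = A *v horner A q v - l *s horner A q v"
    unfolding *
    unfolding horner_def n_def[symmetric] linear_sum[OF matrix_vector_mul_linear]
    by (simp add: vector_scalar_commute pow_comm)
  show "horner A ([:- l, 1:] * q) v = horner A q (A *v v - l *s v)"
    unfolding *
    unfolding horner_def n_def[symmetric]
    by (simp add: pow_lin vector_ssub_ldistrib sum_subtractf vec.scale_sum_right vector_smult_assoc mult.commute)
qed

text \<open>One more iterate than the real dimension forces a linear dependence, whose real
  coefficients form the polynomial. When two iterates coincide the set of iterates is too small for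
  this count, and a difference of two monomials serves instead.\<close>

lemma annihilating_poly_exists:
  fixes A :: "complex ^ 'n ^ 'n"
  shows "\<exists>p. p \<noteq> 0 \<and> horner A p v = 0"
proof -
  define d where "d = DIM(complex ^ 'n)"
  define w where "w i = ((*v) A ^^ i) v" for i
  show ?thesis
  proof (cases "inj_on w {..d}")
    case False
    then obtain i j where ij: "i \<noteq> j" "w i = w j" by (auto simp: inj_on_def)
    define p :: "complex poly" where "p = monom 1 i - monom 1 j"
    have "coeff p i \<noteq> 0" using ij by (simp add: p_def)
    moreover have "horner A p v = 0"
    proof -
      have "horner A p v = (\<Sum>k\<le>max i j. coeff p k *s w k)"
        unfolding w_def by (rule horner_altdef) (auto simp: p_def intro!: degree_diff_le order_trans[OF degree_monom_le])
      also have "\<dots> = (\<Sum>k\<le>max i j. (if k = i then w i else 0) - (if k = j then w j else 0))"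
        by (intro sum.cong) (auto simp: p_def)
      also have "\<dots> = w i - w j" by (simp add: sum_subtractf)
      finally show ?thesis using ij by simp
    qed
    ultimately show ?thesis by (metis coeff_0)
  next
    case True
    then have "card (w ` {..d}) = Suc d" by (simp add: card_image)
    then have "dependent (w ` {..d})"
      using independent_bound[of "w ` {..d}"] unfolding d_def by fastforce
    then obtain u where u: "\<exists>x\<in>w ` {..d}. u x \<noteq> 0" "(\<Sum>x\<in>w ` {..d}. u x *\<^sub>R x) = 0"
      using dependent_finite[of "w ` {..d}"] by auto
    define p where "p = (\<Sum>i\<le>d. monom (complex_of_real (u (w i))) i)"
    have cp: "coeff p i = (if i \<le> d then complex_of_real (u (w i)) else 0)" for i
      by (simp add: p_def coeff_sum)
    have "p \<noteq> 0" using u(1) cp by (metis coeff_0 imageE atMost_iff of_real_eq_0_iff)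
    moreover have "horner A p v = (\<Sum>i\<le>d. coeff p i *s w i)"
      unfolding w_def by (rule horner_altdef) (auto intro!: degree_le simp: cp)
    moreover have "complex_of_real c *s x = c *\<^sub>R x" for c and x :: "complex ^ 'n"
      by (simp add: vec_eq_iff scaleR_conv_of_real[symmetric])
    then have "(\<Sum>i\<le>d. coeff p i *s w i) = (\<Sum>x\<in>w ` {..d}. u x *\<^sub>R x)"
      by (simp add: sum.reindex[OF True] cp)
    ultimately show ?thesis using u(2) by auto
  qed
qed

text \<open>Takes the place of a Jordan decomposition. An annihilating polynomial of
  \<open>v\<close> loses one root at a time: an imaginary root can be cancelled, since the kernel of
  the shifted matrix is trivial, and any other root passes from \<open>v\<close> to
  \<open>A *v v - l *s v\<close>, which is annihilated by a polynomial of smaller degree.\<close>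

lemma generalized_eigenvector_induct:
  fixes A :: "complex ^ 'n ^ 'n"
  assumes noimag: "\<And>l v. Re l = 0 \<Longrightarrow> A *v v - l *s v = 0 \<Longrightarrow> v = 0"
    and P0: "P 0" and step: "\<And>l v. Re l \<noteq> 0 \<Longrightarrow> P (A *v v - l *s v) \<Longrightarrow> P v"
  shows "P v"
proof -
  have "P v" if "p \<noteq> 0" "horner A p v = 0" for p v
    using that
  proof (induction "degree p" arbitrary: p v)
    case 0
    then obtain c where "p = [:c:]" "c \<noteq> 0" by (metis degree_eq_zeroE pCons_eq_0_iff)
    then have "c *s v = 0" using 0 by (simp add: horner_def)
    then have "v = 0" using \<open>c \<noteq> 0\<close> by (simp add: vec_eq_iff)
    then show ?case using P0 by simp
  next
    case (Suc n)
    have "\<not> constant (poly p)" using Suc(2) by (simp add: constant_degree)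
    then obtain l where "poly p l = 0" using fundamental_theorem_of_algebra by blast
    then have "[:- l, 1:] dvd p" by (simp only: poly_eq_0_iff_dvd)
    then obtain q where q: "p = [:- l, 1:] * q" unfolding dvd_def by blast
    have q0: "q \<noteq> 0" using Suc q by auto
    then have deg: "n = degree q" using Suc(2) degree_mult_eq[of "[:- l, 1:]" q] by (simp add: q)
    show ?case
    proof (cases "Re l = 0")
      case True
      have "A *v horner A q v - l *s horner A q v = 0" using Suc(4) unfolding q horner_factor(2) .
      then have "horner A q v = 0" using noimag True by blast
      then show ?thesis using Suc(1)[OF deg q0] by blast
    next
      case False
      have "horner A q (A *v v - l *s v) = 0" using Suc(4) unfolding q horner_factor(1) .
      then show ?thesis using Suc(1)[OF deg q0] step[OF False] by blast
    qed
  qed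
  then show ?thesis using annihilating_poly_exists by blast
qed

lemma matrix_no_kernel_of_det:
  fixes A :: "complex ^ 'n ^ 'n"
  assumes "det (mat l - A) \<noteq> 0" "A *v v - l *s v = 0"
  shows "v = 0"
proof -
  have "mat l *v v = l *s v"
    by (simp add: vec_eq_iff matrix_vector_mult_def mat_def if_distrib[of "\<lambda>x. x * _"] cong: if_cong)
  then have "(mat l - A) *v v = 0" using assms(2) by (simp add: matrix_vector_mult_diff_rdistrib)
  moreover have "invertible (mat l - A)" using assms(1) by (simp add: invertible_det_nz)
  ultimately show ?thesis
    using matrix_left_invertible_ker[of "mat l - A"] unfolding invertible_def by blast
qed

lemma bounded_linear_smult_vec: "bounded_linear (\<lambda>c::complex. c *s (v :: complex ^ 'n))"
proof -
  have "linear (\<lambda>c::complex. c *s v)"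
    by (rule linearI) (simp_all add: vec_eq_iff vector_sadd_rdistrib)
  then show ?thesis by (simp add: linear_conv_bounded_linear)
qed

lemma norm_smult_vec: "norm (c *s (v :: complex ^ 'n)) = norm c * norm v"
  by (simp add: norm_vec_def L2_set_right_distrib norm_mult)

text \<open>The ansatz \<open>u v + z\<close>: the scalar mode absorbs the forcing along
  \<open>v\<close>, and the failure of \<open>v\<close> to be an eigenvector becomes a forcing of
  \<open>z\<close> along the next vector of the chain.\<close>

lemma matrix_forward_chain:
  fixes A :: "complex ^ 'n ^ 'n" and y :: "real \<Rightarrow> complex ^ 'n"
  assumes u: "(u has_vector_derivative l * u t + g) (at t)"
    and z: "(z has_vector_derivative A *v z t + u t *s (A *v v - l *s v)) (at t)"
  shows "((\<lambda>t. u t *s v + z t) has_vector_derivative A *v (u t *s v + z t) + g *s v) (at t)"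
proof -
  have "((\<lambda>t. u t *s v + z t) has_vector_derivative (l * u t + g) *s v + (A *v z t + u t *s (A *v v - l *s v))) (at t)"
    by (intro has_vector_derivative_add z bounded_linear.has_vector_derivative[OF bounded_linear_smult_vec u])
  also have "(l * u t + g) *s v + (A *v z t + u t *s (A *v v - l *s v)) = A *v (u t *s v + z t) + g *s v"
    by (simp add: vec.scale_left_distrib vector_ssub_ldistrib vector_smult_assoc
        matrix_vector_right_distrib vector_scalar_commute mult.commute)
  finally show ?thesis .
qed

text \<open>The estimate is stated with an exponential weight centred at \<open>t\<close> because this form composes
  along chains of generalized eigenvectors and makes a solution inherit the decay of its forcing.\<close>

definition directionally_solvable :: "complex ^ 'n ^ 'n \<Rightarrow> complex ^ 'n \<Rightarrow> real \<Rightarrow> real \<Rightarrow> bool" where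
  "directionally_solvable A v \<gamma> C \<longleftrightarrow> (\<forall>g. continuous_on UNIV g \<longrightarrow> bounded (range g) \<longrightarrow>
     (\<exists>y. (\<forall>t. (y has_vector_derivative A *v y t + g t *s v) (at t)) \<and>
        (\<forall>t m. (\<forall>s. norm (g s) \<le> m * exp (\<gamma> * \<bar>s - t\<bar>)) \<longrightarrow> norm (y t) \<le> C * m)))"

lemma weight_nonneg:
  assumes "\<And>s. norm (g s :: 'b::real_normed_vector) \<le> m * exp (\<gamma> * \<bar>s - t\<bar>)"
  shows "(m::real) \<ge> 0"
  using order_trans[OF norm_ge_zero assms[of t]] by simp

lemma weight_mono:
  fixes m :: real
  assumes "norm (g s :: 'b::real_normed_vector) \<le> m * exp (\<gamma> * \<bar>s - t\<bar>)" "m \<ge> 0" "\<gamma> \<le> \<gamma>'"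
  shows "norm (g s) \<le> m * exp (\<gamma>' * \<bar>s - t\<bar>)"
proof -
  have "m * exp (\<gamma> * \<bar>s - t\<bar>) \<le> m * exp (\<gamma>' * \<bar>s - t\<bar>)"
    using assms(2,3) by (intro mult_left_mono) (auto intro: mult_right_mono)
  then show ?thesis using assms(1) by simp
qed

text \<open>The rate must stay below \<open>\<bar>Re l\<bar>\<close> for the scalar equation and
  must not exceed \<open>\<gamma>'\<close>, so that the bound inherited by \<open>u\<close> is
  admissible as a forcing bound for \<open>z\<close>; hence the minimum.\<close>

lemma directionally_solvable_step:
  fixes A :: "complex ^ 'n ^ 'n"
  assumes l: "Re l \<noteq> 0" and P: "directionally_solvable A (A *v v - l *s v) \<gamma>' C'" "\<gamma>' > 0" "C' \<ge> 0"
  shows "\<exists>\<gamma> C. \<gamma> > 0 \<and> C \<ge> 0 \<and> directionally_solvable A v \<gamma> C"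
proof -
  define \<gamma> where "\<gamma> = min \<gamma>' (\<bar>Re l\<bar> / 2)"
  have \<gamma>: "\<gamma> > 0" "\<gamma> \<le> \<gamma>'" "\<gamma> < \<bar>Re l\<bar>" using l P(2) by (auto simp: \<gamma>_def)
  define A0 where "A0 = \<bar>Re l\<bar> - \<gamma>"
  have A0: "A0 > 0" using \<gamma> by (simp add: A0_def)
  define C where "C = (norm v + C') / A0"
  have "\<exists>y. (\<forall>t. (y has_vector_derivative A *v y t + g t *s v) (at t)) \<and>
        (\<forall>t m. (\<forall>s. norm (g s) \<le> m * exp (\<gamma> * \<bar>s - t\<bar>)) \<longrightarrow> norm (y t) \<le> C * m)"
    if g: "continuous_on UNIV g" "bounded (range g)" for g
  proof -
    obtain u where u: "\<And>t. (u has_vector_derivative l * u t + g t) (at t)"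
      "\<And>t m. (\<And>s. norm (g s) \<le> m * exp (\<gamma> * \<bar>s - t\<bar>)) \<Longrightarrow> norm (u t) \<le> m / A0"
      using scalar_bounded_solution[OF \<gamma>(1,3) g] unfolding A0_def by metis
    have cu: "continuous_on UNIV u"
      using u(1) has_vector_derivative_continuous continuous_at_imp_continuous_on by blast
    obtain B where B: "\<And>s. norm (g s) \<le> B" using g(2) unfolding bounded_iff by auto
    have B0: "B \<ge> 0" using order_trans[OF norm_ge_zero B] .
    have "norm (g s) \<le> B * exp (\<gamma> * \<bar>s - t\<bar>)" for s t
      using weight_mono[of g s B 0 t \<gamma>] B B0 \<gamma> by simp
    then have "norm (u t) \<le> B / A0" for t by (rule u(2))
    then have bu: "bounded (range u)" unfolding bounded_iff by blast
    obtain z where z: "\<And>t. (z has_vector_derivative A *v z t + u t *s (A *v v - l *s v)) (at t)"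
      "\<And>t m. (\<And>s. norm (u s) \<le> m * exp (\<gamma>' * \<bar>s - t\<bar>)) \<Longrightarrow> norm (z t) \<le> C' * m"
      using P(1) cu bu unfolding directionally_solvable_def by metis
    show ?thesis
    proof (intro exI[of _ "\<lambda>t. u t *s v + z t"] conjI allI impI)
      fix t
      show "((\<lambda>t. u t *s v + z t) has_vector_derivative A *v (u t *s v + z t) + g t *s v) (at t)"
        by (rule matrix_forward_chain[OF u(1) z(1)])
    next
      fix t m assume m: "\<forall>s. norm (g s) \<le> m * exp (\<gamma> * \<bar>s - t\<bar>)"
      then have m0: "m \<ge> 0" using weight_nonneg by blast
      \<comment> \<open>Moving the centre of the weight from \<open>t\<close> to \<open>s\<close>
        costs the factor \<open>exp (\<gamma> * \<bar>s - t\<bar>)\<close> by the triangle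
        inequality. Thus \<open>u\<close> satisfies the same kind of bound as \<open>g\<close>,
        centred at \<open>t\<close>.\<close>
      have us: "norm (u s) \<le> m / A0 * exp (\<gamma>' * \<bar>s - t\<bar>)" for s
      proof -
        have "norm (g r) \<le> (m * exp (\<gamma> * \<bar>s - t\<bar>)) * exp (\<gamma> * \<bar>r - s\<bar>)" for r
        proof -
          have "\<gamma> * \<bar>r - t\<bar> \<le> \<gamma> * (\<bar>s - t\<bar> + \<bar>r - s\<bar>)" using \<gamma> by (intro mult_left_mono) auto
          then have "m * exp (\<gamma> * \<bar>r - t\<bar>) \<le> m * exp (\<gamma> * (\<bar>s - t\<bar> + \<bar>r - s\<bar>))"
            using m0 by (intro mult_left_mono) auto
          moreover have "norm (g r) \<le> m * exp (\<gamma> * \<bar>r - t\<bar>)" using m by blast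
          ultimately show ?thesis by (simp add: ring_distribs exp_add)
        qed
        from u(2)[OF this] have "norm (u s) \<le> m / A0 * exp (\<gamma> * \<bar>s - t\<bar>)" by simp
        from weight_mono[of u s "m / A0" \<gamma> t \<gamma>', OF this] show ?thesis using m0 A0 \<gamma>(2) by simp
      qed
      have "norm (u t) \<le> m / A0" using u(2) m by blast
      then have "norm (u t *s v) \<le> m / A0 * norm v"
        unfolding norm_smult_vec by (rule mult_right_mono) simp
      moreover have "norm (z t) \<le> C' * (m / A0)" by (rule z(2)) (rule us)
      moreover have "C * m = m / A0 * norm v + C' * (m / A0)"
        by (simp add: C_def add_divide_distrib distrib_right)
      ultimately show "norm (u t *s v + z t) \<le> C * m"
        using norm_triangle_ineq[of "u t *s v" "z t"] by linarith
    qed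
  qed
  then have "directionally_solvable A v \<gamma> C" unfolding directionally_solvable_def by blast
  moreover have "C \<ge> 0" using A0 P(3) by (simp add: C_def)
  ultimately show ?thesis using \<gamma>(1) by blast
qed

lemma hyperbolic_directionally_solvable:
  fixes A :: "complex ^ 'n ^ 'n"
  assumes "\<And>l. Re l = 0 \<Longrightarrow> det (mat l - A) \<noteq> 0"
  shows "\<exists>\<gamma> C. \<gamma> > 0 \<and> C \<ge> 0 \<and> directionally_solvable A v \<gamma> C"
proof (rule generalized_eigenvector_induct[of A "\<lambda>v. \<exists>\<gamma> C. \<gamma> > 0 \<and> C \<ge> 0 \<and> directionally_solvable A v \<gamma> C"])
  show "v = 0" if "Re l = 0" "A *v v - l *s v = 0" for l v
    using matrix_no_kernel_of_det assms that by blast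
  have "directionally_solvable A 0 1 0"
    unfolding directionally_solvable_def by (auto intro!: exI[of _ "\<lambda>_. 0"])
  then show "\<exists>\<gamma> C. \<gamma> > 0 \<and> C \<ge> 0 \<and> directionally_solvable A 0 \<gamma> C"
    by (intro exI[of _ 1] exI[of _ 0]) simp
next
  fix l :: complex and v
  assume "Re l \<noteq> 0" "\<exists>\<gamma> C. \<gamma> > 0 \<and> C \<ge> 0 \<and> directionally_solvable A (A *v v - l *s v) \<gamma> C"
  then show "\<exists>\<gamma> C. \<gamma> > 0 \<and> C \<ge> 0 \<and> directionally_solvable A v \<gamma> C"
    using directionally_solvable_step[of l A v] by metis
qed

text \<open>Argued on the dual side. Pairing \<open>y\<close> with a generalized eigenvector of the
  transpose reduces the system to scalar equations \<open>u' = l * u\<close> with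
  \<open>Re l\<close> nonzero, whose bounded solutions vanish. The pairing is bilinear, without
  conjugation, so that \<open>A\<close> moves over as its transpose.\<close>

lemma hyperbolic_bounded_solution_zero:
  fixes A :: "complex ^ 'n ^ 'n"
  assumes hyp: "\<And>l. Re l = 0 \<Longrightarrow> det (mat l - A) \<noteq> 0"
    and y: "\<And>t. (y has_vector_derivative A *v y t) (at t)" and bdd: "bounded (range y)"
  shows "y t = 0"
proof -
  define dot where "dot r x = (\<Sum>i\<in>UNIV. r $ i * x $ i)" for r x :: "complex ^ 'n"
  have dotA: "dot r (A *v x) = dot (transpose A *v r) x" for r x
  proof -
    have "dot r (A *v x) = (\<Sum>i\<in>UNIV. \<Sum>j\<in>UNIV. r $ i * (A $ i $ j * x $ j))"
      by (simp add: dot_def matrix_vector_mult_def sum_distrib_left)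
    also have "\<dots> = (\<Sum>j\<in>UNIV. \<Sum>i\<in>UNIV. r $ i * (A $ i $ j * x $ j))" by (rule sum.swap)
    also have "\<dots> = dot (transpose A *v r) x"
      unfolding dot_def matrix_vector_mult_def transpose_def
      by (simp add: sum_distrib_right) (simp add: mult_ac)
    finally show ?thesis .
  qed
  have bl: "bounded_linear (dot r)" for r
    unfolding dot_def
    by (intro bounded_linear_sum bounded_linear_const_mult bounded_linear_vec_nth)
  have "\<forall>t. dot r (y t) = 0" for r
  proof (rule generalized_eigenvector_induct[of "transpose A" "\<lambda>r. \<forall>t. dot r (y t) = 0"])
    fix l :: complex and v assume "Re l = 0" "transpose A *v v - l *s v = 0"
    moreover have "mat l - transpose A = transpose (mat l - A)"
      by (simp add: transpose_def vec_eq_iff mat_def)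
    ultimately show "v = 0" using matrix_no_kernel_of_det[of l "transpose A" v] hyp[of l]
      by (simp only: det_transpose) simp
  next
    show "\<forall>t. dot 0 (y t) = 0" by (simp add: dot_def)
  next
    fix l :: complex and v assume l: "Re l \<noteq> 0" and *: "\<forall>t. dot (transpose A *v v - l *s v) (y t) = 0"
    define u where "u t = dot v (y t)" for t
    have "dot (transpose A *v v) (y t) = l * u t" for t
      using *[rule_format, of t] by (simp add: dot_def u_def sum_subtractf ring_distribs sum_distrib_left mult_ac)
    then have u': "(u has_vector_derivative l * u t) (at t)" for t
      using bounded_linear.has_vector_derivative[OF bl y, of v t] unfolding u_def dotA by simp
    have "((\<lambda>t. exp (- l * of_real t) * u t) has_vector_derivative 0) (at t)" for t
    proof -
      have e: "((\<lambda>t. exp (- l * of_real t)) has_vector_derivative exp (- l * of_real t) * - l) (at t)"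
        by (rule has_vector_derivative_real_field[unfolded o_def, of "\<lambda>z. exp (- l * z)"])
          (auto intro!: derivative_eq_intros)
      have "((\<lambda>t. exp (- l * of_real t) * u t) has_vector_derivative
          exp (- l * of_real t) * (l * u t) + exp (- l * of_real t) * - l * u t) (at t)"
        by (rule has_vector_derivative_mult[OF e u'])
      then show ?thesis by (simp add: mult_ac)
    qed
    note const = this
    obtain c where "\<And>t. t \<in> UNIV \<Longrightarrow> exp (- l * of_real t) * u t = c"
      by (rule has_vector_derivative_zero_constant[of UNIV "\<lambda>t. exp (- l * of_real t) * u t"])
        (use const in auto)
    then have c: "\<And>t. exp (- l * of_real t) * u t = c" by simp
    obtain B where B: "\<And>t. norm (u t) \<le> B"
      using bounded_linear_image[OF bdd bl[of v]] unfolding u_def bounded_iff by auto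
    have cB: "norm c \<le> exp (- Re l * t) * B" for t
    proof -
      have "norm c = exp (- Re l * t) * norm (u t)" by (simp add: norm_mult flip: c[of t])
      then show ?thesis using B by (simp add: mult_left_mono)
    qed
    have "c = 0"
    proof (rule ccontr)
      assume "c \<noteq> 0"
      \<comment> \<open>Chosen so that \<open>Re l * t\<close> is
        \<open>\<bar>B\<bar> / norm c\<close> whichever sign \<open>Re l\<close> has. Then
        \<open>1 + x \<le> exp x\<close> would give
        \<open>norm c + \<bar>B\<bar> \<le> \<bar>B\<bar>\<close>.\<close>
      define t where "t = (\<bar>B\<bar> / norm c) / Re l"
      have Bc: "norm c \<le> exp (- Re l * t) * \<bar>B\<bar>"
        by (rule order_trans[OF cB[of t]]) (simp add: mult_left_mono)
      have "1 + \<bar>B\<bar> / norm c \<le> exp (\<bar>B\<bar> / norm c)" by (rule exp_ge_add_one_self)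
      then have "norm c * (1 + \<bar>B\<bar> / norm c) \<le> norm c * exp (\<bar>B\<bar> / norm c)" by (intro mult_left_mono) auto
      moreover have "exp (\<bar>B\<bar> / norm c) * norm c \<le> \<bar>B\<bar>"
      proof -
        have "exp (\<bar>B\<bar> / norm c) * norm c \<le> exp (\<bar>B\<bar> / norm c) * (exp (- (\<bar>B\<bar> / norm c)) * \<bar>B\<bar>)"
          using Bc l by (intro mult_left_mono) (auto simp: t_def)
        also have "\<dots> = \<bar>B\<bar>" by (simp add: mult.assoc[symmetric] flip: exp_add)
        finally show ?thesis .
      qed
      moreover have "norm c * (1 + \<bar>B\<bar> / norm c) = norm c + \<bar>B\<bar>"
        using \<open>c \<noteq> 0\<close> by (simp add: distrib_left)
      moreover have "norm c > 0" using \<open>c \<noteq> 0\<close> by simp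
      ultimately show False by (simp add: mult.commute)
    qed
    then show "\<forall>t. dot v (y t) = 0" using c by (simp add: u_def)
  qed
  then have "dot (axis i 1) (y t) = 0" for i by blast
  then show ?thesis
    by (simp add: dot_def vec_eq_iff axis_def if_distrib[of "\<lambda>x. x * _"] cong: if_cong)
qed

section \<open>From complex to real linear systems\<close>

definition complexify :: "real ^ 'n \<Rightarrow> complex ^ 'n" where
  "complexify x = (\<chi> i. of_real (x $ i))"

definition Re_vec :: "complex ^ 'n \<Rightarrow> real ^ 'n" where
  "Re_vec x = (\<chi> i. Re (x $ i))"

lemma bounded_linear_complexify: "bounded_linear (complexify :: real ^ 'n \<Rightarrow> complex ^ 'n)"
  by (subst linear_conv_bounded_linear[symmetric], rule linearI)
    (simp_all add: complexify_def vec_eq_iff scaleR_conv_of_real[where 'a = complex])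

lemma bounded_linear_Re_vec: "bounded_linear (Re_vec :: complex ^ 'n \<Rightarrow> real ^ 'n)"
  by (subst linear_conv_bounded_linear[symmetric], rule linearI)
    (simp_all add: Re_vec_def vec_eq_iff)

lemma complexify_matrix_vector_mult:
  "map_matrix complex_of_real A *v complexify x = complexify (A *v x)"
  by (simp add: vec_eq_iff complexify_def matrix_vector_mult_def map_matrix_def)

lemma Re_vec_matrix_vector_mult:
  "Re_vec (map_matrix complex_of_real A *v x) = A *v Re_vec x"
  by (simp add: vec_eq_iff Re_vec_def matrix_vector_mult_def map_matrix_def)

text \<open>The coordinate directions are solved separately over the complex numbers, and the real
  part of the sum is taken. A bound at a smaller rate is a stronger hypothesis, so the minimum of
  the finitely many rates works for all directions; the cardinality in \<open>C\<close> comes from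
  summing over components.\<close>

lemma hyperbolic_green_operator:
  fixes A :: "real ^ 'n ^ 'n"
  assumes hyp: "\<And>l. Re l = 0 \<Longrightarrow> det (mat l - map_matrix complex_of_real A) \<noteq> 0"
  obtains \<gamma> C where "\<gamma> > 0" "C \<ge> 0"
    "\<And>h. continuous_on UNIV h \<Longrightarrow> bounded (range h) \<Longrightarrow>
       \<exists>y. (\<forall>t. (y has_vector_derivative A *v y t + h t) (at t)) \<and>
         (\<forall>t m. (\<forall>s. norm (h s) \<le> m * exp (\<gamma> * \<bar>s - t\<bar>)) \<longrightarrow> norm (y t) \<le> C * m)"
    "\<And>y t. (\<And>t. (y has_vector_derivative A *v y t) (at t)) \<Longrightarrow> bounded (range y) \<Longrightarrow> y t = 0"
proof -
  let ?A = "map_matrix complex_of_real A"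
  have "\<forall>i. \<exists>\<gamma> C. \<gamma> > 0 \<and> C \<ge> 0 \<and> directionally_solvable ?A (axis i 1) \<gamma> C"
    using hyperbolic_directionally_solvable[OF hyp] by blast
  then obtain G K where GK: "\<And>i. G i > 0" "\<And>i. K i \<ge> 0" "\<And>i. directionally_solvable ?A (axis i 1) (G i) (K i)"
    by metis
  define \<gamma> where "\<gamma> = Min (range G)"
  have \<gamma>: "\<gamma> > 0" "\<And>i. \<gamma> \<le> G i" using GK(1) by (auto simp: \<gamma>_def)
  define C where "C = (\<Sum>i\<in>UNIV. K i) * real CARD('n)"
  have C: "C \<ge> 0" using GK(2) by (auto simp: C_def intro!: mult_nonneg_nonneg sum_nonneg)
  show thesis
  proof (rule that[OF \<gamma>(1) C])
    fix h :: "real \<Rightarrow> real ^ 'n"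
    assume h: "continuous_on UNIV h" "bounded (range h)"
    have "\<exists>y. (\<forall>t. (y has_vector_derivative ?A *v y t + complex_of_real (h t $ i) *s axis i 1) (at t)) \<and>
        (\<forall>t m. (\<forall>s. norm (complex_of_real (h s $ i)) \<le> m * exp (G i * \<bar>s - t\<bar>)) \<longrightarrow> norm (y t) \<le> K i * m)" for i
    proof -
      have c1: "continuous_on UNIV (\<lambda>t. complex_of_real (h t $ i))" by (intro continuous_intros h)
      have b1: "bounded (range (\<lambda>t. complex_of_real (h t $ i)))"
      proof -
        obtain B where B: "\<And>t. norm (h t) \<le> B" using h(2) unfolding bounded_iff by auto
        have "norm (complex_of_real (h t $ i)) \<le> B" for t
          using component_le_norm_cart[of "h t" i] B[of t] by simp
        then show ?thesis unfolding bounded_iff by blast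
      qed
      show ?thesis
        by (rule GK(3)[of i, unfolded directionally_solvable_def, THEN spec, THEN mp, THEN mp, OF c1 b1])
    qed
    then obtain Y where Y: "\<And>i t. (Y i has_vector_derivative ?A *v Y i t + complex_of_real (h t $ i) *s axis i 1) (at t)"
      "\<And>i t m. (\<And>s. norm (complex_of_real (h s $ i)) \<le> m * exp (G i * \<bar>s - t\<bar>)) \<Longrightarrow> norm (Y i t) \<le> K i * m"
      by metis
    define y where "y t = Re_vec (\<Sum>i\<in>UNIV. Y i t)" for t
    show "\<exists>y. (\<forall>t. (y has_vector_derivative A *v y t + h t) (at t)) \<and>
         (\<forall>t m. (\<forall>s. norm (h s) \<le> m * exp (\<gamma> * \<bar>s - t\<bar>)) \<longrightarrow> norm (y t) \<le> C * m)"
    proof (intro exI[of _ y] conjI allI impI)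
      fix t
      have "(y has_vector_derivative Re_vec (\<Sum>i\<in>UNIV. ?A *v Y i t + complex_of_real (h t $ i) *s axis i 1)) (at t)"
        unfolding y_def
        by (intro bounded_linear.has_vector_derivative[OF bounded_linear_Re_vec] has_vector_derivative_sum Y)
      also have "(\<Sum>i\<in>UNIV. ?A *v Y i t + complex_of_real (h t $ i) *s axis i 1) =
          ?A *v (\<Sum>i\<in>UNIV. Y i t) + complexify (h t)"
        by (simp add: sum.distrib linear_sum[OF matrix_vector_mul_linear])
          (simp add: complexify_def vec_eq_iff axis_def if_distrib[of "(*) _"] cong: if_cong)
      also have "Re_vec (?A *v (\<Sum>i\<in>UNIV. Y i t) + complexify (h t)) = A *v y t + h t"
        unfolding y_def Re_vec_matrix_vector_mult[symmetric]
        by (simp add: Re_vec_def complexify_def vec_eq_iff)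
      finally show "(y has_vector_derivative A *v y t + h t) (at t)" .
    next
      fix t m assume m: "\<forall>s. norm (h s) \<le> m * exp (\<gamma> * \<bar>s - t\<bar>)"
      then have m0: "m \<ge> 0" using weight_nonneg by blast
      have "norm (Y i t) \<le> K i * m" for i
      proof (rule Y(2))
        fix s
        have "norm (h s $ i) \<le> m * exp (\<gamma> * \<bar>s - t\<bar>)"
          using m[rule_format, of s] component_le_norm_cart[of "h s" i] by simp
        from weight_mono[of "\<lambda>s. h s $ i", OF this m0 \<gamma>(2)[of i]]
        show "norm (complex_of_real (h s $ i)) \<le> m * exp (G i * \<bar>s - t\<bar>)" by simp
      qed
      then have S: "norm (\<Sum>i\<in>UNIV. Y i t) \<le> (\<Sum>i\<in>UNIV. K i) * m"
        unfolding sum_distrib_right by (intro sum_norm_le) auto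
      have "norm (y t) \<le> (\<Sum>i\<in>UNIV. \<bar>y t $ i\<bar>)" by (rule norm_le_l1_cart)
      also have "\<dots> \<le> (\<Sum>i\<in>(UNIV::'n set). (\<Sum>i\<in>UNIV. K i) * m)"
      proof (rule sum_mono)
        fix i
        have "\<bar>y t $ i\<bar> \<le> norm ((\<Sum>i\<in>UNIV. Y i t) $ i)"
          unfolding y_def Re_vec_def vec_lambda_beta by (rule abs_Re_le_cmod)
        also have "\<dots> \<le> norm (\<Sum>i\<in>UNIV. Y i t)" by (rule Finite_Cartesian_Product.norm_nth_le)
        finally show "\<bar>y t $ i\<bar> \<le> (\<Sum>i\<in>UNIV. K i) * m" using S by linarith
      qed
      finally show "norm (y t) \<le> C * m" by (simp add: C_def mult_ac)
    qed
  next
    fix y :: "real \<Rightarrow> real ^ 'n" and t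
    assume y: "\<And>t. (y has_vector_derivative A *v y t) (at t)" "bounded (range y)"
    have "complexify (y t) = 0"
    proof (rule hyperbolic_bounded_solution_zero[OF hyp, of "\<lambda>t. complexify (y t)"])
      show "((\<lambda>t. complexify (y t)) has_vector_derivative ?A *v complexify (y t)) (at t)" for t
        unfolding complexify_matrix_vector_mult
        by (rule bounded_linear.has_vector_derivative[OF bounded_linear_complexify y(1)])
      show "bounded (range (\<lambda>t. complexify (y t)))"
        using bounded_linear_image[OF y(2) bounded_linear_complexify] by (simp add: image_image)
    qed
    then show "y t = 0" by (simp add: complexify_def vec_eq_iff)
  qed
qed

lemma hyperbolic_saddle_no_imaginary_eigenvalue:
  assumes "hyperbolic_saddle g p n_s n_u" "Re l = 0"
  shows "det (mat l - map_matrix complex_of_real (jacobian g (at p))) \<noteq> 0"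
proof -
  let ?A = "map_matrix complex_of_real (jacobian g (at p))"
  define q where "q = charpoly ?A"
  have hs: "eigenvalue_count (jacobian g (at p)) {z. Re z = 0} = 0"
    "eigenvalue_count (jacobian g (at p)) {z. Re z < 0} > 0"
    using assms(1) unfolding hyperbolic_saddle_def by auto
  have e0: "(\<Sum>z\<in>{z\<in>{z. Re z = 0}. poly q z = 0}. order z q) = 0"
    and e1: "(\<Sum>z\<in>{z\<in>{z. Re z < 0}. poly q z = 0}. order z q) > 0"
    using hs unfolding eigenvalue_count_def Let_def q_def by simp_all
  \<comment> \<open>For the zero polynomial the root set in the open left half-plane is infinite,
    and a sum over an infinite set is 0. The positive count there excludes this, so the root sets
    are finite and the counts mean what they say.\<close>
  have q0: "q \<noteq> 0"
  proof
    assume "q = 0"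
    have "infinite {z. Re z < 0}"
    proof
      assume "finite {z. Re z < 0}"
      then have "finite (Re ` {z. Re z < 0})" by simp
      moreover have "{..<0} \<subseteq> Re ` {z. Re z < 0}"
        by (auto simp: image_iff intro!: exI[of _ "complex_of_real _"])
      ultimately show False using infinite_Iio finite_subset by blast
    qed
    then show False using e1 \<open>q = 0\<close> by simp
  qed
  have "poly q l \<noteq> 0"
  proof
    assume l: "poly q l = 0"
    have "finite {z\<in>{z. Re z = 0}. poly q z = 0}" using poly_roots_finite[OF q0] by simp
    then have "order l q = 0" using e0 l assms(2) by simp
    then show False using order_root l q0 by blast
  qed
  moreover have "poly q l = det (mat l - ?A)"
    by (simp add: q_def charpoly_def det_def poly_sum poly_prod mat_def)
      (rule sum.cong, simp, intro arg_cong2[where f = "(*)"] prod.cong, auto simp: sign_def)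
  ultimately show ?thesis by simp
qed

section \<open>Functions vanishing at infinity and compact operators\<close>

lemma integrable_inverse_1_plus_square: "integrable lborel (\<lambda>t::real. inverse (1 + t\<^sup>2))"
proof -
  have pos: "1 + x\<^sup>2 \<noteq> 0" for x :: real by (smt (verit) zero_le_power2)
  have "set_integrable lborel (einterval (-\<infinity>) \<infinity>) (\<lambda>t::real. inverse (1 + t\<^sup>2))"
  proof (rule interval_integral_FTC_nonneg(1)[where F = arctan and A = "- (pi / 2)" and B = "pi / 2"])
    show "((arctan \<circ> real_of_ereal) \<longlongrightarrow> - (pi / 2)) (at_right (-\<infinity>))"
      by (simp add: ereal_tendsto_simps tendsto_arctan_at_bot)
    show "((arctan \<circ> real_of_ereal) \<longlongrightarrow> pi / 2) (at_left \<infinity>)"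
      by (simp add: ereal_tendsto_simps tendsto_arctan_at_top)
  qed (use pos in \<open>auto intro!: DERIV_arctan continuous_intros\<close>)
  then show ?thesis by (simp add: set_integrable_def)
qed

text \<open>Used twice: for the pairing with an adjoint solution, where it gives the solvability
  condition, and for the energy along an orbit.\<close>

lemma integral_derivative_vanishing:
  fixes u k :: "real \<Rightarrow> real"
  assumes u: "\<And>t. (u has_vector_derivative k t) (at t)" and k: "continuous_on UNIV k"
    and int: "integrable lborel k" and lim: "(u \<longlongrightarrow> 0) at_infinity"
  shows "(LINT t|lborel. k t) = 0"
proof -
  have l: "(u \<longlongrightarrow> 0) at_top" "(u \<longlongrightarrow> 0) at_bot"
    using lim at_top_le_at_infinity at_bot_le_at_infinity by (auto intro: tendsto_mono)
  have "(LBINT x=-\<infinity>..\<infinity>. k x) = 0 - 0"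
  proof (rule interval_integral_FTC_integrable[where F = u])
    show "isCont k x" for x using k by (simp add: continuous_on_eq_continuous_at)
    show "set_integrable lborel (einterval (-\<infinity>) \<infinity>) k" using int by (simp add: set_integrable_def)
    show "((u \<circ> real_of_ereal) \<longlongrightarrow> 0) (at_right (-\<infinity>))" "((u \<circ> real_of_ereal) \<longlongrightarrow> 0) (at_left \<infinity>)"
      using l by (simp_all add: ereal_tendsto_simps)
  qed (use u in auto)
  then show ?thesis by (simp add: interval_lebesgue_integral_def set_lebesgue_integral_def)
qed

text \<open>The set where \<open>f\<close> is nonzero is open and negligible, hence empty.\<close>

lemma integral_nonneg_continuous_eq_0:
  fixes f :: "real \<Rightarrow> real"
  assumes f: "continuous_on UNIV f" "integrable lborel f" "\<And>t. f t \<ge> 0" and 0: "(LINT t|lborel. f t) = 0"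
  shows "f t = 0"
proof -
  have "AE t in lborel. f t = 0"
    using integral_nonneg_eq_0_iff_AE[OF f(2)] f(3) 0 by simp
  then have "AE t in lebesgue. f t = 0" by (rule AE_completion)
  then have "negligible {t. f t \<noteq> 0}"
    by (auto simp: negligible_iff_null_sets eventually_ae_filter intro: completion.complete2)
  moreover have "open {t. f t \<noteq> 0}" using f(1) by (rule open_Collect_neq) auto
  ultimately show ?thesis using open_not_negligible by blast
qed

section \<open>Compact operators and functions vanishing at both ends of the line\<close>

definition compact_operator :: "('a::real_normed_vector \<Rightarrow> 'b::real_normed_vector) \<Rightarrow> bool" where
  "compact_operator K \<longleftrightarrow> bounded_linear K \<and>
     (\<forall>X::nat \<Rightarrow> 'a. (\<forall>n. norm (X n) \<le> 1) \<longrightarrow> (\<exists>r l. strict_mono r \<and> (\<lambda>n. K (X (r n))) \<longlonglongrightarrow> l))"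

lemma compact_operator_add:
  assumes K: "compact_operator K" and L: "compact_operator L"
  shows "compact_operator (\<lambda>x. K x + L x)"
  unfolding compact_operator_def
proof (intro conjI allI impI)
  show "bounded_linear (\<lambda>x. K x + L x)"
    using K L unfolding compact_operator_def by (intro bounded_linear_add) auto
  fix X :: "nat \<Rightarrow> 'a" assume X: "\<forall>n. norm (X n) \<le> 1"
  then obtain r l where r: "strict_mono r" "(\<lambda>n. K (X (r n))) \<longlonglongrightarrow> l"
    using K unfolding compact_operator_def by blast
  have "\<forall>n. norm (X (r n)) \<le> 1" using X by simp
  then have "\<exists>s m. strict_mono s \<and> (\<lambda>n. L (X (r (s n)))) \<longlonglongrightarrow> m"
    using L unfolding compact_operator_def by (elim conjE allE[of _ "\<lambda>n. X (r n)"]) simp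
  then obtain s m where s: "strict_mono s" "(\<lambda>n. L (X (r (s n)))) \<longlonglongrightarrow> m" by blast
  have "(\<lambda>n. K (X (r (s n)))) \<longlonglongrightarrow> l"
    using LIMSEQ_subseq_LIMSEQ[OF r(2) s(1)] by (simp add: o_def)
  from tendsto_add[OF this s(2)] strict_mono_o[OF r(1) s(1)]
  show "\<exists>r l. strict_mono r \<and> (\<lambda>n. K (X (r n)) + L (X (r n))) \<longlonglongrightarrow> l"
    by (auto simp: o_def)
qed

lemma compact_operator_rank_one:
  fixes f :: "'a::real_normed_vector \<Rightarrow> real"
  assumes f: "bounded_linear f"
  shows "compact_operator (\<lambda>x. f x *\<^sub>R v)"
  unfolding compact_operator_def
proof (intro conjI allI impI)
  show "bounded_linear (\<lambda>x. f x *\<^sub>R v)" by (rule bounded_linear_scaleR_const[OF f])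
  fix X :: "nat \<Rightarrow> 'a" assume X: "\<forall>n. norm (X n) \<le> 1"
  obtain B where B: "\<And>x. norm (f x) \<le> norm x * B" "B > 0" using bounded_linear.pos_bounded[OF f] by blast
  have "norm (f (X n)) \<le> B" for n
  proof -
    have "norm (X n) * B \<le> 1 * B" using X B(2) by (intro mult_right_mono) auto
    then show ?thesis using B(1)[of "X n"] by simp
  qed
  then have fB: "\<forall>n. f (X n) \<in> cball 0 B" by simp
  have "seq_compact (cball 0 B :: real set)" using compact_eq_seq_compact_metric compact_cball by blast
  from seq_compactE[OF this fB] obtain l r where r: "strict_mono r" "((\<lambda>n. f (X n)) \<circ> r) \<longlonglongrightarrow> l" .
  then have "(\<lambda>n. f (X (r n))) \<longlonglongrightarrow> l" by (simp add: o_def)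
  with r(1) show "\<exists>r l. strict_mono r \<and> (\<lambda>n. f (X (r n)) *\<^sub>R v) \<longlonglongrightarrow> l"
    by (intro exI[of _ r] exI[of _ "l *\<^sub>R v"] conjI tendsto_scaleR tendsto_const)
qed

lemma compact_operator_inverse:
  fixes K :: "'a::banach \<Rightarrow> 'a"
  assumes "compact_operator K" "\<And>x. x - K x = 0 \<Longrightarrow> x = 0"
  obtains W where "bounded_linear W" "\<And>h. W h - K (W h) = h"
proof (rule riesz_schauder_inverse[of K])
  show "bounded_linear K" using assms(1) by (simp add: compact_operator_def)
  show "\<exists>r l. strict_mono r \<and> (\<lambda>n. K (X (r n))) \<longlonglongrightarrow> l" if "\<And>n. norm (X n) \<le> 1" for X :: "nat \<Rightarrow> 'a"
    using assms(1) that by (simp add: compact_operator_def)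
qed (use assms(2) that in auto)

text \<open>Makes \<open>compact_operator_inverse\<close> applicable to bounded continuous functions
  on the line.\<close>

instance bcontfun :: (metric_space, banach) banach ..

definition vanishing :: "(real \<Rightarrow> 'a::real_normed_vector) \<Rightarrow> bool" where
  "vanishing h \<longleftrightarrow> (h \<longlongrightarrow> 0) at_infinity"

lemma vanishingD:
  assumes "vanishing h" "e > 0"
  obtains N where "\<And>t. \<bar>t\<bar> \<ge> N \<Longrightarrow> norm (h t) < e"
proof -
  from assms obtain N where "\<forall>t. N \<le> norm t \<longrightarrow> dist (h t) 0 < e"
    unfolding vanishing_def Lim_at_infinity by blast
  then show thesis by (intro that[of N]) simp
qed

text \<open>Converts decay into a weighted bound with small constant, centred at any far point
  \<open>t\<close>. Where \<open>h\<close> is not yet small, \<open>s\<close> is so far from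
  \<open>t\<close> that \<open>e * exp (\<gamma> * \<bar>s - t\<bar>)\<close> exceeds the bound of
  \<open>h\<close>; the threshold \<open>M\<close> comes from \<open>x \<le> exp x\<close>.\<close>

lemma vanishing_weight:
  fixes h :: "real \<Rightarrow> 'a::real_normed_vector"
  assumes h: "vanishing h" "bounded (range h)" and \<gamma>: "\<gamma> > 0" and e: "e > 0"
  obtains N where "\<And>s t. \<bar>t\<bar> \<ge> N \<Longrightarrow> norm (h s) \<le> e * exp (\<gamma> * \<bar>s - t\<bar>)"
proof -
  obtain N where N: "\<And>t. \<bar>t\<bar> \<ge> N \<Longrightarrow> norm (h t) < e" using vanishingD[OF h(1) e] by metis
  obtain B where B: "\<And>s. norm (h s) \<le> B" using h(2) unfolding bounded_iff by auto
  define M where "M = \<bar>N\<bar> + \<bar>B\<bar> / (e * \<gamma>)"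
  show thesis
  proof (rule that[of M])
    fix s t :: real assume t: "\<bar>t\<bar> \<ge> M"
    show "norm (h s) \<le> e * exp (\<gamma> * \<bar>s - t\<bar>)"
    proof (cases "\<bar>s\<bar> \<ge> N")
      case True
      have "e * 1 \<le> e * exp (\<gamma> * \<bar>s - t\<bar>)" using e \<gamma> by (intro mult_left_mono) auto
      then show ?thesis using N[OF True] by simp
    next
      case False
      then have "\<bar>B\<bar> / (e * \<gamma>) \<le> \<bar>s - t\<bar>" using t by (simp add: M_def)
      then have "e * (\<gamma> * (\<bar>B\<bar> / (e * \<gamma>))) \<le> e * (\<gamma> * \<bar>s - t\<bar>)" using e \<gamma> by (intro mult_left_mono) auto
      then have "\<bar>B\<bar> \<le> e * (\<gamma> * \<bar>s - t\<bar>)" using e \<gamma> by simp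
      also have "\<dots> \<le> e * exp (\<gamma> * \<bar>s - t\<bar>)"
        using e exp_ge_add_one_self[of "\<gamma> * \<bar>s - t\<bar>"] by (intro mult_left_mono) linarith+
      finally show ?thesis using B[of s] by linarith
    qed
  qed
qed

lemma vanishing_bound:
  assumes "vanishing b" "\<And>t. norm (h t) \<le> C * norm (b t)"
  shows "vanishing h"
proof -
  have "((\<lambda>t. C * norm (b t)) \<longlongrightarrow> 0) at_infinity"
    using assms(1) unfolding vanishing_def by (intro tendsto_mult_right_zero tendsto_norm_zero)
  then show ?thesis unfolding vanishing_def
    by (rule Lim_null_comparison[rotated]) (use assms(2) in simp)
qed

lemma vanishing_add: "vanishing f \<Longrightarrow> vanishing g \<Longrightarrow> vanishing (\<lambda>t. f t + g t)"
  unfolding vanishing_def using tendsto_add[of f 0 _ g 0] by simp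

lemma vanishing_diff: "vanishing f \<Longrightarrow> vanishing g \<Longrightarrow> vanishing (\<lambda>t. f t - g t)"
  unfolding vanishing_def using tendsto_diff[of f 0 _ g 0] by simp

lemma vanishing_scaleR: "vanishing f \<Longrightarrow> vanishing (\<lambda>t. c *\<^sub>R f t)"
  unfolding vanishing_def using tendsto_scaleR[OF tendsto_const, of f 0 _ c] by simp

lemma bcontfun_of_bounded:
  assumes "continuous_on UNIV f" "\<And>t. norm (f t) \<le> B"
  shows "apply_bcontfun (Bcontfun f) = f"
  using bcontfun_normI[OF assms] by (rule Bcontfun_inverse)

text \<open>Uniform limits keep the limit 0 at infinity. Closedness lets the contraction argument
  run inside the functions that vanish there, so its fixed point decays at both ends.\<close>

lemma closed_vanishing: "closed {h :: real \<Rightarrow>\<^sub>C 'a::real_normed_vector. vanishing h}"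
  unfolding closed_sequential_limits
proof (intro allI impI, elim conjE)
  fix X :: "nat \<Rightarrow> real \<Rightarrow>\<^sub>C 'a" and h :: "real \<Rightarrow>\<^sub>C 'a"
  assume X: "\<forall>n. X n \<in> {h :: real \<Rightarrow>\<^sub>C 'a. vanishing h}" "X \<longlonglongrightarrow> h"
  have "vanishing h"
    unfolding vanishing_def Lim_at_infinity
  proof (intro allI impI)
    fix e :: real assume e: "e > 0"
    then obtain n where n: "dist (X n) h < e / 2"
      using X(2) unfolding lim_sequentially by (metis half_gt_zero order_refl)
    obtain N where N: "\<And>t. \<bar>t\<bar> \<ge> N \<Longrightarrow> norm (X n t) < e / 2"
      using vanishingD[of "X n" "e / 2"] X(1) e by (metis half_gt_zero mem_Collect_eq)
    show "\<exists>b. \<forall>x. b \<le> norm x \<longrightarrow> dist (h x) 0 < e"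
    proof (intro exI allI impI)
      fix t :: real assume "N \<le> norm t"
      then have "norm (X n t) < e / 2" using N by simp
      moreover have "dist (X n t) (h t) < e / 2" using n dist_bounded[of "X n" t h] by simp
      ultimately show "dist (h t) 0 < e"
        using norm_triangle_ineq[of "X n t" "h t - X n t"] by (simp add: dist_norm norm_minus_commute)
    qed
  qed
  then show "h \<in> {h :: real \<Rightarrow>\<^sub>C 'a. vanishing h}" by simp
qed

text \<open>Arzela-Ascoli on the whole line. The uniform tails reduce every tolerance to a compact
  interval, a diagonal subsequence handles all tolerances at once, and completeness provides the
  limit.\<close>

lemma bcontfun_convergent_subsequence:
  fixes v :: "nat \<Rightarrow> real \<Rightarrow>\<^sub>C 'a::euclidean_space"
  assumes bnd: "\<And>n t. norm (v n t) \<le> M"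
    and lip: "\<And>n s t. norm (v n s - v n t) \<le> L * \<bar>s - t\<bar>"
    and tail: "\<And>e. e > 0 \<Longrightarrow> \<exists>N. \<forall>n t. \<bar>t\<bar> \<ge> N \<longrightarrow> norm (v n t) \<le> e"
  obtains r l where "strict_mono r" "(\<lambda>n. v (r n)) \<longlonglongrightarrow> l"
proof -
  \<comment> \<open>Eventual diameter instead of a named limit: this property passes to sequences
    that eventually select from the given one, as diagonalization requires.\<close>
  define P where "P i r \<longleftrightarrow> (\<exists>N. \<forall>m\<ge>N. \<forall>n\<ge>N. dist (v (r m)) (v (r n)) \<le> inverse (real (Suc i)))"
    for i and r :: "nat \<Rightarrow> nat"
  have L0: "L \<ge> 0" using order_trans[OF norm_ge_zero lip[of 0 1 0]] by simp
  have sub: "\<exists>k. strict_mono k \<and> P i (r \<circ> k)" for i and r :: "nat \<Rightarrow> nat"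
  proof -
    \<comment> \<open>Two tails, or two deviations from the limit on the interval, get added; hence
      half the tolerance.\<close>
    define e where "e = inverse (real (Suc i)) / 2"
    have e: "e > 0" by (simp add: e_def)
    obtain N where N: "\<And>n t. \<bar>t\<bar> \<ge> N \<Longrightarrow> norm (v n t) \<le> e" using tail[OF e] by blast
    obtain g and k :: "nat \<Rightarrow> nat" where k: "strict_mono k"
      and g: "\<And>e. 0 < e \<Longrightarrow> \<exists>n0. \<forall>n x. n \<ge> n0 \<and> x \<in> {-N..N} \<longrightarrow> norm (v (r (k n)) x - g x) < e"
    proof (rule Arzela_Ascoli[of "{-N..N}" "\<lambda>n. apply_bcontfun (v (r n))" M])
      fix x d :: real assume d: "0 < d"
      show "\<exists>\<delta>>0. \<forall>n y. y \<in> {-N..N} \<and> norm (x - y) < \<delta> \<longrightarrow> norm (v (r n) x - v (r n) y) < d"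
      proof (intro exI[of _ "d / (L + 1)"] conjI allI impI)
        show "0 < d / (L + 1)" using d L0 by simp
        fix n y assume "y \<in> {-N..N} \<and> norm (x - y) < d / (L + 1)"
        then have "(L + 1) * \<bar>x - y\<bar> < d" using L0 by (simp add: pos_less_divide_eq mult.commute)
        moreover have "L * \<bar>x - y\<bar> \<le> (L + 1) * \<bar>x - y\<bar>" by (intro mult_right_mono) auto
        ultimately show "norm (v (r n) x - v (r n) y) < d" using lip[of "r n" x y] by linarith
      qed
    qed (use bnd in auto)
    obtain n0 where n0: "\<And>n x. n \<ge> n0 \<Longrightarrow> x \<in> {-N..N} \<Longrightarrow> norm (v (r (k n)) x - g x) < e"
      using g[OF e] by blast
    have "dist (v (r (k m))) (v (r (k n))) \<le> inverse (real (Suc i))" if "m \<ge> n0" "n \<ge> n0" for m n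
    proof (rule dist_bound)
      fix t
      have "norm (v (r (k m)) t - v (r (k n)) t) \<le> e + e"
      proof (cases "\<bar>t\<bar> \<ge> N")
        case True
        then show ?thesis using N[of t "r (k m)"] N[of t "r (k n)"]
          by (intro order_trans[OF norm_triangle_ineq4] add_mono)
      next
        case False
        then have "norm (v (r (k m)) t - g t) < e" "norm (v (r (k n)) t - g t) < e"
          using n0[OF that(1), of t] n0[OF that(2), of t] False by (simp_all add: abs_le_iff not_le abs_less_iff)
        then show ?thesis using norm_triangle_ineq4[of "v (r (k m)) t - g t" "v (r (k n)) t - g t"] by simp
      qed
      then show "dist (v (r (k m)) t) (v (r (k n)) t) \<le> inverse (real (Suc i))"
        by (simp add: dist_norm e_def)
    qed
    then show ?thesis using k unfolding P_def by (auto simp: o_def)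
  qed
  obtain r where r: "strict_mono r" "\<And>i. P i r"
  proof (rule subsequence_diagonalization_lemma[of P id])
    fix i and r k1 k2 :: "nat \<Rightarrow> nat" and N
    assume P1: "P i (r \<circ> k1)" and k2: "\<And>j. N \<le> j \<Longrightarrow> \<exists>j'\<ge>j. k2 j = k1 j'"
    from P1 obtain N1 where N1: "\<And>m n. m \<ge> N1 \<Longrightarrow> n \<ge> N1 \<Longrightarrow>
        dist (v (r (k1 m))) (v (r (k1 n))) \<le> inverse (real (Suc i))"
      unfolding P_def by (auto simp: o_def)
    show "P i (r \<circ> k2)" unfolding P_def
    proof (intro exI[of _ "max N N1"] allI impI)
      fix m n assume mn: "max N N1 \<le> m" "max N N1 \<le> n"
      obtain m' where "m' \<ge> m" "k2 m = k1 m'" using k2[of m] mn by auto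
      moreover obtain n' where "n' \<ge> n" "k2 n = k1 n'" using k2[of n] mn by auto
      ultimately show "dist (v ((r \<circ> k2) m)) (v ((r \<circ> k2) n)) \<le> inverse (real (Suc i))"
        using N1[of m' n'] mn by simp
    qed
  qed (use sub in auto)
  have "Cauchy (\<lambda>n. v (r n))"
  proof (rule metric_CauchyI)
    fix e :: real assume "e > 0"
    then obtain i where i: "inverse (real (Suc i)) < e" using reals_Archimedean by blast
    with r(2)[of i] show "\<exists>M. \<forall>m\<ge>M. \<forall>n\<ge>M. dist (v (r m)) (v (r n)) < e"
      unfolding P_def by (meson le_less_trans)
  qed
  then show thesis using that r(1) Cauchy_convergent convergent_def by blast
qed

section \<open>Fredholm theory of the variational equation\<close>

text \<open>A homoclinic orbit approaches the same equilibrium in both time directions, so one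
  matrix \<open>A0\<close> is the limit at both ends. The scalar \<open>b\<close> measures the
  distance to it uniformly in the vector.\<close>

locale asymptotically_hyperbolic =
  fixes A0 :: "real ^ 'n ^ 'n" and A :: "real \<Rightarrow> real ^ 'n \<Rightarrow> real ^ 'n" and b :: "real \<Rightarrow> real"
  assumes no_imaginary: "\<And>l. Re l = 0 \<Longrightarrow> det (mat l - map_matrix complex_of_real A0) \<noteq> 0"
    and A_linear: "linear (A t)"
    and A_continuous: "continuous_on UNIV w \<Longrightarrow> continuous_on UNIV (\<lambda>t. A t (w t))"
    and A_close: "norm (A t v - A0 *v v) \<le> b t * norm v"
    and b_vanishing: "vanishing b" and b_bounded: "bounded (range b)"
begin

definition perturbation :: "(real \<Rightarrow>\<^sub>C (real ^ 'n)) \<Rightarrow> (real \<Rightarrow>\<^sub>C (real ^ 'n))" where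
  "perturbation w = Bcontfun (\<lambda>t. A t (w t) - A0 *v w t)"

lemma b_bound: "\<exists>M\<ge>0. \<forall>t. b t \<le> M"
proof -
  obtain M where M: "\<And>t. norm (b t) \<le> M" using b_bounded unfolding bounded_iff by auto
  show ?thesis
  proof (intro exI[of _ M] conjI allI)
    show "M \<ge> 0" using order_trans[OF norm_ge_zero M] .
    show "b t \<le> M" for t using M[of t] by simp
  qed
qed

lemma b_nonneg: "b t \<ge> 0"
proof -
  have "0 \<le> norm (A t (axis undefined 1) - A0 *v axis undefined 1)" by simp
  also have "\<dots> \<le> b t" using A_close[of t "axis undefined 1"] by simp
  finally show ?thesis .
qed

lemma perturbation_apply: "perturbation w t = A t (w t) - A0 *v w t"
proof -
  obtain M where M: "M \<ge> 0" "\<And>t. b t \<le> M" using b_bound by blast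
  have "apply_bcontfun (perturbation w) = (\<lambda>t. A t (w t) - A0 *v w t)"
    unfolding perturbation_def
  proof (rule bcontfun_of_bounded)
    show "continuous_on UNIV (\<lambda>t. A t (w t) - A0 *v w t)"
      by (intro continuous_on_diff A_continuous bounded_linear.continuous_on[OF matrix_vector_mul_bounded_linear]) auto
    show "norm (A t (w t) - A0 *v w t) \<le> M * norm w" for t
      by (rule order_trans[OF A_close]) (use M norm_bounded[of w t] in \<open>auto intro!: mult_mono\<close>)
  qed
  then show ?thesis by simp
qed

lemma norm_perturbation_apply: "norm (perturbation w t) \<le> norm w * b t"
proof -
  have "norm (perturbation w t) \<le> b t * norm (w t)" unfolding perturbation_apply by (rule A_close)
  also have "\<dots> \<le> b t * norm w" by (intro mult_left_mono norm_bounded b_nonneg)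
  finally show ?thesis by (simp add: mult.commute)
qed

lemma bounded_linear_perturbation: "bounded_linear perturbation"
proof -
  obtain M where M: "M \<ge> 0" "\<And>t. b t \<le> M" using b_bound by blast
  show ?thesis
  proof (rule bounded_linear_intro[where K = M])
    show "perturbation (x + y) = perturbation x + perturbation y" for x y
      by (rule bcontfun_eqI)
        (simp add: perturbation_apply linear_add[OF A_linear] matrix_vector_right_distrib)
    show "perturbation (r *\<^sub>R x) = r *\<^sub>R perturbation x" for r x
      by (rule bcontfun_eqI)
        (simp add: perturbation_apply linear_scale[OF A_linear] matrix_vector_mult_scaleR scaleR_diff_right)
    show "norm (perturbation x) \<le> norm x * M" for x
      by (rule norm_bound, rule order_trans[OF norm_perturbation_apply]) (use M in \<open>auto intro!: mult_left_mono\<close>)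
  qed
qed

lemma vanishing_perturbation: "vanishing (perturbation w)"
  using b_vanishing
  by (rule vanishing_bound[where C = "norm w"])
    (rule order_trans[OF norm_perturbation_apply], simp add: b_nonneg)

text \<open>Compactness rests on \<open>b\<close>. For \<open>w\<close> in the unit ball, the images
  are bounded, their derivatives are bounded through the equation, and their tails are uniformly
  small because all the forcings are dominated by the single vanishing function \<open>b\<close>.
  These are the hypotheses of \<open>bcontfun_convergent_subsequence\<close>.\<close>

lemma green_operator:
  obtains G :: "(real \<Rightarrow>\<^sub>C (real ^ 'n)) \<Rightarrow> (real \<Rightarrow>\<^sub>C (real ^ 'n))"
  where "bounded_linear G"
    "\<And>(h :: real \<Rightarrow>\<^sub>C (real ^ 'n)) t. (apply_bcontfun (G h) has_vector_derivative A0 *v G h t + h t) (at t)"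
    "\<And>(h :: real \<Rightarrow>\<^sub>C (real ^ 'n)) y. (\<And>t. (y has_vector_derivative A0 *v y t + apply_bcontfun h t) (at t)) \<Longrightarrow> bounded (range y) \<Longrightarrow> y = apply_bcontfun (G h)"
    "\<And>h :: real \<Rightarrow>\<^sub>C (real ^ 'n). vanishing (apply_bcontfun h) \<Longrightarrow> vanishing (apply_bcontfun (G h))"
    "compact_operator (\<lambda>w. G (perturbation w))"
proof -
  obtain \<gamma> C where gC: "\<gamma> > 0" "C \<ge> 0"
    and ex: "\<And>h. continuous_on UNIV h \<Longrightarrow> bounded (range h) \<Longrightarrow>
       \<exists>y. (\<forall>t. (y has_vector_derivative A0 *v y t + h t) (at t)) \<and>
         (\<forall>t m. (\<forall>s. norm (h s) \<le> m * exp (\<gamma> * \<bar>s - t\<bar>)) \<longrightarrow> norm (y t) \<le> C * m)"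
    and zero: "\<And>y t. (\<And>t. (y has_vector_derivative A0 *v y t) (at t)) \<Longrightarrow> bounded (range y) \<Longrightarrow> y t = 0"
    using hyperbolic_green_operator[OF no_imaginary] by blast
  have "\<exists>y :: real \<Rightarrow>\<^sub>C (real ^ 'n). (\<forall>t. (y has_vector_derivative A0 *v y t + h t) (at t)) \<and>
         (\<forall>t m. (\<forall>s. norm (h s) \<le> m * exp (\<gamma> * \<bar>s - t\<bar>)) \<longrightarrow> norm (y t) \<le> C * m)"
    for h :: "real \<Rightarrow>\<^sub>C (real ^ 'n)"
  proof -
    obtain y where y: "\<And>t. (y has_vector_derivative A0 *v y t + h t) (at t)"
      "\<And>t m. (\<And>s. norm (h s) \<le> m * exp (\<gamma> * \<bar>s - t\<bar>)) \<Longrightarrow> norm (y t) \<le> C * m"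
      using ex[of h] by auto
    have "norm (y t) \<le> C * norm h" for t
    proof (rule y(2))
      fix s
      have "norm h * 1 \<le> norm h * exp (\<gamma> * \<bar>s - t\<bar>)" using gC by (intro mult_left_mono) auto
      then show "norm (h s) \<le> norm h * exp (\<gamma> * \<bar>s - t\<bar>)" using norm_bounded[of h s] by simp
    qed
    moreover have "continuous_on UNIV y"
      using y(1) has_vector_derivative_continuous continuous_at_imp_continuous_on by blast
    ultimately have eq: "apply_bcontfun (Bcontfun y) = y" by (intro bcontfun_of_bounded)
    show ?thesis by (rule exI[of _ "Bcontfun y"]) (use y eq in auto)
  qed
  then obtain G :: "(real \<Rightarrow>\<^sub>C (real ^ 'n)) \<Rightarrow> (real \<Rightarrow>\<^sub>C (real ^ 'n))" where G: "\<And>(h :: real \<Rightarrow>\<^sub>C (real ^ 'n)) t. (apply_bcontfun (G h) has_vector_derivative A0 *v G h t + h t) (at t)"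
    "\<And>(h :: real \<Rightarrow>\<^sub>C (real ^ 'n)) t m. (\<And>s. norm (apply_bcontfun h s) \<le> m * exp (\<gamma> * \<bar>s - t\<bar>)) \<Longrightarrow> norm (G h t) \<le> C * m"
    by metis
  \<comment> \<open>\<open>G\<close> was obtained by choice; uniqueness of the bounded solution is
    what makes it additive and homogeneous.\<close>
  have uniq: "y = apply_bcontfun (G h)"
    if y: "\<And>t. (y has_vector_derivative A0 *v y t + h t) (at t)" "bounded (range y)" for h :: "real \<Rightarrow>\<^sub>C (real ^ 'n)" and y
  proof
    fix t
    have "y t - G h t = 0"
    proof (rule zero)
      show "((\<lambda>t. y t - G h t) has_vector_derivative A0 *v (y t - G h t)) (at t)" for t
        using has_vector_derivative_diff[OF y(1) G(1)[of h], of t] by (simp add: matrix_vector_mult_diff_distrib)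
      show "bounded (range (\<lambda>t. y t - G h t))"
        using y(2) bounded_apply_bcontfun by (rule bounded_minus_comp)
    qed
    then show "y t = G h t" by simp
  qed
  have est: "norm (G h t) \<le> C * B" if "\<And>s. norm (h s) \<le> B" for h :: "real \<Rightarrow>\<^sub>C (real ^ 'n)" and t B
  proof (rule G(2))
    fix s
    have "B \<ge> 0" using order_trans[OF norm_ge_zero that] .
    then have "B * 1 \<le> B * exp (\<gamma> * \<bar>s - t\<bar>)" using gC by (intro mult_left_mono) auto
    then show "norm (h s) \<le> B * exp (\<gamma> * \<bar>s - t\<bar>)" using that[of s] by simp
  qed
  have linG: "bounded_linear G"
  proof (rule bounded_linear_intro[where K = C])
    show "G (x + y) = G x + G y" for x y
    proof -
      have "apply_bcontfun (G x + G y) = G (x + y)"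
      proof (rule uniq)
        show "(apply_bcontfun (G x + G y) has_vector_derivative A0 *v (G x + G y) t + (x + y) t) (at t)" for t
          using has_vector_derivative_add[OF G(1)[of x t] G(1)[of y t]]
          by (simp add: matrix_vector_right_distrib add_ac plus_bcontfun.rep_eq[abs_def])
      qed (rule bounded_apply_bcontfun)
      then show ?thesis by (metis apply_bcontfun_inject)
    qed
    show "G (r *\<^sub>R x) = r *\<^sub>R G x" for r x
    proof -
      have "apply_bcontfun (r *\<^sub>R G x) = G (r *\<^sub>R x)"
      proof (rule uniq)
        show "(apply_bcontfun (r *\<^sub>R G x) has_vector_derivative A0 *v (r *\<^sub>R G x) t + (r *\<^sub>R x) t) (at t)" for t
          using has_vector_derivative_scaleR[OF DERIV_const G(1)[of x t], of r]
          by (simp add: matrix_vector_mult_scaleR scaleR_add_right scaleR_bcontfun.rep_eq[abs_def])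
      qed (rule bounded_apply_bcontfun)
      then show ?thesis by (metis apply_bcontfun_inject)
    qed
    show "norm (G x) \<le> norm x * C" for x
      using est[OF norm_bounded, of x] by (intro norm_bound) (simp add: mult.commute)
  qed
  have vanG: "vanishing (apply_bcontfun (G h))" if hv: "vanishing (apply_bcontfun h)" for h :: "real \<Rightarrow>\<^sub>C (real ^ 'n)"
    unfolding vanishing_def Lim_at_infinity
  proof (intro allI impI)
    fix e :: real assume e: "e > 0"
    define d where "d = e / (C + 1)"
    have d: "d > 0" "C * d < e" using e gC by (auto simp: d_def field_simps)
    obtain N where N: "\<And>s t. \<bar>t\<bar> \<ge> N \<Longrightarrow> norm (h s) \<le> d * exp (\<gamma> * \<bar>s - t\<bar>)"
      using vanishing_weight[OF hv bounded_apply_bcontfun gC(1) d(1)] by metis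
    show "\<exists>N. \<forall>t. N \<le> norm t \<longrightarrow> dist (G h t) 0 < e"
    proof (intro exI allI impI)
      fix t :: real assume "N \<le> norm t"
      then have "norm (G h t) \<le> C * d" by (intro G(2) N) simp
      then show "dist (G h t) 0 < e" using d by simp
    qed
  qed
  have cpt: "compact_operator (\<lambda>w. G (perturbation w))"
    unfolding compact_operator_def
  proof (intro conjI allI impI)
    show "bounded_linear (\<lambda>w. G (perturbation w))"
      by (rule bounded_linear_compose[OF linG bounded_linear_perturbation])
    fix X :: "nat \<Rightarrow> real \<Rightarrow>\<^sub>C (real ^ 'n)" assume X: "\<forall>n. norm (X n) \<le> 1"
    obtain M where M: "M \<ge> 0" "\<And>t. b t \<le> M" using b_bound by blast
    define v where "v n = G (perturbation (X n))" for n
    have pb: "norm (perturbation (X n) t) \<le> b t" for n t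
    proof -
      have "norm (X n) * b t \<le> 1 * b t" using X b_nonneg by (intro mult_right_mono) auto
      then show ?thesis using norm_perturbation_apply[of "X n" t] by simp
    qed
    have pM: "norm (perturbation (X n) t) \<le> M" for n t
      using order_trans[OF pb M(2)] .
    have vM: "norm (v n t) \<le> C * M" for n t unfolding v_def by (rule est[OF pM])
    obtain a where a: "a > 0" "\<And>x. norm (A0 *v x) \<le> norm x * a"
      using bounded_linear.pos_bounded[OF matrix_vector_mul_bounded_linear[of A0]] by blast
    define L where "L = C * M * a + M"
    have lip: "norm (v n s - v n t) \<le> L * \<bar>s - t\<bar>" for n s t
    proof -
      have "norm (v n s - v n t) \<le> L * norm (s - t)"
      proof (rule differentiable_bound[of UNIV "v n" "\<lambda>t h. h *\<^sub>R (A0 *v v n t + perturbation (X n) t)"])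
        show "(v n has_derivative (\<lambda>h. h *\<^sub>R (A0 *v v n t + perturbation (X n) t))) (at t within UNIV)" for t
          using G(1)[of "perturbation (X n)" t] unfolding v_def has_vector_derivative_def by simp
        show "onorm (\<lambda>h. h *\<^sub>R (A0 *v v n t + perturbation (X n) t)) \<le> L" for t
        proof (rule onorm_le)
          fix h :: real
          have "norm (v n t) * a \<le> C * M * a" using vM a(1) by (intro mult_right_mono) auto
          then have "norm (A0 *v v n t) \<le> C * M * a" using a(2)[of "v n t"] by linarith
          then have "norm (A0 *v v n t + perturbation (X n) t) \<le> L"
            using pM[of n t] unfolding L_def by (intro order_trans[OF norm_triangle_ineq] add_mono)
          then show "norm (h *\<^sub>R (A0 *v v n t + perturbation (X n) t)) \<le> L * norm h"
            unfolding norm_scaleR real_norm_def mult.commute[of L] by (rule mult_left_mono) simp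
        qed
      qed auto
      then show ?thesis by simp
    qed
    \<comment> \<open>At far \<open>t\<close> the weighted bound on \<open>b\<close> has the small
      constant \<open>d\<close>. It holds for every forcing simultaneously, and \<open>G\<close>
      turns it into \<open>C * d \<le> e\<close>.\<close>
    have tail: "\<exists>N. \<forall>n t. \<bar>t\<bar> \<ge> N \<longrightarrow> norm (v n t) \<le> e" if e: "e > 0" for e
    proof -
      define d where "d = e / (C + 1)"
      have d: "d > 0" "C * d \<le> e" using e gC by (auto simp: d_def field_simps)
      obtain N where N: "\<And>s t. \<bar>t\<bar> \<ge> N \<Longrightarrow> norm (b s) \<le> d * exp (\<gamma> * \<bar>s - t\<bar>)"
        using vanishing_weight[OF b_vanishing b_bounded gC(1) d(1)] by metis
      have "norm (v n t) \<le> e" if "\<bar>t\<bar> \<ge> N" for n t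
      proof -
        have "norm (v n t) \<le> C * d" unfolding v_def
        proof (rule G(2))
          show "norm (perturbation (X n) s) \<le> d * exp (\<gamma> * \<bar>s - t\<bar>)" for s
            using pb[of n s] N[OF that, of s] by simp
        qed
        then show ?thesis using d by simp
      qed
      then show ?thesis by blast
    qed
    from bcontfun_convergent_subsequence[of v, OF vM lip tail]
    show "\<exists>r l. strict_mono r \<and> (\<lambda>n. G (perturbation (X (r n)))) \<longlonglongrightarrow> l"
      unfolding v_def by blast
  qed
  show thesis by (rule that[OF linG G(1) uniq vanG cpt])
qed

text \<open>A bounded solution satisfies \<open>y = G (perturbation y)\<close>. The perturbation
  vanishes at infinity for every bounded argument, and \<open>G\<close> preserves this.\<close>

lemma bounded_solution_vanishing:
  assumes y: "\<And>t. (y has_vector_derivative A t (y t)) (at t)" and bdd: "bounded (range y)"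
  shows "vanishing y"
proof -
  obtain G :: "(real \<Rightarrow>\<^sub>C (real ^ 'n)) \<Rightarrow> (real \<Rightarrow>\<^sub>C (real ^ 'n))" where G:
    "\<And>(h :: real \<Rightarrow>\<^sub>C (real ^ 'n)) y. (\<And>t. (y has_vector_derivative A0 *v y t + apply_bcontfun h t) (at t)) \<Longrightarrow> bounded (range y) \<Longrightarrow> y = apply_bcontfun (G h)"
    "\<And>(h :: real \<Rightarrow>\<^sub>C (real ^ 'n)). vanishing (apply_bcontfun h) \<Longrightarrow> vanishing (apply_bcontfun (G h))"
    using green_operator by metis
  have "continuous_on UNIV y"
    using y has_vector_derivative_continuous continuous_at_imp_continuous_on by blast
  then have "y \<in> bcontfun" using bdd by (simp add: bcontfun_def)
  then obtain w where w: "y = apply_bcontfun w" by (rule bcontfunE)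
  have "y = apply_bcontfun (G (perturbation w))"
    by (rule G(1)[OF _ bdd]) (use y in \<open>simp add: perturbation_apply w\<close>)
  then show ?thesis using G(2)[OF vanishing_perturbation, of w] by simp
qed

end

section \<open>The weighted pairing of bounded functions\<close>

definition cauchy_weight :: "real \<Rightarrow> real" where "cauchy_weight t = inverse (1 + t\<^sup>2)"

lemma cauchy_weight_pos: "cauchy_weight t > 0"
  by (simp add: cauchy_weight_def add_pos_nonneg)

lemma cauchy_weight_le_1: "cauchy_weight t \<le> 1"
  by (simp add: cauchy_weight_def inverse_le_1_iff)

lemma integrable_cauchy_weight: "integrable lborel cauchy_weight"
  using integrable_inverse_1_plus_square by (simp add: cauchy_weight_def[abs_def])

lemma continuous_cauchy_weight: "continuous_on S cauchy_weight"
proof -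
  have "1 + x\<^sup>2 \<noteq> 0" for x :: real by (smt (verit) zero_le_power2)
  then show ?thesis unfolding cauchy_weight_def[abs_def] by (intro continuous_intros) auto
qed

lemma vanishing_cauchy_weight: "vanishing cauchy_weight"
proof -
  have "filterlim (\<lambda>t::real. 1 + t\<^sup>2) at_top at_infinity"
    unfolding at_infinity_eq_at_top_bot
    by (intro filterlim_tendsto_add_at_top[OF tendsto_const] filterlim_sup
        filterlim_pow_at_top[OF _ filterlim_ident] filterlim_pow_at_bot_even[OF _ filterlim_ident]) auto
  then show ?thesis
    unfolding vanishing_def cauchy_weight_def[abs_def] by (rule tendsto_inverse_0_at_top)
qed

lemma cauchy_weight_integral_bound:
  assumes "continuous_on UNIV g" "\<And>t. \<bar>g t\<bar> \<le> B"
  shows "integrable lborel (\<lambda>t. cauchy_weight t * g t)"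
    and "\<bar>LINT t|lborel. cauchy_weight t * g t\<bar> \<le> B * (LINT t|lborel. cauchy_weight t)"
proof -
  have B: "integrable lborel (\<lambda>t. B * cauchy_weight t)" by (simp add: integrable_cauchy_weight)
  have le: "norm (cauchy_weight t * g t) \<le> B * cauchy_weight t" for t
    using assms(2)[of t] cauchy_weight_pos[of t] by (simp add: abs_mult mult.commute mult_left_mono)
  have m: "(\<lambda>t. cauchy_weight t * g t) \<in> borel_measurable lborel"
    by (auto intro!: borel_measurable_continuous_onI continuous_intros assms continuous_cauchy_weight)
  show int: "integrable lborel (\<lambda>t. cauchy_weight t * g t)"
    by (rule Bochner_Integration.integrable_bound[OF B m]) (rule AE_I2, rule order_trans[OF le], simp)
  have "\<bar>LINT t|lborel. cauchy_weight t * g t\<bar> \<le> (LINT t|lborel. norm (cauchy_weight t * g t))"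
    using integral_norm_bound[of lborel "\<lambda>t. cauchy_weight t * g t"] by simp
  also have "\<dots> \<le> (LINT t|lborel. B * cauchy_weight t)"
    by (intro integral_mono integrable_norm int B le)
  finally show "\<bar>LINT t|lborel. cauchy_weight t * g t\<bar> \<le> B * (LINT t|lborel. cauchy_weight t)" by simp
qed

text \<open>The weight makes the pairing finite, and continuous in the sup norm, for functions that
  are merely bounded. Its positivity keeps the pairing definite on continuous functions.\<close>

definition weighted_inner :: "(real \<Rightarrow> real ^ 'n) \<Rightarrow> (real \<Rightarrow> real ^ 'n) \<Rightarrow> real" where
  "weighted_inner u w = (LINT t|lborel. cauchy_weight t * (u t \<bullet> w t))"

lemma weighted_inner_integrable:
  fixes u w :: "real \<Rightarrow> real ^ 'n"
  assumes "continuous_on UNIV u" "bounded (range u)" "continuous_on UNIV w" "bounded (range w)"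
  shows "integrable lborel (\<lambda>t. cauchy_weight t * (u t \<bullet> w t))"
proof -
  obtain A where A: "\<And>t. norm (u t) \<le> A" using assms(2) unfolding bounded_iff by auto
  obtain B where B: "\<And>t. norm (w t) \<le> B" using assms(4) unfolding bounded_iff by auto
  show ?thesis
  proof (rule cauchy_weight_integral_bound(1))
    show "continuous_on UNIV (\<lambda>t. u t \<bullet> w t)" by (intro continuous_intros assms)
    show "\<bar>u t \<bullet> w t\<bar> \<le> A * B" for t
      by (rule order_trans[OF Cauchy_Schwarz_ineq2])
        (intro mult_mono A B norm_ge_zero order_trans[OF norm_ge_zero A])
  qed
qed

lemma weighted_inner_self_pos:
  fixes u :: "real \<Rightarrow> real ^ 'n"
  assumes u: "continuous_on UNIV u" "bounded (range u)" and nz: "u t \<noteq> 0"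
  shows "weighted_inner u u > 0"
proof -
  let ?f = "\<lambda>t. cauchy_weight t * (u t \<bullet> u t)"
  have nn: "?f t \<ge> 0" for t using cauchy_weight_pos[of t] by simp
  have "weighted_inner u u \<noteq> 0"
  proof
    assume 0: "weighted_inner u u = 0"
    have "?f t = 0"
      by (rule integral_nonneg_continuous_eq_0[OF _ weighted_inner_integrable[OF u u] nn])
        (use 0 in \<open>auto simp: weighted_inner_def intro!: continuous_intros continuous_cauchy_weight u\<close>)
    then show False using nz cauchy_weight_pos[of t] by simp
  qed
  moreover have "weighted_inner u u \<ge> 0" unfolding weighted_inner_def using nn by (intro integral_nonneg_AE) auto
  ultimately show ?thesis by simp
qed

lemma bounded_linear_weighted_inner:
  fixes u :: "real \<Rightarrow> real ^ 'n"
  assumes u: "continuous_on UNIV u" "bounded (range u)"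
  shows "bounded_linear (\<lambda>w. weighted_inner u (apply_bcontfun w))"
proof -
  obtain A where A: "\<And>t. norm (u t) \<le> A" using u(2) unfolding bounded_iff by auto
  note int = weighted_inner_integrable[OF u continuous_on_apply_bcontfun bounded_apply_bcontfun]
  show ?thesis
  proof (rule bounded_linear_intro[where K = "A * (LINT t|lborel. cauchy_weight t)"])
    show "weighted_inner u (x + y) = weighted_inner u x + weighted_inner u y" for x y :: "real \<Rightarrow>\<^sub>C (real ^ 'n)"
      unfolding weighted_inner_def using int by (simp add: inner_add_right distrib_left)
    show "weighted_inner u (r *\<^sub>R x) = r *\<^sub>R weighted_inner u x" for r and x :: "real \<Rightarrow>\<^sub>C (real ^ 'n)"
      unfolding weighted_inner_def by (simp add: mult.left_commute)
    show "norm (weighted_inner u x) \<le> norm x * (A * (LINT t|lborel. cauchy_weight t))" for x :: "real \<Rightarrow>\<^sub>C (real ^ 'n)"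
    proof -
      have "\<bar>weighted_inner u x\<bar> \<le> (A * norm x) * (LINT t|lborel. cauchy_weight t)"
        unfolding weighted_inner_def
      proof (rule cauchy_weight_integral_bound(2))
        show "continuous_on UNIV (\<lambda>t. u t \<bullet> x t)" by (intro continuous_intros u) auto
        show "\<bar>u t \<bullet> x t\<bar> \<le> A * norm x" for t
          by (rule order_trans[OF Cauchy_Schwarz_ineq2])
            (intro mult_mono A norm_bounded norm_ge_zero order_trans[OF norm_ge_zero A])
      qed
      then show ?thesis by (simp add: mult_ac)
    qed
  qed
qed

text \<open>\<open>J_adjoint\<close> says that \<open>A t\<close> is infinitesimally symplectic,
  equivalently that \<open>J\<close> maps solutions of the variational equation to solutions of its
  adjoint. Orthogonality decouples the two solvability conditions.\<close>

locale degenerate_variational_equation = asymptotically_hyperbolic A0 A b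
  for A0 :: "real ^ 'n ^ 'n" and A b +
  fixes J :: "real ^ 'n \<Rightarrow> real ^ 'n" and \<eta>\<^sub>1 \<eta>\<^sub>2 :: "real \<Rightarrow>\<^sub>C (real ^ 'n)"
  assumes J_linear: "linear J" and J_inner: "J u \<bullet> J v = u \<bullet> v"
    and J_adjoint: "J (A t u) \<bullet> v + J u \<bullet> A t v = 0"
    and \<eta>\<^sub>1: "(apply_bcontfun \<eta>\<^sub>1 has_vector_derivative A t (\<eta>\<^sub>1 t)) (at t)"
    and \<eta>\<^sub>2: "(apply_bcontfun \<eta>\<^sub>2 has_vector_derivative A t (\<eta>\<^sub>2 t)) (at t)"
    and spanning: "(\<And>t. (y has_vector_derivative A t (y t)) (at t)) \<Longrightarrow> bounded (range y) \<Longrightarrow>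
      \<exists>c\<^sub>1 c\<^sub>2. \<forall>t. y t = c\<^sub>1 *\<^sub>R \<eta>\<^sub>1 t + c\<^sub>2 *\<^sub>R \<eta>\<^sub>2 t"
    and nonzero: "\<exists>t. \<eta>\<^sub>1 t \<noteq> 0" "\<exists>t. \<eta>\<^sub>2 t \<noteq> 0"
    and orthogonal: "weighted_inner \<eta>\<^sub>1 \<eta>\<^sub>2 = 0"
begin

definition weighted_J :: "(real \<Rightarrow>\<^sub>C (real ^ 'n)) \<Rightarrow> (real \<Rightarrow>\<^sub>C (real ^ 'n))" where
  "weighted_J \<eta> = Bcontfun (\<lambda>t. cauchy_weight t *\<^sub>R J (\<eta> t))"

lemma norm_J: "norm (J v) = norm v"
  by (simp add: norm_eq_sqrt_inner J_inner)

lemma bounded_linear_J: "bounded_linear J"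
  using J_linear by (simp add: linear_conv_bounded_linear)

lemma weighted_J_apply: "weighted_J \<eta> t = cauchy_weight t *\<^sub>R J (\<eta> t)"
proof -
  have "apply_bcontfun (weighted_J \<eta>) = (\<lambda>t. cauchy_weight t *\<^sub>R J (\<eta> t))"
    unfolding weighted_J_def
  proof (rule bcontfun_of_bounded)
    show "continuous_on UNIV (\<lambda>t. cauchy_weight t *\<^sub>R J (\<eta> t))"
      by (intro continuous_on_scaleR continuous_cauchy_weight bounded_linear.continuous_on[OF bounded_linear_J]) auto
    show "norm (cauchy_weight t *\<^sub>R J (\<eta> t)) \<le> norm \<eta>" for t
      using mult_mono[OF cauchy_weight_le_1[of t] norm_bounded[of \<eta> t]] cauchy_weight_pos[of t]
      by (simp add: norm_J)
  qed
  then show ?thesis by simp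
qed

lemma vanishing_weighted_J: "vanishing (weighted_J \<eta>)"
proof (rule vanishing_bound[OF vanishing_cauchy_weight])
  show "norm (weighted_J \<eta> t) \<le> norm \<eta> * norm (cauchy_weight t)" for t
    using norm_bounded[of \<eta> t] cauchy_weight_pos[of t]
    by (simp add: weighted_J_apply norm_J mult.commute mult_right_mono)
qed

text \<open>The derivative of \<open>J (\<eta> t) \<bullet> w t\<close> is
  \<open>J (\<eta> t) \<bullet> h t\<close>, since the terms with \<open>A t\<close> cancel, and the
  product tends to 0 at both ends because \<open>w\<close> does. This is the necessary solvability
  condition.\<close>

lemma J_pairing_integral:
  assumes \<eta>: "\<And>t. (apply_bcontfun \<eta> has_vector_derivative A t (\<eta> t)) (at t)"
    and w: "\<And>t. (w has_vector_derivative A t (w t) + h t) (at t)" "vanishing w"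
    and h: "continuous_on UNIV h" and int: "integrable lborel (\<lambda>t. J (\<eta> t) \<bullet> h t)"
  shows "(LINT t|lborel. J (\<eta> t) \<bullet> h t) = 0"
proof (rule integral_derivative_vanishing[of "\<lambda>t. J (\<eta> t) \<bullet> w t"])
  fix t
  have "((\<lambda>t. J (\<eta> t)) has_vector_derivative J (A t (\<eta> t))) (at t)"
    by (rule bounded_linear.has_vector_derivative[OF bounded_linear_J \<eta>])
  from bounded_bilinear.has_vector_derivative[OF bounded_bilinear_inner this w(1)]
  have "((\<lambda>t. J (\<eta> t) \<bullet> w t) has_vector_derivative J (\<eta> t) \<bullet> (A t (w t) + h t) + J (A t (\<eta> t)) \<bullet> w t) (at t)" .
  moreover have "J (\<eta> t) \<bullet> (A t (w t) + h t) + J (A t (\<eta> t)) \<bullet> w t = J (\<eta> t) \<bullet> h t"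
    using J_adjoint[of t "\<eta> t" "w t"] by (simp add: inner_add_right)
  ultimately show "((\<lambda>t. J (\<eta> t) \<bullet> w t) has_vector_derivative J (\<eta> t) \<bullet> h t) (at t)" by simp
next
  show "continuous_on UNIV (\<lambda>t. J (\<eta> t) \<bullet> h t)"
    by (intro continuous_on_inner h bounded_linear.continuous_on[OF bounded_linear_J]) auto
  have "vanishing (\<lambda>t. J (\<eta> t) \<bullet> w t)"
  proof (rule vanishing_bound[OF w(2)])
    show "norm (J (\<eta> t) \<bullet> w t) \<le> norm \<eta> * norm (w t)" for t
      using order_trans[OF Cauchy_Schwarz_ineq2[of "J (\<eta> t)" "w t"]] norm_bounded[of \<eta> t]
      by (simp add: norm_J mult_right_mono)
  qed
  then show "((\<lambda>t. J (\<eta> t) \<bullet> w t) \<longlongrightarrow> 0) at_infinity" by (simp add: vanishing_def)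
qed (rule int)

lemma weighted_J_pairing:
  fixes \<eta> \<zeta> :: "real \<Rightarrow>\<^sub>C (real ^ 'n)"
  shows "integrable lborel (\<lambda>t. J (\<eta> t) \<bullet> weighted_J \<zeta> t)"
  "(LINT t|lborel. J (\<eta> t) \<bullet> weighted_J \<zeta> t) = weighted_inner \<eta> \<zeta>"
proof -
  have "(\<lambda>t. J (\<eta> t) \<bullet> weighted_J \<zeta> t) = (\<lambda>t. cauchy_weight t * (\<eta> t \<bullet> \<zeta> t))"
    by (simp add: weighted_J_apply J_inner)
  then show "integrable lborel (\<lambda>t. J (\<eta> t) \<bullet> weighted_J \<zeta> t)"
    "(LINT t|lborel. J (\<eta> t) \<bullet> weighted_J \<zeta> t) = weighted_inner \<eta> \<zeta>"
    using weighted_inner_integrable[of \<eta> \<zeta>] by (simp_all add: weighted_inner_def)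
qed

lemma weighted_inner_commute: "weighted_inner u v = weighted_inner v u"
  by (simp add: weighted_inner_def inner_commute)

lemma weighted_norm_pos: "weighted_inner \<eta>\<^sub>1 \<eta>\<^sub>1 > 0" "weighted_inner \<eta>\<^sub>2 \<eta>\<^sub>2 > 0"
  using nonzero weighted_inner_self_pos[OF continuous_on_apply_bcontfun bounded_apply_bcontfun] by blast+

text \<open>Each multiplier is a functional of the solution itself, so the bordered equation is
  again linear in one unknown, and applying \<open>G\<close> brings it to the form
  \<open>w - K w = G h\<close>. Pairing with the adjoint solutions recovers the multipliers from
  \<open>h\<close>; the last clause records this for \<open>\<eta>\<^sub>2\<close>, where it later
  becomes the bifurcation equation.\<close>

lemma fredholm_right_inverse:
  obtains W :: "(real \<Rightarrow>\<^sub>C (real ^ 'n)) \<Rightarrow> (real \<Rightarrow>\<^sub>C (real ^ 'n))"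
  where "bounded_linear W"
    "\<And>(h :: real \<Rightarrow>\<^sub>C (real ^ 'n)) t. (apply_bcontfun (W h) has_vector_derivative A t (W h t) +
       (apply_bcontfun h t - weighted_inner \<eta>\<^sub>1 (W h) *\<^sub>R weighted_J \<eta>\<^sub>1 t
         - weighted_inner \<eta>\<^sub>2 (W h) *\<^sub>R weighted_J \<eta>\<^sub>2 t)) (at t)"
    "\<And>h. vanishing (apply_bcontfun h) \<Longrightarrow> vanishing (apply_bcontfun (W h))"
    "\<And>h. vanishing (apply_bcontfun h) \<Longrightarrow>
       integrable lborel (\<lambda>t. J (\<eta>\<^sub>2 t) \<bullet> apply_bcontfun h t) \<Longrightarrow>
       weighted_inner \<eta>\<^sub>2 (W h) * weighted_inner \<eta>\<^sub>2 \<eta>\<^sub>2 = (LINT t|lborel. J (\<eta>\<^sub>2 t) \<bullet> apply_bcontfun h t)"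
proof -
  obtain G :: "(real \<Rightarrow>\<^sub>C (real ^ 'n)) \<Rightarrow> (real \<Rightarrow>\<^sub>C (real ^ 'n))"
    where G: "bounded_linear G"
    "\<And>(h :: real \<Rightarrow>\<^sub>C (real ^ 'n)) t. (apply_bcontfun (G h) has_vector_derivative A0 *v G h t + h t) (at t)"
    "\<And>h. vanishing (apply_bcontfun h) \<Longrightarrow> vanishing (apply_bcontfun (G h))"
    "compact_operator (\<lambda>w. G (perturbation w))"
    using green_operator by metis
  interpret G: bounded_linear G by (rule G(1))
  define l1 where "l1 w = weighted_inner \<eta>\<^sub>1 (apply_bcontfun w)" for w
  define l2 where "l2 w = weighted_inner \<eta>\<^sub>2 (apply_bcontfun w)" for w
  define e1 where "e1 = weighted_J \<eta>\<^sub>1"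
  define e2 where "e2 = weighted_J \<eta>\<^sub>2"
  have l: "bounded_linear l1" "bounded_linear l2"
    unfolding l1_def l2_def by (intro bounded_linear_weighted_inner; auto)+
  \<comment> \<open>The bordering contributes two operators of rank one, which leaves
    \<open>K\<close> compact.\<close>
  define K where "K w = G (perturbation w) + (l1 w *\<^sub>R (- G e1) + l2 w *\<^sub>R (- G e2))" for w
  have K_alt: "K w = G (perturbation w - l1 w *\<^sub>R e1 - l2 w *\<^sub>R e2)" for w
    by (simp add: K_def G.diff G.scaleR)
  have cK: "compact_operator K"
    unfolding K_def by (intro compact_operator_add G(4) compact_operator_rank_one l)
  have van: "vanishing (apply_bcontfun (perturbation w - c *\<^sub>R e1 - d *\<^sub>R e2))" for w c d
    unfolding minus_bcontfun.rep_eq scaleR_bcontfun.rep_eq e1_def e2_def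
    by (intro vanishing_diff vanishing_scaleR vanishing_perturbation vanishing_weighted_J)
  have eqn: "(apply_bcontfun w has_vector_derivative A t (w t) + (h t - c *\<^sub>R e1 t - d *\<^sub>R e2 t)) (at t)"
    if "w = G (h + perturbation w - c *\<^sub>R e1 - d *\<^sub>R e2)" for w h c d t
    using G(2)[of "h + perturbation w - c *\<^sub>R e1 - d *\<^sub>R e2" t] that[symmetric]
    by (simp add: perturbation_apply algebra_simps)
  have pair: "(LINT t|lborel. J (\<zeta> t) \<bullet> h t) = c * weighted_inner \<zeta> \<eta>\<^sub>1 + d * weighted_inner \<zeta> \<eta>\<^sub>2"
    if \<zeta>: "\<And>t. (apply_bcontfun \<zeta> has_vector_derivative A t (\<zeta> t)) (at t)"
      and w: "\<And>t. (apply_bcontfun w has_vector_derivative A t (w t) + (h t - c *\<^sub>R e1 t - d *\<^sub>R e2 t)) (at t)"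
      "vanishing (apply_bcontfun w)" and int: "integrable lborel (\<lambda>t. J (\<zeta> t) \<bullet> h t)"
    for \<zeta> w h :: "real \<Rightarrow>\<^sub>C (real ^ 'n)" and c d
  proof -
    have split: "J (\<zeta> t) \<bullet> (h t - c *\<^sub>R e1 t - d *\<^sub>R e2 t) =
        J (\<zeta> t) \<bullet> h t - c * (J (\<zeta> t) \<bullet> e1 t) - d * (J (\<zeta> t) \<bullet> e2 t)" for t
      by (simp add: inner_diff_right)
    note ie = weighted_J_pairing(1)[of \<zeta> \<eta>\<^sub>1, folded e1_def] weighted_J_pairing(1)[of \<zeta> \<eta>\<^sub>2, folded e2_def]
    have "(LINT t|lborel. J (\<zeta> t) \<bullet> (h t - c *\<^sub>R e1 t - d *\<^sub>R e2 t)) = 0"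
    proof (rule J_pairing_integral[OF \<zeta> w])
      show "continuous_on UNIV (\<lambda>t. h t - c *\<^sub>R e1 t - d *\<^sub>R e2 t)" by (intro continuous_intros) auto
      show "integrable lborel (\<lambda>t. J (\<zeta> t) \<bullet> (h t - c *\<^sub>R e1 t - d *\<^sub>R e2 t))"
        unfolding split using int ie by simp
    qed
    then show ?thesis
      unfolding split using int ie weighted_J_pairing(2)[of \<zeta> \<eta>\<^sub>1] weighted_J_pairing(2)[of \<zeta> \<eta>\<^sub>2]
      by (simp add: e1_def e2_def)
  qed
  have orth': "weighted_inner \<eta>\<^sub>2 \<eta>\<^sub>1 = 0" using orthogonal weighted_inner_commute by metis
  \<comment> \<open>With \<open>h = 0\<close> the pairings force both multipliers to vanish. Then
    \<open>w\<close> is a bounded solution of the variational equation, hence a combination of the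
    two kernel elements, and vanishing multipliers also mean that it is orthogonal to both.\<close>
  have inj: "w = 0" if "w - K w = 0" for w
  proof -
    have w: "w = G (0 + perturbation w - l1 w *\<^sub>R e1 - l2 w *\<^sub>R e2)" using that by (simp add: K_alt)
    note dw = eqn[OF w]
    have vw: "vanishing (apply_bcontfun w)" by (subst w, rule G(3)) (simp only: add_0 van)
    have "l1 w = 0"
      using pair[OF \<eta>\<^sub>1 dw vw] weighted_norm_pos orthogonal by simp
    moreover have "l2 w = 0"
      using pair[OF \<eta>\<^sub>2 dw vw] weighted_norm_pos orth' by simp
    ultimately have "\<And>t. (apply_bcontfun w has_vector_derivative A t (w t)) (at t)"
      using dw by simp
    from spanning[OF this bounded_apply_bcontfun] obtain a1 a2
      where a: "\<And>t. w t = a1 *\<^sub>R \<eta>\<^sub>1 t + a2 *\<^sub>R \<eta>\<^sub>2 t" by blast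
    have wa: "w = a1 *\<^sub>R \<eta>\<^sub>1 + a2 *\<^sub>R \<eta>\<^sub>2" by (rule bcontfun_eqI) (simp add: a)
    interpret l1: bounded_linear l1 by (rule l)
    interpret l2: bounded_linear l2 by (rule l)
    have "a1 = 0"
      using \<open>l1 w = 0\<close> weighted_norm_pos orthogonal unfolding wa l1.add l1.scaleR by (simp add: l1_def)
    moreover have "a2 = 0"
      using \<open>l2 w = 0\<close> weighted_norm_pos orth' unfolding wa l2.add l2.scaleR by (simp add: l2_def)
    ultimately show "w = 0" by (simp add: wa)
  qed
  obtain V where V: "bounded_linear V" "\<And>h. V h - K (V h) = h"
    using compact_operator_inverse[OF cK inj] by blast
  define W where "W h = V (G h)" for h
  have W: "W h = G (h + perturbation (W h) - l1 (W h) *\<^sub>R e1 - l2 (W h) *\<^sub>R e2)" for h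
  proof -
    have "W h = G h + K (W h)" using V(2)[of "G h"] by (simp add: W_def algebra_simps)
    then show ?thesis by (simp add: K_alt G.diff G.add algebra_simps)
  qed
  have vW: "vanishing (apply_bcontfun (W h))" if h: "vanishing (apply_bcontfun h)" for h
  proof -
    have "vanishing (apply_bcontfun (h + (perturbation (W h) - l1 (W h) *\<^sub>R e1 - l2 (W h) *\<^sub>R e2)))"
      unfolding plus_bcontfun.rep_eq using h van by (rule vanishing_add)
    then show ?thesis by (subst W, intro G(3)) (simp only: add_diff_eq)
  qed
  show thesis
  proof (rule that[of W])
    show "bounded_linear W" unfolding W_def by (rule bounded_linear_compose[OF V(1) G(1)])
    show "(apply_bcontfun (W h) has_vector_derivative A t (W h t) +
       (apply_bcontfun h t - weighted_inner \<eta>\<^sub>1 (W h) *\<^sub>R weighted_J \<eta>\<^sub>1 t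
         - weighted_inner \<eta>\<^sub>2 (W h) *\<^sub>R weighted_J \<eta>\<^sub>2 t)) (at t)" for h t
      using eqn[OF W[of h]] by (simp add: l1_def l2_def e1_def e2_def)
    show "vanishing (apply_bcontfun (W h))" if "vanishing (apply_bcontfun h)" for h
      by (rule vW[OF that])
    show "weighted_inner \<eta>\<^sub>2 (W h) * weighted_inner \<eta>\<^sub>2 \<eta>\<^sub>2 = (LINT t|lborel. J (\<eta>\<^sub>2 t) \<bullet> apply_bcontfun h t)"
      if "vanishing (apply_bcontfun h)" "integrable lborel (\<lambda>t. J (\<eta>\<^sub>2 t) \<bullet> apply_bcontfun h t)" for h
      using pair[OF \<eta>\<^sub>2 eqn[OF W[of h]] vW[OF that(1)] that(2)] orth' by (simp add: l2_def)
  qed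
qed

end

section \<open>Lyapunov-Schmidt reduction\<close>

text \<open>\<open>D\<close> is the part of \<open>S\<close> linear in \<open>v\<close> that
  survives as \<open>\<alpha>\<close> tends to 0; the rest has Lipschitz constant of order
  \<open>\<alpha>\<close>. Since \<open>l (W g) = 0\<close>, the condition
  \<open>l (W (g + \<alpha> S)) = 0\<close> may be divided by \<open>\<alpha>\<close>, and its
  leading dependence on the coefficient of \<open>e\<close> has the nonzero slope
  \<open>l (W (D e))\<close>.\<close>

lemma lyapunov_schmidt_fixed_point:
  fixes W D :: "'a::banach \<Rightarrow> 'a" and l :: "'a \<Rightarrow> real" and S :: "real \<Rightarrow> 'a \<Rightarrow> 'a" and U :: "'a set"
  assumes W: "bounded_linear W" and D: "bounded_linear D" and l: "bounded_linear l"
    and U: "closed U" "subspace U" and g: "g \<in> U" and e: "e \<in> U"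
    and WU: "\<And>v. v \<in> U \<Longrightarrow> W v \<in> U"
    and \<alpha>0: "\<alpha>0 > 0" and SU: "\<And>\<alpha> v. \<alpha> \<noteq> 0 \<Longrightarrow> \<bar>\<alpha>\<bar> < \<alpha>0 \<Longrightarrow> v \<in> U \<Longrightarrow> S \<alpha> v \<in> U"
    and lg: "l (W g) = 0" and \<beta>: "l (W (D e)) \<noteq> 0"
    and S0: "\<And>\<alpha>. \<alpha> \<noteq> 0 \<Longrightarrow> \<bar>\<alpha>\<bar> < \<alpha>0 \<Longrightarrow> norm (S \<alpha> 0) \<le> C"
    and SL: "\<And>r. \<exists>L\<ge>0. \<forall>\<alpha> v v'. \<alpha> \<noteq> 0 \<longrightarrow> \<bar>\<alpha>\<bar> < \<alpha>0 \<longrightarrow> norm v \<le> r \<longrightarrow> norm v' \<le> r \<longrightarrow>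
       norm ((S \<alpha> v - D v) - (S \<alpha> v' - D v')) \<le> L * \<bar>\<alpha>\<bar> * norm (v - v')"
  shows "\<exists>r \<alpha>1. \<alpha>1 > 0 \<and> (\<forall>\<alpha>. \<alpha> \<noteq> 0 \<longrightarrow> \<bar>\<alpha>\<bar> < \<alpha>1 \<longrightarrow> (\<exists>v\<in>U. norm v \<le> r \<and>
      l (W (g + \<alpha> *\<^sub>R S \<alpha> v)) = 0 \<and> (\<exists>c. v = W (g + \<alpha> *\<^sub>R S \<alpha> v) + c *\<^sub>R e)))"
proof -
  interpret W: bounded_linear W by (rule W)
  interpret D: bounded_linear D by (rule D)
  interpret l: bounded_linear l by (rule l)
  define d where "d = (\<lambda>v. l (W v))"
  have d: "bounded_linear d" unfolding d_def by (rule bounded_linear_compose[OF l W])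
  interpret d: bounded_linear d by (rule d)
  define \<beta> where "\<beta> = d (D e)"
  have \<beta>0: "\<beta> \<noteq> 0" using \<beta> by (simp add: \<beta>_def d_def)
  obtain MW MD Md where MM: "MW > 0" "\<And>x. norm (W x) \<le> norm x * MW" "MD > 0" "\<And>x. norm (D x) \<le> norm x * MD"
      "Md > 0" "\<And>x. norm (d x) \<le> norm x * Md"
    using W.pos_bounded D.pos_bounded d.pos_bounded by metis
  define M where "M = MW + MD + Md + norm e"
  have M: "M > 0" using MM by (simp add: M_def add_pos_nonneg)
  have bM: "norm x * K \<le> M * norm x" if "K \<le> M" for x :: 'a and K
    using that by (simp add: mult.commute mult_right_mono)
  have WM: "norm (W x) \<le> M * norm x" and DM: "norm (D x) \<le> M * norm x" and dM: "\<bar>d x\<bar> \<le> M * norm x" for x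
    using order_trans[OF MM(2) bM] order_trans[OF MM(4) bM] order_trans[OF MM(6) bM] MM by (auto simp: M_def)
  have dD: "\<bar>d (D x)\<bar> \<le> M * (M * K)" if "norm x \<le> K" for x K
  proof -
    have "norm (D x) \<le> M * K" using DM[of x] mult_left_mono[OF that, of M] M by linarith
    then show ?thesis using dM[of "D x"] mult_left_mono[of "norm (D x)" "M * K" M] M by linarith
  qed
  have eM: "norm e \<le> M" using MM by (simp add: M_def)
  have C0: "C \<ge> 0" using order_trans[OF norm_ge_zero S0[of "\<alpha>0 / 2"]] \<alpha>0 by simp
  define B where "B = M * (norm g + 1)"
  have B0: "B \<ge> 0" using M by (simp add: B_def)
  \<comment> \<open>\<open>B\<close> bounds \<open>w v\<close> and the second summand bounds
    \<open>c v *\<^sub>R e\<close>. Neither involves \<open>\<alpha>\<close> or the Lipschitz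
    constant \<open>L\<close>, so the ball can be fixed first and \<open>L\<close> chosen for it
    afterwards.\<close>
  define r where "r = B + (M * (C + 1 + M * B) / \<bar>\<beta>\<bar>) * M"
  have r0: "r \<ge> 0" using M B0 C0 by (simp add: r_def)
  obtain L where L: "L \<ge> 0" "\<And>\<alpha> v v'. \<alpha> \<noteq> 0 \<Longrightarrow> \<bar>\<alpha>\<bar> < \<alpha>0 \<Longrightarrow> norm v \<le> r \<Longrightarrow> norm v' \<le> r \<Longrightarrow>
       norm ((S \<alpha> v - D v) - (S \<alpha> v' - D v')) \<le> L * \<bar>\<alpha>\<bar> * norm (v - v')"
    using SL[of r] by metis
  \<comment> \<open>The map \<open>T\<close> below has Lipschitz constant
    \<open>\<bar>\<alpha>\<bar> * k\<close>: the first summand comes from \<open>w\<close>, the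
    second from \<open>c\<close> times the norm of \<open>e\<close>.\<close>
  define k where "k = M * (1 + M) + (M * (L + M * (M * (1 + M))) / \<bar>\<beta>\<bar>) * M"
  have k0: "k \<ge> 0" using M L(1) by (simp add: k_def)
  \<comment> \<open>One majorant for the four quantities that must be at most 1 after multiplication
    by \<open>\<bar>\<alpha>\<bar>\<close>. The entry \<open>2 * k\<close> yields contraction
    constant 1/2.\<close>
  define Q where "Q = 1 + L + L * r + (C + 1 + M * r) + 2 * k"
  have Q: "Q > 0" using L(1) r0 C0 M k0 by (simp add: Q_def add_pos_nonneg)
  define \<alpha>1 where "\<alpha>1 = min \<alpha>0 (1 / Q)"
  have "\<exists>v\<in>U. norm v \<le> r \<and> l (W (g + \<alpha> *\<^sub>R S \<alpha> v)) = 0 \<and> (\<exists>c. v = W (g + \<alpha> *\<^sub>R S \<alpha> v) + c *\<^sub>R e)"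
    if \<alpha>: "\<alpha> \<noteq> 0" "\<bar>\<alpha>\<bar> < \<alpha>1" for \<alpha>
  proof -
    have \<alpha>a: "\<bar>\<alpha>\<bar> < \<alpha>0" and "\<bar>\<alpha>\<bar> < 1 / Q" using \<alpha> by (auto simp: \<alpha>1_def)
    then have \<alpha>Q: "\<bar>\<alpha>\<bar> * Q < 1" using Q by (simp add: pos_less_divide_eq)
    have small: "\<bar>\<alpha>\<bar> * q \<le> 1" if "q \<le> Q" for q
      using mult_left_mono[OF that, of "\<bar>\<alpha>\<bar>"] \<alpha>Q by simp
    have s1: "\<bar>\<alpha>\<bar> * L \<le> 1" and s2: "\<bar>\<alpha>\<bar> * (L * r) \<le> 1" and s3: "\<bar>\<alpha>\<bar> * (C + 1 + M * r) \<le> 1"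
      and s4: "\<bar>\<alpha>\<bar> * (2 * k) \<le> 1"
      using L(1) r0 C0 M k0 by (auto intro!: small simp: Q_def add_nonneg_nonneg)
    define R where "R v = S \<alpha> v - D v" for v
    \<comment> \<open>\<open>c\<close> is read off from the condition \<open>l (W (g + \<alpha> S)) = 0\<close> divided by \<open>\<alpha>\<close>, with the already
      updated \<open>w v\<close> in place of \<open>v\<close>: only then is \<open>T\<close> contracting.\<close>
    define w where "w v = W (g + \<alpha> *\<^sub>R S \<alpha> v)" for v
    define c where "c v = - (d (R v) + d (D (w v))) / \<beta>" for v
    define T where "T v = w v + c v *\<^sub>R e" for v
    have RL: "norm (R v - R v') \<le> L * \<bar>\<alpha>\<bar> * norm (v - v')" if "norm v \<le> r" "norm v' \<le> r" for v v'
      unfolding R_def using L(2)[OF \<alpha>(1) \<alpha>a that] .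
    have SR: "S \<alpha> v = R v + D v" for v by (simp add: R_def)
    have Rb: "norm (R v) \<le> C + 1" if v: "norm v \<le> r" for v
    proof -
      have "norm (R v) \<le> norm (R 0) + norm (R v - R 0)"
        using norm_triangle_ineq[of "R 0" "R v - R 0"] by simp
      also have "norm (R 0) \<le> C" using S0[OF \<alpha>(1) \<alpha>a] by (simp add: R_def D.zero)
      also have "norm (R v - R 0) \<le> L * \<bar>\<alpha>\<bar> * norm v" using RL[of v 0] v r0 by simp
      also have "\<dots> \<le> L * \<bar>\<alpha>\<bar> * r" using v L(1) by (intro mult_left_mono) auto
      also have "\<dots> \<le> 1" using s2 by (simp add: mult_ac)
      finally show ?thesis by simp
    qed
    have wb: "norm (w v) \<le> B" if v: "norm v \<le> r" for v
    proof -
      have "norm (S \<alpha> v) \<le> C + 1 + M * r"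
        unfolding SR using Rb[OF v] DM[of v] v M
        by (intro order_trans[OF norm_triangle_ineq] add_mono) (auto intro: order_trans mult_left_mono)
      then have "\<bar>\<alpha>\<bar> * norm (S \<alpha> v) \<le> \<bar>\<alpha>\<bar> * (C + 1 + M * r)" by (intro mult_left_mono) auto
      then have "norm (g + \<alpha> *\<^sub>R S \<alpha> v) \<le> norm g + 1"
        using s3 norm_triangle_ineq[of g "\<alpha> *\<^sub>R S \<alpha> v"] by simp
      then have "M * norm (g + \<alpha> *\<^sub>R S \<alpha> v) \<le> B" unfolding B_def using M by (intro mult_left_mono) auto
      then show ?thesis using WM[of "g + \<alpha> *\<^sub>R S \<alpha> v"] by (simp add: w_def)
    qed
    have cb: "\<bar>c v\<bar> \<le> M * (C + 1 + M * B) / \<bar>\<beta>\<bar>" if v: "norm v \<le> r" for v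
    proof -
      have "\<bar>d (R v)\<bar> \<le> M * (C + 1)"
        using dM[of "R v"] mult_left_mono[OF Rb[OF v], of M] M by linarith
      moreover have "\<bar>d (D (w v))\<bar> \<le> M * (M * B)"
        by (rule dD[OF wb[OF v]])
      ultimately have "\<bar>d (R v) + d (D (w v))\<bar> \<le> M * (C + 1 + M * B)" by (simp add: distrib_left)
      then show ?thesis by (simp add: c_def divide_right_mono)
    qed
    have wL: "norm (w v - w v') \<le> \<bar>\<alpha>\<bar> * (M * (1 + M)) * norm (v - v')" if v: "norm v \<le> r" "norm v' \<le> r" for v v'
    proof -
      have "w v - w v' = \<alpha> *\<^sub>R W (S \<alpha> v - S \<alpha> v')"
        by (simp add: w_def W.add W.diff W.scaleR scaleR_diff_right)
      then have "norm (w v - w v') \<le> \<bar>\<alpha>\<bar> * (M * norm (S \<alpha> v - S \<alpha> v'))"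
        using WM by (simp add: mult_left_mono)
      moreover have "norm (S \<alpha> v - S \<alpha> v') \<le> (1 + M) * norm (v - v')"
      proof -
        have "S \<alpha> v - S \<alpha> v' = (R v - R v') + D (v - v')" by (simp add: R_def D.diff)
        moreover have "L * \<bar>\<alpha>\<bar> * norm (v - v') \<le> 1 * norm (v - v')"
          using s1 by (intro mult_right_mono) (auto simp: mult.commute)
        ultimately show ?thesis
          using norm_triangle_ineq[of "R v - R v'" "D (v - v')"] RL[OF v] DM[of "v - v'"] by (simp add: distrib_right)
      qed
      then have "\<bar>\<alpha>\<bar> * (M * norm (S \<alpha> v - S \<alpha> v')) \<le> \<bar>\<alpha>\<bar> * (M * ((1 + M) * norm (v - v')))"
        using M by (intro mult_left_mono) auto
      ultimately show ?thesis by (simp add: mult.assoc)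
    qed
    have cL: "\<bar>c v - c v'\<bar> \<le> \<bar>\<alpha>\<bar> * (M * (L + M * (M * (1 + M))) / \<bar>\<beta>\<bar>) * norm (v - v')"
      if v: "norm v \<le> r" "norm v' \<le> r" for v v'
    proof -
      have "c v - c v' = - (d (R v - R v') + d (D (w v - w v'))) / \<beta>"
        by (simp add: c_def d.diff D.diff divide_simps)
      then have "\<bar>c v - c v'\<bar> = \<bar>d (R v - R v') + d (D (w v - w v'))\<bar> / \<bar>\<beta>\<bar>"
        by (simp only: abs_divide abs_minus_cancel)
      also have "\<dots> \<le> (M * (L * \<bar>\<alpha>\<bar> * norm (v - v')) + M * (M * (\<bar>\<alpha>\<bar> * (M * (1 + M)) * norm (v - v')))) / \<bar>\<beta>\<bar>"
      proof (rule divide_right_mono)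
        have "\<bar>d (R v - R v')\<bar> \<le> M * (L * \<bar>\<alpha>\<bar> * norm (v - v'))"
          using dM[of "R v - R v'"] mult_left_mono[OF RL[OF v], of M] M by linarith
        moreover have "\<bar>d (D (w v - w v'))\<bar> \<le> M * (M * (\<bar>\<alpha>\<bar> * (M * (1 + M)) * norm (v - v')))"
          by (rule dD[OF wL[OF v]])
        ultimately show "\<bar>d (R v - R v') + d (D (w v - w v'))\<bar> \<le>
          M * (L * \<bar>\<alpha>\<bar> * norm (v - v')) + M * (M * (\<bar>\<alpha>\<bar> * (M * (1 + M)) * norm (v - v')))" by linarith
      qed simp
      finally show ?thesis by (simp add: algebra_simps)
    qed
    have Tr: "norm (T v) \<le> r" if v: "norm v \<le> r" for v
    proof -
      have "norm (c v *\<^sub>R e) \<le> (M * (C + 1 + M * B) / \<bar>\<beta>\<bar>) * M"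
        unfolding norm_scaleR using cb[OF v] eM by (intro mult_mono order_trans[OF abs_ge_zero cb[OF v]]) auto
      then show ?thesis using wb[OF v] norm_triangle_ineq[of "w v" "c v *\<^sub>R e"] by (simp add: T_def r_def)
    qed
    have TL: "dist (T v) (T v') \<le> (1 / 2) * dist v v'" if v: "norm v \<le> r" "norm v' \<le> r" for v v'
    proof -
      let ?n = "norm (v - v')"
      have "norm ((c v - c v') *\<^sub>R e) \<le> (\<bar>\<alpha>\<bar> * (M * (L + M * (M * (1 + M))) / \<bar>\<beta>\<bar>) * ?n) * M"
        unfolding norm_scaleR using cL[OF v] eM by (intro mult_mono order_trans[OF abs_ge_zero cL[OF v]]) auto
      note ce = this
      have "T v - T v' = (w v - w v') + (c v - c v') *\<^sub>R e" by (simp add: T_def algebra_simps)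
      then have "norm (T v - T v') \<le> \<bar>\<alpha>\<bar> * (M * (1 + M)) * ?n + (\<bar>\<alpha>\<bar> * (M * (L + M * (M * (1 + M))) / \<bar>\<beta>\<bar>) * ?n) * M"
        by (simp only:) (rule order_trans[OF norm_triangle_ineq add_mono[OF wL[OF v] ce]])
      also have "\<dots> = \<bar>\<alpha>\<bar> * k * ?n" by (simp add: k_def algebra_simps)
      also have "\<dots> \<le> (1 / 2) * ?n" using s4 by (intro mult_right_mono) auto
      finally show ?thesis by (simp add: dist_norm)
    qed
    have TU: "T v \<in> U" if "v \<in> U" for v
    proof -
      have "g + \<alpha> *\<^sub>R S \<alpha> v \<in> U" using U(2) g SU[OF \<alpha>(1) \<alpha>a that] by (intro subspace_add subspace_scale)
      then show ?thesis unfolding T_def w_def using U(2) WU e by (intro subspace_add subspace_scale)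
    qed
    have "\<exists>!v\<in>U \<inter> cball 0 r. T v = v"
    proof (rule Banach_fix[where c = "1/2"])
      show "complete (U \<inter> cball 0 r)" using U(1) by (auto simp: complete_eq_closed)
      show "U \<inter> cball 0 r \<noteq> {}" using subspace_0[OF U(2)] r0 by auto
    qed (use TU Tr TL in auto)
    then obtain v where v: "v \<in> U" "norm v \<le> r" "T v = v" by auto
    \<comment> \<open>Only at the fixed point may \<open>v\<close> be replaced by
      \<open>w v + c v *\<^sub>R e\<close> inside \<open>D\<close>; there the definition of
      \<open>c\<close> cancels the whole expression.\<close>
    have "l (W (g + \<alpha> *\<^sub>R S \<alpha> v)) = d g + \<alpha> * d (S \<alpha> v)"
      by (simp add: d_def W.add W.scaleR l.add l.scaleR)
    also have "d g = 0" using lg by (simp add: d_def)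
    also have "d (S \<alpha> v) = d (R v) + d (D (w v + c v *\<^sub>R e))" using v(3) by (simp add: SR d.add T_def)
    also have "\<dots> = d (R v) + d (D (w v)) + c v * \<beta>"
      by (simp add: D.add D.scaleR d.add d.scaleR \<beta>_def)
    also have "\<dots> = 0" using \<beta>0 by (simp add: c_def)
    finally have "l (W (g + \<alpha> *\<^sub>R S \<alpha> v)) = 0" by simp
    moreover have "v = W (g + \<alpha> *\<^sub>R S \<alpha> v) + c v *\<^sub>R e" using v(3) by (simp add: T_def w_def)
    ultimately show ?thesis using v by blast
  qed
  moreover have "\<alpha>1 > 0" using \<alpha>0 Q by (simp add: \<alpha>1_def)
  ultimately show ?thesis by blast
qed

section \<open>Taylor estimates for the rescaled nonlinearity\<close>

lemma linear_second_derivative: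
  fixes F :: "'a::euclidean_space \<Rightarrow> real ^ 'n"
  assumes F: "analytic_map F"
  shows "linear (\<lambda>v. frechet_derivative (\<lambda>y. frechet_derivative F (at y) v) (at z) u)"
proof -
  have "linear (\<lambda>v. \<Sum>b\<in>Basis. (v \<bullet> b) *\<^sub>R frechet_derivative (\<lambda>y. frechet_derivative F (at y) b) (at z) u)"
    by (rule linearI) (simp_all add: inner_add_left scaleR_add_left sum.distrib scaleR_right.sum)
  moreover have "(\<lambda>v. frechet_derivative (\<lambda>y. frechet_derivative F (at y) v) (at z) u) =
      (\<lambda>v. \<Sum>b\<in>Basis. (v \<bullet> b) *\<^sub>R frechet_derivative (\<lambda>y. frechet_derivative F (at y) b) (at z) u)"
    by (rule ext) (rule second_derivative_eq_sum[OF F])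
  ultimately show ?thesis by (simp only:)
qed

text \<open>With \<open>\<mu> = \<nu> \<alpha>\<^sup>2\<close> and increment \<open>\<alpha> p + \<alpha>\<^sup>2 v\<close>, the nonlinear part of \<open>F\<close> is
  \<open>\<alpha>\<^sup>2 (g + \<alpha> S)\<close>, where \<open>g = \<nu> D\<^sub>\<mu> F + D\<^sup>2 F (p, p) / 2\<close> does not depend on \<open>v\<close>; this is \<open>S\<close>.\<close>

definition rescaled_remainder ::
    "('a::euclidean_space \<times> real \<Rightarrow> real ^ 'n) \<Rightarrow> real \<Rightarrow> real \<Rightarrow> 'a \<Rightarrow> 'a \<Rightarrow> 'a \<Rightarrow> real ^ 'n" where
  "rescaled_remainder F \<nu> \<alpha> x p v =
     (1 / \<alpha> ^ 3) *\<^sub>R (F (x + \<alpha> *\<^sub>R p + \<alpha>\<^sup>2 *\<^sub>R v, \<alpha>\<^sup>2 * \<nu>) - F (x, 0)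
        - frechet_derivative F (at (x, 0)) (\<alpha> *\<^sub>R p + \<alpha>\<^sup>2 *\<^sub>R v, 0))
     - (1 / \<alpha>) *\<^sub>R (\<nu> *\<^sub>R frechet_derivative F (at (x, 0)) (0, 1)
        + (1 / 2) *\<^sub>R frechet_derivative (\<lambda>y. frechet_derivative F (at y) (p, 0)) (at (x, 0)) (p, 0))"

text \<open>\<open>v\<close> and the parameter enter the increment at order
  \<open>\<alpha>\<^sup>2\<close>, so to first order the derivative is displaced along
  \<open>p\<close> alone. The first bound serves directions in phase space, the second the parameter
  direction.\<close>

lemma derivative_increment_estimate:
  fixes F :: "'a::euclidean_space \<times> real \<Rightarrow> real ^ 'n"
  assumes F: "analytic_map F"
  obtains C where "C \<ge> 0"
    "\<And>x p v u \<alpha>. norm x \<le> r \<Longrightarrow> norm p \<le> r \<Longrightarrow> norm v \<le> r \<Longrightarrow> \<bar>\<alpha>\<bar> \<le> 1 \<Longrightarrow>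
      norm (frechet_derivative F (at (x + \<alpha> *\<^sub>R p + \<alpha>\<^sup>2 *\<^sub>R v, \<alpha>\<^sup>2 * \<nu>)) (u, 0)
        - frechet_derivative F (at (x, 0)) (u, 0)
        - \<alpha> *\<^sub>R frechet_derivative (\<lambda>y. frechet_derivative F (at y) (u, 0)) (at (x, 0)) (p, 0))
      \<le> C * \<alpha>\<^sup>2 * norm u"
    "\<And>x p \<alpha> u. norm x \<le> r \<Longrightarrow> norm p \<le> r \<Longrightarrow> \<bar>\<alpha>\<bar> \<le> 1 \<Longrightarrow>
      norm (frechet_derivative F (at (x + \<alpha> *\<^sub>R p, \<alpha>\<^sup>2 * \<nu>)) u - frechet_derivative F (at (x, 0)) u)
      \<le> C * \<bar>\<alpha>\<bar> * norm u"
proof -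
  \<comment> \<open>For \<open>\<bar>\<alpha>\<bar> \<le> 1\<close> each of \<open>x\<close>,
    \<open>\<alpha> p\<close> and \<open>\<alpha>\<^sup>2 v\<close> has norm at most
    \<open>r\<close>, and the parameter is at most \<open>\<bar>\<nu>\<bar>\<close>.\<close>
  define R where "R = 3 * \<bar>r\<bar> + \<bar>\<nu>\<bar>"
  obtain K where K: "K \<ge> 0" 
    "\<And>y u v. norm y \<le> R \<Longrightarrow>
       norm (frechet_derivative (\<lambda>y. frechet_derivative F (at y) v) (at y) u) \<le> K * norm v * norm u"
    "\<And>y z v. norm y \<le> R \<Longrightarrow> norm z \<le> R \<Longrightarrow>
       norm (frechet_derivative F (at y) v - frechet_derivative F (at z) v) \<le> K * norm v * norm (y - z)"
    "\<And>y z v. norm y \<le> R \<Longrightarrow> norm z \<le> R \<Longrightarrow>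
       norm (frechet_derivative F (at y) v - frechet_derivative F (at z) v
         - frechet_derivative (\<lambda>y. frechet_derivative F (at y) v) (at z) (y - z)) \<le> K * norm v * (norm (y - z))\<^sup>2"
    using analytic_map_derivative_lipschitz[OF F, of R] by metis
  have R0: "R \<ge> 0" by (simp add: R_def)
  have sq: "\<alpha>\<^sup>2 \<le> \<bar>\<alpha>\<bar>" if "\<bar>\<alpha>\<bar> \<le> 1" for \<alpha> :: real
    using mult_left_le[OF that, of "\<bar>\<alpha>\<bar>"] by (simp add: power2_eq_square flip: abs_mult)
  have geom: "norm (x, 0::real) \<le> R" "norm (x + \<alpha> *\<^sub>R p + \<alpha>\<^sup>2 *\<^sub>R v, \<alpha>\<^sup>2 * \<nu>) \<le> R"
     "norm ((x + \<alpha> *\<^sub>R p + \<alpha>\<^sup>2 *\<^sub>R v, \<alpha>\<^sup>2 * \<nu>) - (x, 0)) \<le> \<bar>\<alpha>\<bar> * R"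
     "norm (\<alpha>\<^sup>2 *\<^sub>R (v, \<nu>)) \<le> \<alpha>\<^sup>2 * R"
    if "norm x \<le> r" "norm p \<le> r" "norm v \<le> r" "\<bar>\<alpha>\<bar> \<le> 1" for x p v :: 'a and \<alpha> :: real
  proof -
    have r: "r \<ge> 0" using order_trans[OF norm_ge_zero that(1)] .
    show "norm (x, 0::real) \<le> R" using that(1) r by (simp add: R_def norm_Pair)
    have "norm (\<alpha>\<^sup>2 *\<^sub>R (v, \<nu>)) \<le> \<alpha>\<^sup>2 * (norm v + norm \<nu>)"
      unfolding norm_scaleR using norm_Pair_le[of v \<nu>] by (simp add: mult_left_mono)
    also have "\<dots> \<le> \<alpha>\<^sup>2 * R" using that(3) r by (intro mult_left_mono) (auto simp: R_def)
    finally show "norm (\<alpha>\<^sup>2 *\<^sub>R (v, \<nu>)) \<le> \<alpha>\<^sup>2 * R" .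
    have inc: "norm (\<alpha> *\<^sub>R p + \<alpha>\<^sup>2 *\<^sub>R v, \<alpha>\<^sup>2 * \<nu>) \<le> \<bar>\<alpha>\<bar> * (2 * r + \<bar>\<nu>\<bar>)"
    proof -
      have "norm (\<alpha> *\<^sub>R p + \<alpha>\<^sup>2 *\<^sub>R v, \<alpha>\<^sup>2 * \<nu>) \<le> norm (\<alpha> *\<^sub>R p + \<alpha>\<^sup>2 *\<^sub>R v) + norm (\<alpha>\<^sup>2 * \<nu>)"
        by (rule norm_Pair_le)
      also have "\<dots> \<le> norm (\<alpha> *\<^sub>R p) + norm (\<alpha>\<^sup>2 *\<^sub>R v) + norm (\<alpha>\<^sup>2 * \<nu>)"
        using norm_triangle_ineq by (intro add_right_mono)
      also have "\<dots> \<le> \<bar>\<alpha>\<bar> * r + \<bar>\<alpha>\<bar> * r + \<bar>\<alpha>\<bar> * \<bar>\<nu>\<bar>"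
        using that sq[OF that(4)] by (intro add_mono) (auto simp: abs_mult intro!: mult_mono)
      finally show ?thesis by (simp add: algebra_simps)
    qed
    also have "\<bar>\<alpha>\<bar> * (2 * r + \<bar>\<nu>\<bar>) \<le> \<bar>\<alpha>\<bar> * R" using r by (intro mult_left_mono) (auto simp: R_def)
    finally show "norm ((x + \<alpha> *\<^sub>R p + \<alpha>\<^sup>2 *\<^sub>R v, \<alpha>\<^sup>2 * \<nu>) - (x, 0)) \<le> \<bar>\<alpha>\<bar> * R"
      by (simp add: algebra_simps)
    have "\<bar>\<alpha>\<bar> * (2 * r + \<bar>\<nu>\<bar>) \<le> 1 * (2 * r + \<bar>\<nu>\<bar>)" using r that(4) by (intro mult_right_mono) auto
    moreover have "norm ((x, 0) + (\<alpha> *\<^sub>R p + \<alpha>\<^sup>2 *\<^sub>R v, \<alpha>\<^sup>2 * \<nu>)) \<le> norm (x, 0::real) + norm (\<alpha> *\<^sub>R p + \<alpha>\<^sup>2 *\<^sub>R v, \<alpha>\<^sup>2 * \<nu>)"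
      by (rule norm_triangle_ineq)
    ultimately show "norm (x + \<alpha> *\<^sub>R p + \<alpha>\<^sup>2 *\<^sub>R v, \<alpha>\<^sup>2 * \<nu>) \<le> R"
      using inc that(1) r by (simp add: R_def norm_Pair add.assoc)
  qed
  show thesis
  \<comment> \<open>\<open>K * R\<^sup>2\<close> comes from the Taylor remainder of an increment of
    size \<open>\<bar>\<alpha>\<bar> * R\<close>, and \<open>K * R\<close> from the part
    \<open>\<alpha>\<^sup>2 (v, \<nu>)\<close> of that increment.\<close>
  proof (rule that[of "K * R\<^sup>2 + K * R"])
    show "K * R\<^sup>2 + K * R \<ge> 0" using K(1) R0 by simp
  next
    fix x p v u :: 'a and \<alpha> :: real
    assume a: "norm x \<le> r" "norm p \<le> r" "norm v \<le> r" "\<bar>\<alpha>\<bar> \<le> 1"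
    let ?z = "(x + \<alpha> *\<^sub>R p + \<alpha>\<^sup>2 *\<^sub>R v, \<alpha>\<^sup>2 * \<nu>)" and ?y = "(x, 0::real)"
    let ?D = "\<lambda>y. frechet_derivative F (at y) (u, 0)"
    interpret D2: linear "frechet_derivative ?D (at ?y)"
      by (rule linear_frechet_derivative[OF differentiableI[OF analytic_map_second_derivative[OF F]]])
    have "?z - ?y = \<alpha> *\<^sub>R (p, 0) + \<alpha>\<^sup>2 *\<^sub>R (v, \<nu>)" by (rule prod_eqI) simp_all
    then have e: "frechet_derivative ?D (at ?y) (?z - ?y) =
        \<alpha> *\<^sub>R frechet_derivative ?D (at ?y) (p, 0) + frechet_derivative ?D (at ?y) (\<alpha>\<^sup>2 *\<^sub>R (v, \<nu>))"
      by (simp only: D2.add D2.scale)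
    have "?D ?z - ?D ?y - \<alpha> *\<^sub>R frechet_derivative ?D (at ?y) (p, 0) =
        (?D ?z - ?D ?y - frechet_derivative ?D (at ?y) (?z - ?y)) + frechet_derivative ?D (at ?y) (\<alpha>\<^sup>2 *\<^sub>R (v, \<nu>))"
      unfolding e by (simp only: diff_add_eq diff_diff_eq[symmetric]) simp
    also have "norm \<dots> \<le> K * norm u * (norm (?z - ?y))\<^sup>2 + K * norm u * norm (\<alpha>\<^sup>2 *\<^sub>R (v, \<nu>))"
      using K(4)[OF geom(2)[OF a] geom(1)[OF a], of "(u, 0)"] K(2)[OF geom(1)[OF a], of "(u, 0)" "\<alpha>\<^sup>2 *\<^sub>R (v, \<nu>)"]
      by (intro order_trans[OF norm_triangle_ineq] add_mono) (simp_all add: norm_Pair)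
    also have "\<dots> \<le> K * norm u * (\<bar>\<alpha>\<bar> * R)\<^sup>2 + K * norm u * (\<alpha>\<^sup>2 * R)"
      using geom(3,4)[OF a] K(1) by (intro add_mono mult_left_mono power_mono) auto
    finally show "norm (?D ?z - ?D ?y - \<alpha> *\<^sub>R frechet_derivative ?D (at ?y) (p, 0)) \<le> (K * R\<^sup>2 + K * R) * \<alpha>\<^sup>2 * norm u"
      by (simp add: algebra_simps power_mult_distrib)
  next
    fix x p :: 'a and \<alpha> :: real and u
    assume a: "norm x \<le> r" "norm p \<le> r" "\<bar>\<alpha>\<bar> \<le> 1"
    have n0: "norm (0::'a) \<le> r" using order_trans[OF norm_ge_zero a(1)] by simp
    note g = geom[OF a(1,2) n0 a(3), simplified]
    have "norm (frechet_derivative F (at (x + \<alpha> *\<^sub>R p, \<alpha>\<^sup>2 * \<nu>)) u - frechet_derivative F (at (x, 0)) u)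
        \<le> K * norm u * norm ((x + \<alpha> *\<^sub>R p, \<alpha>\<^sup>2 * \<nu>) - (x, 0))"
      using g by (intro K(3)) auto
    also have "\<dots> \<le> K * norm u * (\<bar>\<alpha>\<bar> * R)" using g K(1) by (intro mult_left_mono) auto
    also have "\<dots> \<le> (K * R\<^sup>2 + K * R) * \<bar>\<alpha>\<bar> * norm u" using K(1) R0 by (simp add: algebra_simps)
    finally show "norm (frechet_derivative F (at (x + \<alpha> *\<^sub>R p, \<alpha>\<^sup>2 * \<nu>)) u - frechet_derivative F (at (x, 0)) u)
        \<le> (K * R\<^sup>2 + K * R) * \<bar>\<alpha>\<bar> * norm u" .
  qed
qed

text \<open>The mean value inequality in \<open>v\<close>: differentiating with respect to
  \<open>v\<close> yields one factor \<open>\<alpha>\<^sup>2\<close>, the increment estimate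
  another, and division by \<open>\<alpha> ^ 3\<close> leaves one power of
  \<open>\<alpha>\<close>.\<close>

lemma rescaled_remainder_lipschitz:
  fixes F :: "'a::euclidean_space \<times> real \<Rightarrow> real ^ 'n"
  assumes F: "analytic_map F"
  obtains C where "C \<ge> 0"
    "\<And>x p v v' \<alpha>. norm x \<le> r \<Longrightarrow> norm p \<le> r \<Longrightarrow> norm v \<le> r \<Longrightarrow> norm v' \<le> r \<Longrightarrow> \<alpha> \<noteq> 0 \<Longrightarrow> \<bar>\<alpha>\<bar> \<le> 1 \<Longrightarrow>
      norm ((rescaled_remainder F \<nu> \<alpha> x p v
          - frechet_derivative (\<lambda>y. frechet_derivative F (at y) (v, 0)) (at (x, 0)) (p, 0))
        - (rescaled_remainder F \<nu> \<alpha> x p v'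
          - frechet_derivative (\<lambda>y. frechet_derivative F (at y) (v', 0)) (at (x, 0)) (p, 0)))
      \<le> C * \<bar>\<alpha>\<bar> * norm (v - v')"
proof -
  obtain C where C: "C \<ge> 0"
    "\<And>x p v u \<alpha>. norm x \<le> r \<Longrightarrow> norm p \<le> r \<Longrightarrow> norm v \<le> r \<Longrightarrow> \<bar>\<alpha>\<bar> \<le> 1 \<Longrightarrow>
      norm (frechet_derivative F (at (x + \<alpha> *\<^sub>R p + \<alpha>\<^sup>2 *\<^sub>R v, \<alpha>\<^sup>2 * \<nu>)) (u, 0)
        - frechet_derivative F (at (x, 0)) (u, 0)
        - \<alpha> *\<^sub>R frechet_derivative (\<lambda>y. frechet_derivative F (at y) (u, 0)) (at (x, 0)) (p, 0))
      \<le> C * \<alpha>\<^sup>2 * norm u"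
    "\<And>x p \<alpha> u. norm x \<le> r \<Longrightarrow> norm p \<le> r \<Longrightarrow> \<bar>\<alpha>\<bar> \<le> 1 \<Longrightarrow>
      norm (frechet_derivative F (at (x + \<alpha> *\<^sub>R p, \<alpha>\<^sup>2 * \<nu>)) u - frechet_derivative F (at (x, 0)) u)
      \<le> C * \<bar>\<alpha>\<bar> * norm u"
    using derivative_increment_estimate[OF F, of r \<nu>] by metis
  show thesis
  proof (rule that[OF C(1)])
    fix x p v v' :: 'a and \<alpha> :: real
    assume a: "norm x \<le> r" "norm p \<le> r" "norm v \<le> r" "norm v' \<le> r" "\<alpha> \<noteq> 0" "\<bar>\<alpha>\<bar> \<le> 1"
    define D2 where "D2 u = frechet_derivative (\<lambda>y. frechet_derivative F (at y) (u, 0)) (at (x, 0)) (p, 0)" for u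
    define D1 where "D1 z u = frechet_derivative F (at z) (u, 0)" for z and u :: 'a
    define Z where "Z v = (x + \<alpha> *\<^sub>R p + \<alpha>\<^sup>2 *\<^sub>R v, \<alpha>\<^sup>2 * \<nu>)" for v
    have linF: "linear (frechet_derivative F (at z))" for z
      by (rule linear_frechet_derivative[OF differentiableI[OF analytic_map_has_derivative[OF F]]])
    have D1_lin: "linear (D1 z)" for z
    proof (rule linearI)
      show "D1 z (u + w) = D1 z u + D1 z w" for u w
        using linear_add[OF linF, of z "(u, 0)" "(w, 0)"] by (simp add: D1_def)
      show "D1 z (s *\<^sub>R u) = s *\<^sub>R D1 z u" for s u
        using linear_scale[OF linF, of z s "(u, 0)"] by (simp add: D1_def)
    qed
    have D2_lin: "linear D2"
    proof (rule linearI)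
      show "D2 (u + w) = D2 u + D2 w" for u w
        using linear_add[OF linear_second_derivative[OF F, where z = "(x, 0)" and u = "(p, 0)"], of "(u, 0)" "(w, 0)"]
        by (simp add: D2_def)
      show "D2 (s *\<^sub>R u) = s *\<^sub>R D2 u" for s u
        using linear_scale[OF linear_second_derivative[OF F, where z = "(x, 0)" and u = "(p, 0)"], of s "(u, 0)"]
        by (simp add: D2_def)
    qed
    \<comment> \<open>Up to a summand independent of \<open>v\<close>, this is
      \<open>\<alpha> ^ 3\<close> times the rescaled remainder minus its limiting linear
      part.\<close>
    define k where "k v = F (Z v) - \<alpha>\<^sup>2 *\<^sub>R D1 (x, 0) v - \<alpha> ^ 3 *\<^sub>R D2 v" for v
    have k': "(k has_derivative (\<lambda>u. \<alpha>\<^sup>2 *\<^sub>R (D1 (Z w) u - D1 (x, 0) u - \<alpha> *\<^sub>R D2 u))) (at w within S)" for w S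
    proof -
      have Z': "(Z has_derivative (\<lambda>u. (\<alpha>\<^sup>2 *\<^sub>R u, 0))) (at w within S)"
        unfolding Z_def by (auto intro!: derivative_eq_intros)
      have "((\<lambda>v. F (Z v)) has_derivative (\<lambda>u. frechet_derivative F (at (Z w)) (\<alpha>\<^sup>2 *\<^sub>R u, 0))) (at w within S)"
        by (rule has_derivative_compose[OF Z' analytic_map_has_derivative[OF F]])
      moreover have "frechet_derivative F (at (Z w)) (\<alpha>\<^sup>2 *\<^sub>R u, 0) = \<alpha>\<^sup>2 *\<^sub>R D1 (Z w) u" for u
        using linear_scale[OF D1_lin] by (simp add: D1_def)
      ultimately have "((\<lambda>v. F (Z v)) has_derivative (\<lambda>u. \<alpha>\<^sup>2 *\<^sub>R D1 (Z w) u)) (at w within S)" by simp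
      then have "(k has_derivative (\<lambda>u. \<alpha>\<^sup>2 *\<^sub>R D1 (Z w) u - \<alpha>\<^sup>2 *\<^sub>R D1 (x, 0) u - \<alpha> ^ 3 *\<^sub>R D2 u)) (at w within S)"
        unfolding k_def
        by (intro has_derivative_diff has_derivative_scaleR_right bounded_linear_imp_has_derivative
            D1_lin[unfolded linear_conv_bounded_linear] D2_lin[unfolded linear_conv_bounded_linear])
      then show ?thesis by (simp add: scaleR_diff_right power3_eq_cube power2_eq_square)
    qed
    have "norm (k v - k v') \<le> (\<alpha>\<^sup>2 * (C * \<alpha>\<^sup>2)) * norm (v - v')"
    proof (rule differentiable_bound[OF convex_cball k'])
      fix w :: 'a assume "w \<in> cball 0 r"
      then have w: "norm w \<le> r" by simp
      show "onorm (\<lambda>u. \<alpha>\<^sup>2 *\<^sub>R (D1 (Z w) u - D1 (x, 0) u - \<alpha> *\<^sub>R D2 u)) \<le> \<alpha>\<^sup>2 * (C * \<alpha>\<^sup>2)"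
      proof (rule onorm_le)
        fix u
        have "norm (D1 (Z w) u - D1 (x, 0) u - \<alpha> *\<^sub>R D2 u) \<le> C * \<alpha>\<^sup>2 * norm u"
          unfolding D1_def D2_def Z_def by (rule C(2)[OF a(1,2) w a(6)])
        then have "\<alpha>\<^sup>2 * norm (D1 (Z w) u - D1 (x, 0) u - \<alpha> *\<^sub>R D2 u) \<le> \<alpha>\<^sup>2 * (C * \<alpha>\<^sup>2 * norm u)"
          by (intro mult_left_mono) auto
        then show "norm (\<alpha>\<^sup>2 *\<^sub>R (D1 (Z w) u - D1 (x, 0) u - \<alpha> *\<^sub>R D2 u)) \<le> \<alpha>\<^sup>2 * (C * \<alpha>\<^sup>2) * norm u"
          by (simp add: mult_ac)
      qed
    qed (use a in auto)
    moreover have "(rescaled_remainder F \<nu> \<alpha> x p v - D2 v) - (rescaled_remainder F \<nu> \<alpha> x p v' - D2 v')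
        = (1 / \<alpha> ^ 3) *\<^sub>R (k v - k v')"
    proof -
      have lin: "frechet_derivative F (at (x, 0)) (\<alpha> *\<^sub>R p + \<alpha>\<^sup>2 *\<^sub>R w, 0) = \<alpha> *\<^sub>R D1 (x, 0) p + \<alpha>\<^sup>2 *\<^sub>R D1 (x, 0) w" for w
        using linear_add[OF D1_lin, of "(x, 0)" "\<alpha> *\<^sub>R p" "\<alpha>\<^sup>2 *\<^sub>R w"] linear_scale[OF D1_lin]
        by (simp add: D1_def)
      have "D2 w = (1 / \<alpha> ^ 3) *\<^sub>R (\<alpha> ^ 3 *\<^sub>R D2 w)" for w using a(5) by simp
      then show ?thesis
        unfolding rescaled_remainder_def lin k_def Z_def
        by (simp add: algebra_simps)
    qed
    ultimately have "norm ((rescaled_remainder F \<nu> \<alpha> x p v - D2 v) - (rescaled_remainder F \<nu> \<alpha> x p v' - D2 v'))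
        \<le> (1 / \<bar>\<alpha>\<bar> ^ 3) * ((\<alpha>\<^sup>2 * (C * \<alpha>\<^sup>2)) * norm (v - v'))"
      by (simp add: power_abs divide_right_mono)
    also have "\<dots> = C * \<bar>\<alpha>\<bar> * norm (v - v')"
      using a(5) by (simp add: field_simps power3_eq_cube power2_eq_square abs_if)
    finally show "norm ((rescaled_remainder F \<nu> \<alpha> x p v
          - frechet_derivative (\<lambda>y. frechet_derivative F (at y) (v, 0)) (at (x, 0)) (p, 0))
        - (rescaled_remainder F \<nu> \<alpha> x p v'
          - frechet_derivative (\<lambda>y. frechet_derivative F (at y) (v', 0)) (at (x, 0)) (p, 0)))
      \<le> C * \<bar>\<alpha>\<bar> * norm (v - v')"
      unfolding D2_def .
  qed
qed

text \<open>The increment with \<open>v = 0\<close> runs along the parabola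
  \<open>(x + s p, s\<^sup>2 \<nu>)\<close>. Subtracting the Taylor polynomial of degree 2 in
  \<open>s\<close> leaves a function with derivative of order \<open>s\<^sup>2\<close>, hence a
  remainder of order \<open>\<alpha> ^ 3\<close>.\<close>

lemma rescaled_remainder_zero_bound:
  fixes F :: "'a::euclidean_space \<times> real \<Rightarrow> real ^ 'n"
  assumes F: "analytic_map F"
  obtains C where "C \<ge> 0"
    "\<And>x p \<alpha>. norm x \<le> r \<Longrightarrow> norm p \<le> r \<Longrightarrow> \<alpha> \<noteq> 0 \<Longrightarrow> \<bar>\<alpha>\<bar> \<le> 1 \<Longrightarrow>
      norm (rescaled_remainder F \<nu> \<alpha> x p 0) \<le> C"
proof -
  obtain C where C: "C \<ge> 0"
    "\<And>x p v u \<alpha>. norm x \<le> r \<Longrightarrow> norm p \<le> r \<Longrightarrow> norm v \<le> r \<Longrightarrow> \<bar>\<alpha>\<bar> \<le> 1 \<Longrightarrow>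
      norm (frechet_derivative F (at (x + \<alpha> *\<^sub>R p + \<alpha>\<^sup>2 *\<^sub>R v, \<alpha>\<^sup>2 * \<nu>)) (u, 0)
        - frechet_derivative F (at (x, 0)) (u, 0)
        - \<alpha> *\<^sub>R frechet_derivative (\<lambda>y. frechet_derivative F (at y) (u, 0)) (at (x, 0)) (p, 0))
      \<le> C * \<alpha>\<^sup>2 * norm u"
    "\<And>x p \<alpha> u. norm x \<le> r \<Longrightarrow> norm p \<le> r \<Longrightarrow> \<bar>\<alpha>\<bar> \<le> 1 \<Longrightarrow>
      norm (frechet_derivative F (at (x + \<alpha> *\<^sub>R p, \<alpha>\<^sup>2 * \<nu>)) u - frechet_derivative F (at (x, 0)) u)
      \<le> C * \<bar>\<alpha>\<bar> * norm u"
    using derivative_increment_estimate[OF F, of r \<nu>] by metis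
  define K where "K = C * \<bar>r\<bar> + 2 * \<bar>\<nu>\<bar> * C"
  have K: "K \<ge> 0" using C(1) by (simp add: K_def)
  show thesis
  proof (rule that[OF K])
    fix x p :: 'a and \<alpha> :: real
    assume a: "norm x \<le> r" "norm p \<le> r" "\<alpha> \<noteq> 0" "\<bar>\<alpha>\<bar> \<le> 1"
    have n0: "norm (0::'a) \<le> r" using order_trans[OF norm_ge_zero a(1)] by simp
    define D1 where "D1 z u = frechet_derivative F (at z) u" for z and u
    define d2 where "d2 = frechet_derivative (\<lambda>y. frechet_derivative F (at y) (p, 0)) (at (x, 0)) (p, 0)"
    define Z where "Z s = (x + s *\<^sub>R p, s\<^sup>2 * \<nu>)" for s
    have linF: "linear (D1 z)" for z unfolding D1_def
      by (rule linear_frechet_derivative[OF differentiableI[OF analytic_map_has_derivative[OF F]]])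
    define q where "q s = F (Z s) - s *\<^sub>R D1 (x, 0) (p, 0) - s\<^sup>2 *\<^sub>R (\<nu> *\<^sub>R D1 (x, 0) (0, 1) + (1 / 2) *\<^sub>R d2)" for s
    \<comment> \<open>Grouped so that each bracket meets one of the two increment estimates: the
      first is of order \<open>s\<^sup>2\<close> itself, the second of order \<open>s\<close> with
      another \<open>s\<close> in front.\<close>
    define q' where "q' s = (D1 (Z s) (p, 0) - D1 (x, 0) (p, 0) - s *\<^sub>R d2)
        + (2 * s * \<nu>) *\<^sub>R (D1 (Z s) (0, 1) - D1 (x, 0) (0, 1))" for s
    have q'd: "(q has_derivative (\<lambda>h. h *\<^sub>R q' s)) (at s within S)" for s S
    proof -
      have Z': "(Z has_derivative (\<lambda>h. (h *\<^sub>R p, h * (2 * s * \<nu>)))) (at s within S)"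
        unfolding Z_def by (auto intro!: derivative_eq_intros)
      have "((\<lambda>s. F (Z s)) has_derivative (\<lambda>h. D1 (Z s) (h *\<^sub>R p, h * (2 * s * \<nu>)))) (at s within S)"
        unfolding D1_def by (rule has_derivative_compose[OF Z' analytic_map_has_derivative[OF F]])
      moreover have "D1 (Z s) (h *\<^sub>R p, h * (2 * s * \<nu>)) = h *\<^sub>R (D1 (Z s) (p, 0) + (2 * s * \<nu>) *\<^sub>R D1 (Z s) (0, 1))" for h
        using linear_add[OF linF, of "Z s" "h *\<^sub>R (p, 0)" "(h * (2 * s * \<nu>)) *\<^sub>R (0, 1)"]
        unfolding linear_scale[OF linF] by (simp add: scaleR_add_right)
      ultimately have "((\<lambda>s. F (Z s)) has_derivative (\<lambda>h. h *\<^sub>R (D1 (Z s) (p, 0) + (2 * s * \<nu>) *\<^sub>R D1 (Z s) (0, 1)))) (at s within S)"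
        by simp
      then show ?thesis unfolding q_def
        by (rule has_derivative_eq_rhs[OF has_derivative_diff[OF has_derivative_diff]])
          (auto intro!: derivative_eq_intros simp: q'_def fun_eq_iff algebra_simps)
    qed
    have "norm (q \<alpha> - q 0) \<le> (K * \<alpha>\<^sup>2) * norm (\<alpha> - 0)"
    proof (rule differentiable_bound[OF convex_closed_segment[of 0 \<alpha>] q'd])
      fix s assume "s \<in> closed_segment 0 \<alpha>"
      then have s: "\<bar>s\<bar> \<le> \<bar>\<alpha>\<bar>" using segment_bound1[of s 0 \<alpha>] by simp
      then have s1: "\<bar>s\<bar> \<le> 1" using a(4) by linarith
      have "norm (D1 (Z s) (p, 0) - D1 (x, 0) (p, 0) - s *\<^sub>R d2) \<le> C * s\<^sup>2 * norm p"
        using C(2)[OF a(1,2) n0 s1, of p] by (simp add: D1_def Z_def d2_def)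
      also have "\<dots> \<le> C * s\<^sup>2 * \<bar>r\<bar>" using a(2) C(1) by (intro mult_left_mono) auto
      finally have 1: "norm (D1 (Z s) (p, 0) - D1 (x, 0) (p, 0) - s *\<^sub>R d2) \<le> C * s\<^sup>2 * \<bar>r\<bar>" .
      have "norm (D1 (Z s) (0, 1) - D1 (x, 0) (0, 1)) \<le> C * \<bar>s\<bar>"
        using C(3)[OF a(1,2) s1, of "(0, 1)"] by (simp add: D1_def Z_def norm_Pair)
      then have 2: "norm ((2 * s * \<nu>) *\<^sub>R (D1 (Z s) (0, 1) - D1 (x, 0) (0, 1))) \<le> \<bar>2 * s * \<nu>\<bar> * (C * \<bar>s\<bar>)"
        unfolding norm_scaleR by (intro mult_left_mono) auto
      have "norm (q' s) \<le> C * s\<^sup>2 * \<bar>r\<bar> + \<bar>2 * s * \<nu>\<bar> * (C * \<bar>s\<bar>)"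
        unfolding q'_def by (rule order_trans[OF norm_triangle_ineq add_mono[OF 1 2]])
      also have "\<bar>2 * s * \<nu>\<bar> * (C * \<bar>s\<bar>) = 2 * \<bar>\<nu>\<bar> * C * (\<bar>s\<bar> * \<bar>s\<bar>)" by (simp add: abs_mult)
      also have "C * s\<^sup>2 * \<bar>r\<bar> + 2 * \<bar>\<nu>\<bar> * C * (\<bar>s\<bar> * \<bar>s\<bar>) = K * s\<^sup>2"
        by (simp add: K_def power2_eq_square distrib_right)
      also have "\<dots> \<le> K * \<alpha>\<^sup>2" using s K by (intro mult_left_mono) (auto simp: abs_le_square_iff)
      finally have "norm (q' s) \<le> K * \<alpha>\<^sup>2" .
      then have "norm h * norm (q' s) \<le> norm h * (K * \<alpha>\<^sup>2)" for h :: real by (intro mult_left_mono) auto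
      then show "onorm (\<lambda>h. h *\<^sub>R q' s) \<le> K * \<alpha>\<^sup>2"
        by (intro onorm_le) (simp add: mult.commute)
    qed auto
    moreover have "rescaled_remainder F \<nu> \<alpha> x p 0 = (1 / \<alpha> ^ 3) *\<^sub>R (q \<alpha> - q 0)"
    proof -
      have "D1 (x, 0) (\<alpha> *\<^sub>R p, 0) = \<alpha> *\<^sub>R D1 (x, 0) (p, 0)"
        using linear_scale[OF linF, of "(x, 0)" \<alpha> "(p, 0)"] by simp
      moreover have "\<nu> * \<alpha>\<^sup>2 / \<alpha> ^ 3 = \<nu> / \<alpha>" "\<alpha>\<^sup>2 / (2 * \<alpha> ^ 3) = 1 / (\<alpha> * 2)"
        using a(3) by (simp_all add: power3_eq_cube power2_eq_square)
      ultimately show ?thesis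
        unfolding rescaled_remainder_def q_def Z_def D1_def d2_def
        by (simp add: algebra_simps)
    qed
    ultimately have "norm (rescaled_remainder F \<nu> \<alpha> x p 0) \<le> (1 / \<bar>\<alpha>\<bar> ^ 3) * (K * \<alpha>\<^sup>2 * \<bar>\<alpha>\<bar>)"
      by (simp add: power_abs divide_right_mono)
    also have "\<dots> = K" using a(3) by (simp add: power3_eq_cube power2_eq_square)
    finally show "norm (rescaled_remainder F \<nu> \<alpha> x p 0) \<le> K" .
  qed
qed

section \<open>Hamiltonian vector fields\<close>

lemma vanishing_continuous_bounded:
  fixes h :: "real \<Rightarrow> 'a::real_normed_vector"
  assumes "continuous_on UNIV h" "vanishing h"
  shows "bounded (range h)"
proof -
  obtain N where N: "\<And>t. \<bar>t\<bar> \<ge> N \<Longrightarrow> norm (h t) < 1" using vanishingD[OF assms(2), of 1] by auto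
  have "compact (h ` {-N..N})"
    by (intro compact_continuous_image continuous_on_subset[OF assms(1)]) auto
  then obtain B where B: "\<And>t. t \<in> {-N..N} \<Longrightarrow> norm (h t) \<le> B"
    using compact_imp_bounded[THEN bounded_iff[THEN iffD1]] by (metis imageI)
  have "norm (h t) \<le> max 1 B" for t
  proof (cases "\<bar>t\<bar> \<ge> N")
    case True
    then show ?thesis using N[of t] by simp
  next
    case False
    then have "t \<in> {-N..N}" by auto
    then show ?thesis using B[of t] by simp
  qed
  then show ?thesis unfolding bounded_iff by blast
qed

lemma sum_UNIV_Plus:
  fixes g :: "'m::finite + 'm \<Rightarrow> real"
  shows "(\<Sum>i\<in>UNIV. g i) = (\<Sum>a\<in>UNIV. g (Inl a)) + (\<Sum>a\<in>UNIV. g (Inr a))"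
  by (simp add: UNIV_Plus_UNIV[symmetric] sum.Plus del: UNIV_Plus_UNIV)

lemma symplectic_J_nth:
  "(symplectic_J *v w) $ Inl a = w $ Inr a" "(symplectic_J *v w) $ Inr a = - w $ Inl a"
  by (simp_all add: symplectic_J_def matrix_vector_mult_def sum_UNIV_Plus if_distrib[of "\<lambda>x. x * _"] cong: if_cong)

lemma symplectic_J_twice: "symplectic_J *v (symplectic_J *v v) = - v"
proof (unfold vec_eq_iff, rule allI)
  fix i show "(symplectic_J *v (symplectic_J *v v)) $ i = (- v) $ i"
    by (cases i) (simp_all add: symplectic_J_nth)
qed

lemma symplectic_J_inner: "(symplectic_J *v u) \<bullet> (symplectic_J *v v) = u \<bullet> v"
  by (simp add: inner_vec_def sum_UNIV_Plus symplectic_J_nth)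

lemma symplectic_J_skew: "(symplectic_J *v u) \<bullet> v = - (u \<bullet> (symplectic_J *v v))"
  using symplectic_J_inner[of u "symplectic_J *v v"] by (simp add: symplectic_J_twice inner_minus_right)

lemma symplectic_J_self: "u \<bullet> (symplectic_J *v u) = 0"
  using symplectic_J_skew[of u u] by (simp add: inner_commute)

section \<open>Gradient and Hessian of the Hamiltonian\<close>

definition spatial_gradient :: "((real ^ 'n) \<times> real \<Rightarrow> real) \<Rightarrow> (real ^ 'n) \<times> real \<Rightarrow> real ^ 'n" where
  "spatial_gradient H z = (\<chi> i. frechet_derivative H (at z) (axis i 1, 0))"

lemma axis_Pair_Basis: "(axis i 1 :: real ^ 'n, 0 :: real) \<in> Basis"
  by (auto simp: Basis_prod_def axis_in_Basis_iff)

lemma analytic_map_spatial_gradient: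
  assumes "real_analytic H" shows "analytic_map (spatial_gradient H)"
  unfolding analytic_map_def spatial_gradient_def vec_lambda_beta
  using real_analytic_partial[OF assms axis_Pair_Basis] by blast

lemma Pair_eq_sum_axis: "(v, 0) = (\<Sum>i\<in>UNIV. v $ i *\<^sub>R (axis i 1 :: real ^ 'n, 0 :: real))"
  using basis_expansion[of v] by (simp add: sum_prod[symmetric] scalar_mult_eq_scaleR prod_eq_iff fst_sum snd_sum)

lemma spatial_gradient_inner:
  assumes "real_analytic H"
  shows "frechet_derivative H (at z) (v, 0) = spatial_gradient H z \<bullet> v"
proof -
  interpret linear "frechet_derivative H (at z)"
    by (rule linear_frechet_derivative[OF real_analytic_differentiable[OF assms]])
  show ?thesis
    by (subst Pair_eq_sum_axis) (simp add: sum scale spatial_gradient_def inner_vec_def mult.commute del: scaleR_Pair)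
qed

lemma frechet_derivative_slice:
  fixes g :: "'a::real_normed_vector \<times> 'b::real_normed_vector \<Rightarrow> 'c::real_normed_vector"
  assumes "g differentiable (at (x, \<mu>))"
  shows "frechet_derivative (\<lambda>y. g (y, \<mu>)) (at x) = (\<lambda>v. frechet_derivative g (at (x, \<mu>)) (v, 0))"
proof -
  have "((\<lambda>y. (y, \<mu>)) has_derivative (\<lambda>v. (v, 0))) (at x)" by (auto intro!: derivative_eq_intros)
  from has_derivative_compose[OF this, of g] assms
  have "((\<lambda>y. g (y, \<mu>)) has_derivative (\<lambda>v. frechet_derivative g (at (x, \<mu>)) (v, 0))) (at x)"
    by (simp add: frechet_derivative_works)
  then show ?thesis by (rule frechet_derivative_at[symmetric])
qed

lemma hamiltonian_field_eq:
  assumes "real_analytic H"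
  shows "hamiltonian_field H x \<mu> = symplectic_J *v spatial_gradient H (x, \<mu>)"
  unfolding hamiltonian_field_def spatial_gradient_def
    frechet_derivative_slice[OF real_analytic_differentiable[OF assms]] ..

lemma analytic_map_hamiltonian_field:
  assumes "real_analytic H"
  shows "analytic_map (\<lambda>z. hamiltonian_field H (fst z) (snd z))"
  unfolding analytic_map_def
proof
  fix i
  show "real_analytic (\<lambda>z. hamiltonian_field H (fst z) (snd z) $ i)"
    using analytic_map_nth[OF analytic_map_spatial_gradient[OF assms]]
    by (cases i) (auto simp: hamiltonian_field_eq[OF assms] symplectic_J_nth intro!: real_analytic_uminus)
qed

lemma spatial_hessian_symmetric:
  assumes H: "real_analytic H"
  shows "frechet_derivative (spatial_gradient H) (at z) (v, 0) \<bullet> u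
       = frechet_derivative (spatial_gradient H) (at z) (u, 0) \<bullet> v"
proof -
  define h where "h i j = frechet_derivative (\<lambda>z. frechet_derivative H (at z) (axis i 1, 0)) (at z) (axis j 1, 0)" for i j
  have sym: "h i j = h j i" for i j
    unfolding h_def by (rule real_analytic_partial_commute[OF H axis_Pair_Basis axis_Pair_Basis])
  have D: "frechet_derivative (spatial_gradient H) (at z) (v, 0) $ i = (\<Sum>j\<in>UNIV. v $ j * h i j)" for v i
  proof -
    have g: "real_analytic (\<lambda>z. frechet_derivative H (at z) (axis i 1, 0))"
      by (rule real_analytic_partial[OF H axis_Pair_Basis])
    interpret linear "frechet_derivative (\<lambda>z. frechet_derivative H (at z) (axis i 1, 0)) (at z)"
      by (rule linear_frechet_derivative[OF real_analytic_differentiable[OF g]])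
    have "frechet_derivative (spatial_gradient H) (at z) (v, 0) $ i =
        frechet_derivative (\<lambda>z. frechet_derivative H (at z) (axis i 1, 0)) (at z) (v, 0)"
      unfolding analytic_map_frechet_derivative_nth(2)[OF analytic_map_spatial_gradient[OF H]]
      by (simp add: spatial_gradient_def)
    also have "\<dots> = (\<Sum>j\<in>UNIV. v $ j * h i j)"
      unfolding h_def by (subst Pair_eq_sum_axis) (simp add: sum scale del: scaleR_Pair)
    finally show ?thesis .
  qed
  have "frechet_derivative (spatial_gradient H) (at z) (v, 0) \<bullet> u = (\<Sum>i\<in>UNIV. \<Sum>j\<in>UNIV. v $ j * h i j * u $ i)"
    by (simp add: inner_vec_def D sum_distrib_right)
  also have "\<dots> = (\<Sum>j\<in>UNIV. \<Sum>i\<in>UNIV. v $ j * h i j * u $ i)" by (rule sum.swap)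
  also have "\<dots> = (\<Sum>j\<in>UNIV. \<Sum>i\<in>UNIV. u $ i * h j i * v $ j)"
    by (intro sum.cong refl) (subst sym, simp)
  also have "\<dots> = frechet_derivative (spatial_gradient H) (at z) (u, 0) \<bullet> v"
    by (simp add: inner_vec_def D sum_distrib_right)
  finally show ?thesis .
qed

text \<open>The linearization is \<open>J\<close> times the Hessian. As \<open>J\<close> squares to
  minus the identity and preserves the inner product, the two terms become the two sides of the
  symmetry of the Hessian with opposite signs.\<close>

lemma hamiltonian_linearization_adjoint:
  assumes H: "real_analytic H" and F: "F = (\<lambda>z. hamiltonian_field H (fst z) (snd z))"
  shows "(symplectic_J *v frechet_derivative F (at z) (u, 0)) \<bullet> v
       + (symplectic_J *v u) \<bullet> frechet_derivative F (at z) (v, 0) = 0"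
proof -
  let ?D = "\<lambda>w. frechet_derivative (spatial_gradient H) (at z) w"
  have "F = (\<lambda>z. symplectic_J *v spatial_gradient H z)" by (simp add: F hamiltonian_field_eq[OF H])
  then have "(F has_derivative (\<lambda>w. symplectic_J *v ?D w)) (at z)"
    by (simp add: bounded_linear.has_derivative[OF matrix_vector_mul_bounded_linear
        analytic_map_has_derivative[OF analytic_map_spatial_gradient[OF H]]])
  then have D: "frechet_derivative F (at z) w = symplectic_J *v ?D w" for w
    by (metis frechet_derivative_at)
  show ?thesis
    unfolding D symplectic_J_twice symplectic_J_inner inner_minus_left
    using spatial_hessian_symmetric[OF H, of z u v] by (simp add: inner_commute)
qed

section \<open>Homoclinic orbits with a two-dimensional variational kernel\<close>

lemma bounded_solutions_iff:
  "\<xi> \<in> bounded_solutions A \<longleftrightarrow> (\<forall>t. (\<xi> has_vector_derivative A t (\<xi> t)) (at t)) \<and> bounded (range \<xi>)"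
  by (simp add: bounded_solutions_def)

locale degenerate_homoclinic =
  fixes H :: "(real ^ ('m::finite + 'm)) \<times> real \<Rightarrow> real"
    and f :: "real ^ ('m + 'm) \<Rightarrow> real \<Rightarrow> real ^ ('m + 'm)"
    and xh \<phi>\<^sub>1 \<phi>\<^sub>2 :: "real \<Rightarrow> real ^ ('m + 'm)"
    and a\<^sub>2 b\<^sub>2 :: real
  assumes H: "real_analytic H"
    and f: "f = hamiltonian_field H"
    and equilibrium: "\<forall>\<^sub>F \<mu> in nhds 0. f 0 \<mu> = 0"
    and M1: "hyperbolic_saddle (\<lambda>x. f x 0) 0 CARD('m) CARD('m)"
    and M2: "homoclinic_orbit (\<lambda>x. f x 0) 0 xh"
    and \<phi>1: "\<phi>\<^sub>1 = (\<lambda>t. vector_derivative xh (at t))"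
    and M3: "two_element_basis
               (bounded_solutions (\<lambda>t. frechet_derivative (\<lambda>x. f x 0) (at (xh t)))) \<phi>\<^sub>1 \<phi>\<^sub>2"
    and a2: "a\<^sub>2 = - (LINT t|lborel.
               (symplectic_J *v \<phi>\<^sub>2 t) \<bullet> vector_derivative (\<lambda>\<mu>. f (xh t) \<mu>) (at 0))"
    and b2: "b\<^sub>2 = - (1/2) * (LINT t|lborel.
               (symplectic_J *v \<phi>\<^sub>2 t) \<bullet> second_derivative (\<lambda>x. f x 0) (xh t) (\<phi>\<^sub>2 t) (\<phi>\<^sub>2 t))"
    and a2_nz: "a\<^sub>2 \<noteq> 0" and b2_nz: "b\<^sub>2 \<noteq> 0"
begin

text \<open>State and parameter are treated as one variable, so one family of derivative bounds also
  controls the dependence on the parameter.\<close>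

definition F :: "(real ^ ('m + 'm)) \<times> real \<Rightarrow> real ^ ('m + 'm)" where
  "F z = hamiltonian_field H (fst z) (snd z)"

definition DF :: "(real ^ ('m + 'm)) \<times> real \<Rightarrow> (real ^ ('m + 'm)) \<times> real \<Rightarrow> real ^ ('m + 'm)" where
  "DF z = frechet_derivative F (at z)"

definition D2F :: "real ^ ('m + 'm) \<Rightarrow> real ^ ('m + 'm) \<Rightarrow> real ^ ('m + 'm) \<Rightarrow> real ^ ('m + 'm)" where
  "D2F x v w = frechet_derivative (\<lambda>y. frechet_derivative F (at y) (v, 0)) (at (x, 0)) (w, 0)"

lemma f_eq_F: "f x \<mu> = F (x, \<mu>)"
  by (simp add: F_def f)

lemma F_analytic: "analytic_map F"
  using analytic_map_hamiltonian_field[OF H] by (simp add: F_def[abs_def])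

lemma F_has_derivative: "(F has_derivative DF z) (at z)"
  unfolding DF_def by (rule analytic_map_has_derivative[OF F_analytic])

lemma linear_DF: "linear (DF z)"
  unfolding DF_def by (rule linear_frechet_derivative[OF differentiableI[OF analytic_map_has_derivative[OF F_analytic]]])

lemma f_slice_derivative: "frechet_derivative (\<lambda>x. f x 0) (at x) v = DF (x, 0) (v, 0)"
  unfolding f_eq_F DF_def
  by (rule fun_cong[OF frechet_derivative_slice]) (rule differentiableI[OF F_has_derivative])

lemma second_derivative_f: "second_derivative (\<lambda>x. f x 0) x v w = D2F x v w"
  unfolding second_derivative_def f_slice_derivative DF_def D2F_def
  by (rule fun_cong[OF frechet_derivative_slice[where g = "\<lambda>y. frechet_derivative F (at y) (v, 0)"]])
    (rule differentiableI[OF analytic_map_second_derivative[OF F_analytic]])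

lemma f_parameter_derivative: "vector_derivative (\<lambda>\<mu>. f x \<mu>) (at 0) = DF (x, 0) (0, 1)"
proof -
  have "((\<lambda>\<mu>. (x, \<mu>)) has_derivative (\<lambda>h. (0, h))) (at 0)" by (auto intro!: derivative_eq_intros)
  from has_derivative_compose[OF this F_has_derivative]
  have "((\<lambda>\<mu>. F (x, \<mu>)) has_derivative (\<lambda>h. DF (x, 0) (0, h))) (at 0)" .
  moreover have "(\<lambda>h. DF (x, 0) (0, h)) = (\<lambda>h. h *\<^sub>R DF (x, 0) (0, 1))"
  proof
    show "DF (x, 0) (0, h) = h *\<^sub>R DF (x, 0) (0, 1)" for h
      using linear_scale[OF linear_DF, of "(x, 0)" h "(0, 1)"] by simp
  qed
  ultimately have "((\<lambda>\<mu>. f x \<mu>) has_vector_derivative DF (x, 0) (0, 1)) (at 0)"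
    unfolding has_vector_derivative_def f_eq_F by (simp only:)
  then show ?thesis by (rule vector_derivative_at)
qed

lemma equilibrium_radius: obtains \<delta> where "\<delta> > 0" "\<And>\<mu>. \<bar>\<mu>\<bar> < \<delta> \<Longrightarrow> F (0, \<mu>) = 0"
  using equilibrium unfolding eventually_nhds_metric f_eq_F by (auto simp: dist_norm)

lemma F_0: "F (0, 0) = 0"
proof -
  obtain \<delta> where "\<delta> > 0" "\<And>\<mu>. \<bar>\<mu>\<bar> < \<delta> \<Longrightarrow> F (0, \<mu>) = 0" using equilibrium_radius by blast
  then show ?thesis by simp
qed

text \<open>The equilibrium persists for nearby parameters, so the field is constant along the
  parameter axis near 0. Consequently the parameter derivative along the orbit tends to 0, as the
  forcing must.\<close>

lemma DF_0_parameter: "DF (0, 0) (0, 1) = 0"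
proof -
  obtain \<delta> where \<delta>: "\<delta> > 0" "\<And>\<mu>. \<bar>\<mu>\<bar> < \<delta> \<Longrightarrow> F (0, \<mu>) = 0" using equilibrium_radius by blast
  have "((\<lambda>\<mu>. f 0 \<mu>) has_vector_derivative 0) (at 0)"
    by (rule has_vector_derivative_transform_within_open[of "\<lambda>_. 0" _ _ "{-\<delta><..<\<delta>}"])
      (use \<delta> in \<open>auto simp: f_eq_F\<close>)
  then show ?thesis using vector_derivative_at f_parameter_derivative by metis
qed

lemma xh_derivative: "(xh has_vector_derivative F (xh t, 0)) (at t)"
  using M2 by (simp add: homoclinic_orbit_def f_eq_F)

lemma xh_vanishing: "vanishing xh"
  using M2 unfolding homoclinic_orbit_def vanishing_def at_infinity_eq_at_top_bot by (simp add: filterlim_sup)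

lemma xh_continuous: "continuous_on UNIV xh"
  using xh_derivative has_vector_derivative_continuous continuous_at_imp_continuous_on by blast

lemma \<phi>1_eq: "\<phi>\<^sub>1 t = F (xh t, 0)"
  using vector_derivative_at[OF xh_derivative] by (simp add: \<phi>1)

lemma basis_facts:
  "(\<phi>\<^sub>1 has_vector_derivative DF (xh t, 0) (\<phi>\<^sub>1 t, 0)) (at t)" "bounded (range \<phi>\<^sub>1)"
  "(\<phi>\<^sub>2 has_vector_derivative DF (xh t, 0) (\<phi>\<^sub>2 t, 0)) (at t)" "bounded (range \<phi>\<^sub>2)"
  "(\<forall>t. c *\<^sub>R \<phi>\<^sub>1 t + d *\<^sub>R \<phi>\<^sub>2 t = 0) \<Longrightarrow> c = 0 \<and> d = 0"
  "(\<And>t. (y has_vector_derivative DF (xh t, 0) (y t, 0)) (at t)) \<Longrightarrow> bounded (range y) \<Longrightarrow>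
    \<exists>c d. \<forall>t. y t = c *\<^sub>R \<phi>\<^sub>1 t + d *\<^sub>R \<phi>\<^sub>2 t"
  using M3 unfolding two_element_basis_def bounded_solutions_iff f_slice_derivative Ball_def by blast+

section \<open>The orbit and the variational solutions as bounded continuous functions\<close>

definition XH :: "real \<Rightarrow>\<^sub>C (real ^ ('m + 'm))" where "XH = Bcontfun xh"
definition P1 :: "real \<Rightarrow>\<^sub>C (real ^ ('m + 'm))" where "P1 = Bcontfun \<phi>\<^sub>1"
definition P2 :: "real \<Rightarrow>\<^sub>C (real ^ ('m + 'm))" where "P2 = Bcontfun \<phi>\<^sub>2"

lemma Bcontfun_bounded_apply:
  fixes g :: "real \<Rightarrow> real ^ ('m + 'm)"
  assumes "continuous_on UNIV g" "bounded (range g)"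
  shows "apply_bcontfun (Bcontfun g) = g"
  using assms by (intro Bcontfun_inverse) (simp add: bcontfun_def)

lemma apply_XH: "apply_bcontfun XH = xh"
  unfolding XH_def
  by (intro Bcontfun_bounded_apply xh_continuous vanishing_continuous_bounded[OF xh_continuous xh_vanishing])

lemma apply_P1: "apply_bcontfun P1 = \<phi>\<^sub>1"
  unfolding P1_def using basis_facts(1,2) has_vector_derivative_continuous continuous_at_imp_continuous_on
  by (intro Bcontfun_bounded_apply) blast+

lemma apply_P2: "apply_bcontfun P2 = \<phi>\<^sub>2"
  unfolding P2_def using basis_facts(3,4) has_vector_derivative_continuous continuous_at_imp_continuous_on
  by (intro Bcontfun_bounded_apply) blast+

text \<open>A common sup bound for the orbit and \<open>\<phi>\<^sub>2\<close>, and the radius of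
  the ball on which the field is estimated. The integrable weight is
  \<open>cauchy_weight\<close>.\<close>

definition \<rho> :: real where "\<rho> = max (norm XH) (norm P2)"

lemma norm_xh_le: "norm (xh t) \<le> \<rho>" and norm_\<phi>2_le: "norm (\<phi>\<^sub>2 t) \<le> \<rho>"
  using norm_bounded[of XH t] norm_bounded[of P2 t] by (simp_all add: \<rho>_def apply_XH apply_P2)

lemma \<rho>_nonneg: "\<rho> \<ge> 0"
  by (simp add: \<rho>_def le_max_iff_disj)

text \<open>The derivative of the field is Lipschitz on the ball, so its distance at
  \<open>xh t\<close> from its value at the equilibrium is at most a multiple of
  \<open>norm (xh t)\<close>, which vanishes at both ends.\<close>

lemma linearization_asymptotically_hyperbolic:
  obtains b where "asymptotically_hyperbolic (jacobian (\<lambda>x. f x 0) (at 0)) (\<lambda>t v. DF (xh t, 0) (v, 0)) b"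
proof -
  obtain C where C: "C \<ge> 0" "\<And>y z v. norm y \<le> \<rho> \<Longrightarrow> norm z \<le> \<rho> \<Longrightarrow>
       norm (frechet_derivative F (at y) v - frechet_derivative F (at z) v) \<le> C * norm v * norm (y - z)"
    using analytic_map_derivative_lipschitz[OF F_analytic, of \<rho>] by metis
  show thesis
  proof (rule that[of "\<lambda>t. C * norm (xh t)"], rule asymptotically_hyperbolic.intro)
    show "det (mat l - map_matrix complex_of_real (jacobian (\<lambda>x. f x 0) (at 0))) \<noteq> 0" if "Re l = 0" for l
      by (rule hyperbolic_saddle_no_imaginary_eigenvalue[OF M1 that])
    show "linear (\<lambda>v. DF (xh t, 0) (v, 0))" for t
    proof (rule linearI)
      show "DF (xh t, 0) (u + w, 0) = DF (xh t, 0) (u, 0) + DF (xh t, 0) (w, 0)" for u w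
        using linear_add[OF linear_DF, of "(xh t, 0)" "(u, 0)" "(w, 0)"] by simp
      show "DF (xh t, 0) (s *\<^sub>R u, 0) = s *\<^sub>R DF (xh t, 0) (u, 0)" for s u
        using linear_scale[OF linear_DF, of "(xh t, 0)" s "(u, 0)"] by simp
    qed
    show "continuous_on UNIV (\<lambda>t. DF (xh t, 0) (w t, 0))" if "continuous_on UNIV w" for w
      unfolding DF_def
      by (intro analytic_map_derivative_continuous_on[OF F_analytic] continuous_on_Pair xh_continuous that continuous_on_const)
    show "norm (DF (xh t, 0) (v, 0) - jacobian (\<lambda>x. f x 0) (at 0) *v v) \<le> C * norm (xh t) * norm v" for t v
    proof -
      have "linear (frechet_derivative (\<lambda>x. f x 0) (at 0))"
      proof (rule linearI)
        show "frechet_derivative (\<lambda>x. f x 0) (at 0) (u + w) = frechet_derivative (\<lambda>x. f x 0) (at 0) u + frechet_derivative (\<lambda>x. f x 0) (at 0) w" for u w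
          using linear_add[OF linear_DF, of "(0, 0)" "(u, 0)" "(w, 0)"] by (simp add: f_slice_derivative)
        show "frechet_derivative (\<lambda>x. f x 0) (at 0) (s *\<^sub>R u) = s *\<^sub>R frechet_derivative (\<lambda>x. f x 0) (at 0) u" for s u
          using linear_scale[OF linear_DF, of "(0, 0)" s "(u, 0)"] by (simp add: f_slice_derivative)
      qed
      then have "jacobian (\<lambda>x. f x 0) (at 0) *v v = DF (0, 0) (v, 0)"
        by (simp add: jacobian_def matrix_works f_slice_derivative)
      then show ?thesis
        using C(2)[of "(xh t, 0)" "(0, 0)" "(v, 0)"] norm_xh_le[of t] \<rho>_nonneg
        by (simp add: DF_def norm_Pair mult_ac)
    qed
    show "vanishing (\<lambda>t. C * norm (xh t))"
      by (rule vanishing_bound[OF xh_vanishing, of _ C]) (simp add: C(1))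
    have "\<bar>C * norm (xh t)\<bar> \<le> C * \<rho>" for t
      using norm_xh_le[of t] C(1) by (simp add: abs_mult mult_left_mono)
    then show "bounded (range (\<lambda>t. C * norm (xh t)))" unfolding bounded_iff by auto
  qed
qed

text \<open>Boundedness is all that is assumed of \<open>\<phi>\<^sub>2\<close>; its decay is what
  makes the perturbed orbits homoclinic.\<close>

lemma \<phi>2_vanishing: "vanishing \<phi>\<^sub>2"
proof -
  obtain b where "asymptotically_hyperbolic (jacobian (\<lambda>x. f x 0) (at 0)) (\<lambda>t v. DF (xh t, 0) (v, 0)) b"
    using linearization_asymptotically_hyperbolic by blast
  from asymptotically_hyperbolic.bounded_solution_vanishing[OF this basis_facts(3,4)] show ?thesis .
qed

definition \<nu> :: real where "\<nu> = - b\<^sub>2 / a\<^sub>2"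

text \<open>The part of the rescaled nonlinearity that is linear in \<open>v\<close> at
  \<open>\<alpha> = 0\<close>. It is the cross term of half the quadratic form at
  \<open>\<phi>\<^sub>2 + \<alpha> v\<close>, so two equal contributions cancel the factor
  1/2.\<close>

definition hessian_operator :: "(real \<Rightarrow>\<^sub>C (real ^ ('m + 'm))) \<Rightarrow> (real \<Rightarrow>\<^sub>C (real ^ ('m + 'm)))" where
  "hessian_operator v = Bcontfun (\<lambda>t. D2F (xh t) (v t) (\<phi>\<^sub>2 t))"

definition forcing :: "real \<Rightarrow>\<^sub>C (real ^ ('m + 'm))" where
  "forcing = Bcontfun (\<lambda>t. \<nu> *\<^sub>R DF (xh t, 0) (0, 1) + (1 / 2) *\<^sub>R D2F (xh t) (\<phi>\<^sub>2 t) (\<phi>\<^sub>2 t))"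

definition remainder :: "real \<Rightarrow> (real \<Rightarrow>\<^sub>C (real ^ ('m + 'm))) \<Rightarrow> (real \<Rightarrow>\<^sub>C (real ^ ('m + 'm)))" where
  "remainder \<alpha> v = Bcontfun (\<lambda>t. rescaled_remainder F \<nu> \<alpha> (xh t) (\<phi>\<^sub>2 t) (v t))"

lemma continuous_\<phi>2: "continuous_on UNIV \<phi>\<^sub>2"
  using continuous_on_apply_bcontfun[of UNIV P2] by (simp add: apply_P2)

lemma D2F_continuous:
  assumes "continuous_on UNIV v"
  shows "continuous_on UNIV (\<lambda>t. D2F (xh t) (v t) (\<phi>\<^sub>2 t))"
  unfolding D2F_def
  by (intro analytic_map_second_derivative_continuous_on[OF F_analytic] continuous_on_Pair continuous_on_const
      xh_continuous continuous_\<phi>2 assms)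

lemma D2F_bound: obtains K where "K \<ge> 0" "\<And>t v w. norm (D2F (xh t) v w) \<le> K * norm v * norm w"
proof -
  obtain K where K: "K \<ge> 0" "\<And>y u v. norm y \<le> \<rho> \<Longrightarrow>
       norm (frechet_derivative (\<lambda>y. frechet_derivative F (at y) v) (at y) u) \<le> K * norm v * norm u"
    using analytic_map_derivative_lipschitz[OF F_analytic, of \<rho>] by metis
  show thesis
  proof (rule that[OF K(1)])
    show "norm (D2F (xh t) v w) \<le> K * norm v * norm w" for t v w
      using K(2)[of "(xh t, 0)" "(v, 0)" "(w, 0)"] norm_xh_le[of t] by (simp add: D2F_def norm_Pair)
  qed
qed

lemma D2F_vanishing:
  fixes v :: "real \<Rightarrow>\<^sub>C (real ^ ('m + 'm))"
  shows "vanishing (\<lambda>t. D2F (xh t) (v t) (\<phi>\<^sub>2 t))"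
proof -
  obtain K where K: "K \<ge> 0" "\<And>t v w. norm (D2F (xh t) v w) \<le> K * norm v * norm w" using D2F_bound by blast
  show ?thesis
  proof (rule vanishing_bound[OF \<phi>2_vanishing])
    show "norm (D2F (xh t) (v t) (\<phi>\<^sub>2 t)) \<le> (K * norm v) * norm (\<phi>\<^sub>2 t)" for t
      by (rule order_trans[OF K(2)]) (intro mult_right_mono mult_left_mono norm_bounded K(1) norm_ge_zero)
  qed
qed

lemma hessian_operator_apply: "hessian_operator v t = D2F (xh t) (v t) (\<phi>\<^sub>2 t)"
proof -
  have "apply_bcontfun (hessian_operator v) = (\<lambda>t. D2F (xh t) (v t) (\<phi>\<^sub>2 t))"
    unfolding hessian_operator_def
    by (intro Bcontfun_bounded_apply D2F_continuous vanishing_continuous_bounded D2F_vanishing) auto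
  then show ?thesis by simp
qed

lemma bounded_linear_hessian_operator: "bounded_linear hessian_operator"
proof -
  obtain K where K: "K \<ge> 0" "\<And>t v w. norm (D2F (xh t) v w) \<le> K * norm v * norm w" using D2F_bound by blast
  have lin: "linear (\<lambda>u. frechet_derivative (\<lambda>y. frechet_derivative F (at y) u) (at (xh t, 0)) (\<phi>\<^sub>2 t, 0))" for t
    by (rule linear_second_derivative[OF F_analytic])
  show ?thesis
  proof (rule bounded_linear_intro[where K = "K * norm P2"])
    show "hessian_operator (x + y) = hessian_operator x + hessian_operator y" for x y
    proof (rule bcontfun_eqI)
      fix t show "hessian_operator (x + y) t = (hessian_operator x + hessian_operator y) t"
        using linear_add[OF lin[of t], of "(x t, 0)" "(y t, 0)"] by (simp add: hessian_operator_apply D2F_def)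
    qed
    show "hessian_operator (r *\<^sub>R x) = r *\<^sub>R hessian_operator x" for r x
    proof (rule bcontfun_eqI)
      fix t show "hessian_operator (r *\<^sub>R x) t = (r *\<^sub>R hessian_operator x) t"
        using linear_scale[OF lin[of t], of r "(x t, 0)"] by (simp add: hessian_operator_apply D2F_def)
    qed
    show "norm (hessian_operator x) \<le> norm x * (K * norm P2)" for x
    proof (rule norm_bound)
      fix t
      have "norm (hessian_operator x t) \<le> K * norm (x t) * norm (P2 t)"
        unfolding hessian_operator_apply apply_P2 by (rule K(2))
      also have "\<dots> \<le> K * norm x * norm P2"
        using K(1) by (intro mult_mono mult_left_mono norm_bounded) auto
      finally show "norm (hessian_operator x t) \<le> norm x * (K * norm P2)" by (simp add: mult_ac)
    qed
  qed
qed

lemma parameter_derivative_vanishing: "vanishing (\<lambda>t. DF (xh t, 0) (0, 1))"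
proof -
  obtain C where C: "C \<ge> 0" "\<And>y z v. norm y \<le> \<rho> \<Longrightarrow> norm z \<le> \<rho> \<Longrightarrow>
       norm (frechet_derivative F (at y) v - frechet_derivative F (at z) v) \<le> C * norm v * norm (y - z)"
    using analytic_map_derivative_lipschitz[OF F_analytic, of \<rho>] by metis
  show ?thesis
  proof (rule vanishing_bound[OF xh_vanishing])
    show "norm (DF (xh t, 0) (0, 1)) \<le> C * norm (xh t)" for t
      using C(2)[of "(xh t, 0)" "(0, 0)" "(0, 1)"] norm_xh_le[of t] \<rho>_nonneg DF_0_parameter
      by (simp add: DF_def norm_Pair)
  qed
qed

lemma parameter_derivative_continuous: "continuous_on UNIV (\<lambda>t. DF (xh t, 0) (0, 1))"
  unfolding DF_def
  by (intro analytic_map_derivative_continuous_on[OF F_analytic] continuous_on_Pair xh_continuous continuous_on_const)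

lemma forcing_vanishing': "vanishing (\<lambda>t. \<nu> *\<^sub>R DF (xh t, 0) (0, 1) + (1 / 2) *\<^sub>R D2F (xh t) (\<phi>\<^sub>2 t) (\<phi>\<^sub>2 t))"
  using D2F_vanishing[of P2] unfolding apply_P2
  by (intro vanishing_add vanishing_scaleR parameter_derivative_vanishing)

lemma forcing_apply: "apply_bcontfun forcing = (\<lambda>t. \<nu> *\<^sub>R DF (xh t, 0) (0, 1) + (1 / 2) *\<^sub>R D2F (xh t) (\<phi>\<^sub>2 t) (\<phi>\<^sub>2 t))"
proof -
  have "continuous_on UNIV (\<lambda>t. \<nu> *\<^sub>R DF (xh t, 0) (0, 1) + (1 / 2) *\<^sub>R D2F (xh t) (\<phi>\<^sub>2 t) (\<phi>\<^sub>2 t))"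
    by (intro continuous_on_add continuous_on_scaleR continuous_on_const parameter_derivative_continuous
        D2F_continuous continuous_\<phi>2)
  then show ?thesis unfolding forcing_def
    by (intro Bcontfun_bounded_apply vanishing_continuous_bounded forcing_vanishing')
qed

lemma rescaled_remainder_continuous:
  assumes "continuous_on UNIV v"
  shows "continuous_on UNIV (\<lambda>t. rescaled_remainder F \<nu> \<alpha> (xh t) (\<phi>\<^sub>2 t) (v t))"
  unfolding rescaled_remainder_def
  by (intro continuous_on_diff continuous_on_add continuous_on_scaleR continuous_on_const
      analytic_map_continuous_on[OF F_analytic] analytic_map_derivative_continuous_on[OF F_analytic]
      analytic_map_second_derivative_continuous_on[OF F_analytic] continuous_on_Pair
      xh_continuous continuous_\<phi>2 assms)

lemma rescaled_remainder_hessian_lipschitz: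
  obtains L where "L \<ge> 0"
    "\<And>t v v' \<alpha>. norm v \<le> r \<Longrightarrow> norm v' \<le> r \<Longrightarrow> \<alpha> \<noteq> 0 \<Longrightarrow> \<bar>\<alpha>\<bar> \<le> 1 \<Longrightarrow>
      norm ((rescaled_remainder F \<nu> \<alpha> (xh t) (\<phi>\<^sub>2 t) v - D2F (xh t) v (\<phi>\<^sub>2 t))
        - (rescaled_remainder F \<nu> \<alpha> (xh t) (\<phi>\<^sub>2 t) v' - D2F (xh t) v' (\<phi>\<^sub>2 t))) \<le> L * \<bar>\<alpha>\<bar> * norm (v - v')"
proof -
  obtain L where L: "L \<ge> 0"
    "\<And>x p v v' \<alpha>. norm x \<le> max r \<rho> \<Longrightarrow> norm p \<le> max r \<rho> \<Longrightarrow> norm v \<le> max r \<rho> \<Longrightarrow> norm v' \<le> max r \<rho> \<Longrightarrow> \<alpha> \<noteq> 0 \<Longrightarrow> \<bar>\<alpha>\<bar> \<le> 1 \<Longrightarrow>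
      norm ((rescaled_remainder F \<nu> \<alpha> x p v
          - frechet_derivative (\<lambda>y. frechet_derivative F (at y) (v, 0)) (at (x, 0)) (p, 0))
        - (rescaled_remainder F \<nu> \<alpha> x p v'
          - frechet_derivative (\<lambda>y. frechet_derivative F (at y) (v', 0)) (at (x, 0)) (p, 0)))
      \<le> L * \<bar>\<alpha>\<bar> * norm (v - v')"
    using rescaled_remainder_lipschitz[OF F_analytic, of "max r \<rho>" \<nu>] by metis
  show thesis
  proof (rule that[OF L(1)])
    fix t and v v' :: "real ^ ('m + 'm)" and \<alpha> :: real
    assume "norm v \<le> r" "norm v' \<le> r" "\<alpha> \<noteq> 0" "\<bar>\<alpha>\<bar> \<le> 1"
    then show "norm ((rescaled_remainder F \<nu> \<alpha> (xh t) (\<phi>\<^sub>2 t) v - D2F (xh t) v (\<phi>\<^sub>2 t))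
        - (rescaled_remainder F \<nu> \<alpha> (xh t) (\<phi>\<^sub>2 t) v' - D2F (xh t) v' (\<phi>\<^sub>2 t))) \<le> L * \<bar>\<alpha>\<bar> * norm (v - v')"
      unfolding D2F_def using norm_xh_le[of t] norm_\<phi>2_le[of t] by (intro L(2)) auto
  qed
qed

lemma rescaled_remainder_bound:
  obtains C where "\<And>t \<alpha>. \<alpha> \<noteq> 0 \<Longrightarrow> \<bar>\<alpha>\<bar> \<le> 1 \<Longrightarrow> norm (rescaled_remainder F \<nu> \<alpha> (xh t) (\<phi>\<^sub>2 t) 0) \<le> C"
proof -
  obtain C where C: "\<And>x p \<alpha>. norm x \<le> \<rho> \<Longrightarrow> norm p \<le> \<rho> \<Longrightarrow> \<alpha> \<noteq> 0 \<Longrightarrow> \<bar>\<alpha>\<bar> \<le> 1 \<Longrightarrow>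
      norm (rescaled_remainder F \<nu> \<alpha> x p 0) \<le> C"
    using rescaled_remainder_zero_bound[OF F_analytic, of \<rho> \<nu>] by metis
  show thesis by (rule that[of C]) (intro C norm_xh_le norm_\<phi>2_le)
qed

text \<open>\<open>Bcontfun\<close> is faithful only on bounded continuous functions. Boundedness in
  \<open>t\<close> comes from comparing \<open>v\<close> with 0: the Lipschitz estimate, the linear
  part and the bound at 0 add up.\<close>

lemma remainder_apply:
  assumes \<alpha>: "\<alpha> \<noteq> 0" "\<bar>\<alpha>\<bar> \<le> 1"
  shows "remainder \<alpha> v t = rescaled_remainder F \<nu> \<alpha> (xh t) (\<phi>\<^sub>2 t) (v t)"
proof -
  obtain L where L: "L \<ge> 0"
    "\<And>t w w' \<alpha>. norm w \<le> norm v \<Longrightarrow> norm w' \<le> norm v \<Longrightarrow> \<alpha> \<noteq> 0 \<Longrightarrow> \<bar>\<alpha>\<bar> \<le> 1 \<Longrightarrow>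
      norm ((rescaled_remainder F \<nu> \<alpha> (xh t) (\<phi>\<^sub>2 t) w - D2F (xh t) w (\<phi>\<^sub>2 t))
        - (rescaled_remainder F \<nu> \<alpha> (xh t) (\<phi>\<^sub>2 t) w' - D2F (xh t) w' (\<phi>\<^sub>2 t))) \<le> L * \<bar>\<alpha>\<bar> * norm (w - w')"
    using rescaled_remainder_hessian_lipschitz[of "norm v"] by metis
  obtain C where C: "\<And>t \<alpha>. \<alpha> \<noteq> 0 \<Longrightarrow> \<bar>\<alpha>\<bar> \<le> 1 \<Longrightarrow> norm (rescaled_remainder F \<nu> \<alpha> (xh t) (\<phi>\<^sub>2 t) 0) \<le> C"
    using rescaled_remainder_bound by metis
  have "apply_bcontfun (remainder \<alpha> v) = (\<lambda>t. rescaled_remainder F \<nu> \<alpha> (xh t) (\<phi>\<^sub>2 t) (v t))"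
    unfolding remainder_def
  proof (rule bcontfun_of_bounded)
    show "continuous_on UNIV (\<lambda>t. rescaled_remainder F \<nu> \<alpha> (xh t) (\<phi>\<^sub>2 t) (v t))"
      by (rule rescaled_remainder_continuous) auto
    fix t
    let ?R = "\<lambda>w. rescaled_remainder F \<nu> \<alpha> (xh t) (\<phi>\<^sub>2 t) w" and ?D = "\<lambda>w. D2F (xh t) w (\<phi>\<^sub>2 t)"
    have "hessian_operator 0 = 0" by (rule linear_0[OF bounded_linear.linear[OF bounded_linear_hessian_operator]])
    then have D0: "?D 0 = 0" using hessian_operator_apply[of 0 t] by simp
    have Dv: "norm (?D (v t)) \<le> norm (hessian_operator v)"
      using norm_bounded[of "hessian_operator v" t] by (simp add: hessian_operator_apply)
    have "norm ((?R (v t) - ?D (v t)) - (?R 0 - ?D 0)) \<le> L * \<bar>\<alpha>\<bar> * norm (v t - 0)"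
      by (intro L(2) \<alpha> norm_bounded) auto
    also have "\<dots> \<le> L * \<bar>\<alpha>\<bar> * norm v" using norm_bounded[of v t] L(1) by (intro mult_left_mono) auto
    finally have 1: "norm (?R (v t) - ?D (v t) - ?R 0) \<le> L * \<bar>\<alpha>\<bar> * norm v" using D0 by simp
    have "norm (?R (v t)) = norm ((?R (v t) - ?D (v t) - ?R 0) + ?D (v t) + ?R 0)" by simp
    also have "\<dots> \<le> norm (?R (v t) - ?D (v t) - ?R 0) + norm (?D (v t)) + norm (?R 0)"
      by (intro order_trans[OF norm_triangle_ineq] add_right_mono norm_triangle_ineq)
    also have "\<dots> \<le> L * \<bar>\<alpha>\<bar> * norm v + norm (hessian_operator v) + C"
      using 1 Dv C[OF \<alpha>, of t] by linarith
    finally show "norm (?R (v t)) \<le> L * \<bar>\<alpha>\<bar> * norm v + norm (hessian_operator v) + C" .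
  qed
  then show ?thesis by simp
qed

lemma remainder_zero_bound:
  obtains C where "\<And>\<alpha>. \<alpha> \<noteq> 0 \<Longrightarrow> \<bar>\<alpha>\<bar> \<le> 1 \<Longrightarrow> norm (remainder \<alpha> 0) \<le> C"
proof -
  obtain C where C: "\<And>t \<alpha>. \<alpha> \<noteq> 0 \<Longrightarrow> \<bar>\<alpha>\<bar> \<le> 1 \<Longrightarrow> norm (rescaled_remainder F \<nu> \<alpha> (xh t) (\<phi>\<^sub>2 t) 0) \<le> C"
    using rescaled_remainder_bound by metis
  show thesis
    by (rule that[of C], rule norm_bound) (simp add: remainder_apply C)
qed

lemma remainder_lipschitz:
  "\<exists>L\<ge>0. \<forall>\<alpha> v v'. \<alpha> \<noteq> 0 \<longrightarrow> \<bar>\<alpha>\<bar> \<le> 1 \<longrightarrow> norm v \<le> r \<longrightarrow> norm v' \<le> r \<longrightarrow>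
     norm ((remainder \<alpha> v - hessian_operator v) - (remainder \<alpha> v' - hessian_operator v')) \<le> L * \<bar>\<alpha>\<bar> * norm (v - v')"
proof -
  obtain L where L: "L \<ge> 0"
    "\<And>t w w' \<alpha>. norm w \<le> r \<Longrightarrow> norm w' \<le> r \<Longrightarrow> \<alpha> \<noteq> 0 \<Longrightarrow> \<bar>\<alpha>\<bar> \<le> 1 \<Longrightarrow>
      norm ((rescaled_remainder F \<nu> \<alpha> (xh t) (\<phi>\<^sub>2 t) w - D2F (xh t) w (\<phi>\<^sub>2 t))
        - (rescaled_remainder F \<nu> \<alpha> (xh t) (\<phi>\<^sub>2 t) w' - D2F (xh t) w' (\<phi>\<^sub>2 t))) \<le> L * \<bar>\<alpha>\<bar> * norm (w - w')"
    using rescaled_remainder_hessian_lipschitz[of r] by metis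
  show ?thesis
  proof (intro exI[of _ L] conjI allI impI L(1) norm_bound)
    fix \<alpha> :: real and v v' :: "real \<Rightarrow>\<^sub>C (real ^ ('m + 'm))" and t
    assume a: "\<alpha> \<noteq> 0" "\<bar>\<alpha>\<bar> \<le> 1" "norm v \<le> r" "norm v' \<le> r"
    have "norm (((remainder \<alpha> v - hessian_operator v) - (remainder \<alpha> v' - hessian_operator v')) t)
      \<le> L * \<bar>\<alpha>\<bar> * norm (v t - v' t)"
      using L(2)[of "v t" "v' t" \<alpha> t] a order_trans[OF norm_bounded a(3)] order_trans[OF norm_bounded a(4)]
      by (simp add: remainder_apply[OF a(1,2)] hessian_operator_apply)
    also have "\<dots> \<le> L * \<bar>\<alpha>\<bar> * norm (v - v')"
      using norm_bounded[of "v - v'" t] L(1) by (intro mult_left_mono) auto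
    finally show "norm (((remainder \<alpha> v - hessian_operator v) - (remainder \<alpha> v' - hessian_operator v')) t)
      \<le> L * \<bar>\<alpha>\<bar> * norm (v - v')" .
  qed
qed

text \<open>As long as the origin is an equilibrium at the parameter
  \<open>\<alpha>\<^sup>2 * \<nu>\<close>, the field along the new curve is bounded by a multiple of
  the curve itself. All other terms are controlled by \<open>xh\<close>, by the increment or by the
  forcing, and each of these vanishes.\<close>

lemma remainder_vanishing:
  obtains \<alpha>0 where "\<alpha>0 > 0" "\<alpha>0 \<le> 1"
    "\<And>\<alpha>. \<bar>\<alpha>\<bar> < \<alpha>0 \<Longrightarrow> F (0, \<alpha>\<^sup>2 * \<nu>) = 0"
    "\<And>\<alpha> v. \<alpha> \<noteq> 0 \<Longrightarrow> \<bar>\<alpha>\<bar> < \<alpha>0 \<Longrightarrow> vanishing (apply_bcontfun v) \<Longrightarrow> vanishing (apply_bcontfun (remainder \<alpha> v))"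
proof -
  obtain \<delta> where \<delta>: "\<delta> > 0" "\<And>\<mu>. \<bar>\<mu>\<bar> < \<delta> \<Longrightarrow> F (0, \<mu>) = 0" using equilibrium_radius by blast
  \<comment> \<open>The 1 allows \<open>\<alpha>\<^sup>2\<close> to be replaced by
    \<open>\<bar>\<alpha>\<bar>\<close>; the quotient then keeps the parameter within
    \<open>\<delta>\<close>.\<close>
  define \<alpha>0 where "\<alpha>0 = min 1 (\<delta> / (\<bar>\<nu>\<bar> + 1))"
  have \<alpha>0: "\<alpha>0 > 0" "\<alpha>0 \<le> 1" using \<delta>(1) by (auto simp: \<alpha>0_def)
  have F0: "F (0, \<alpha>\<^sup>2 * \<nu>) = 0" if "\<bar>\<alpha>\<bar> < \<alpha>0" for \<alpha>
  proof (rule \<delta>(2))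
    have a1: "\<bar>\<alpha>\<bar> \<le> 1" and "\<bar>\<alpha>\<bar> < \<delta> / (\<bar>\<nu>\<bar> + 1)" using that by (auto simp: \<alpha>0_def)
    then have a: "\<bar>\<alpha>\<bar> * (\<bar>\<nu>\<bar> + 1) < \<delta>" by (simp add: pos_less_divide_eq)
    have "\<bar>\<alpha>\<bar> * \<bar>\<alpha>\<bar> \<le> \<bar>\<alpha>\<bar> * 1" by (rule mult_left_mono[OF a1]) simp
    then have "\<alpha>\<^sup>2 * \<bar>\<nu>\<bar> \<le> \<bar>\<alpha>\<bar> * (\<bar>\<nu>\<bar> + 1)" by (intro mult_mono) (auto simp: power2_eq_square)
    then show "\<bar>\<alpha>\<^sup>2 * \<nu>\<bar> < \<delta>" using a by (simp add: abs_mult)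
  qed
  show thesis
  proof (rule that[OF \<alpha>0 F0])
    fix \<alpha> and v :: "real \<Rightarrow>\<^sub>C (real ^ ('m + 'm))"
    assume \<alpha>: "\<alpha> \<noteq> 0" "\<bar>\<alpha>\<bar> < \<alpha>0" and v: "vanishing (apply_bcontfun v)"
    define p where "p t = \<alpha> *\<^sub>R \<phi>\<^sub>2 t + \<alpha>\<^sup>2 *\<^sub>R v t" for t
    have p: "vanishing p" unfolding p_def by (intro vanishing_add vanishing_scaleR \<phi>2_vanishing v)
    have q: "vanishing (\<lambda>t. xh t + p t)" by (intro vanishing_add xh_vanishing p)
    have pc: "continuous_on UNIV p" unfolding p_def by (intro continuous_intros continuous_\<phi>2) auto
    obtain B where B: "\<And>t. norm (xh t + p t) \<le> B"
      using vanishing_continuous_bounded[OF continuous_on_add[OF xh_continuous pc] q] unfolding bounded_iff by auto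
    define R where "R = \<bar>B\<bar> + \<rho> + \<bar>\<alpha>\<^sup>2 * \<nu>\<bar>"
    obtain K where K: "K \<ge> 0" "\<And>y v. norm y \<le> R \<Longrightarrow> norm (frechet_derivative F (at y) v) \<le> K * norm v"
      "\<And>y z. norm y \<le> R \<Longrightarrow> norm z \<le> R \<Longrightarrow> norm (F y - F z) \<le> K * norm (y - z)"
      using analytic_map_lipschitz[OF F_analytic, of R] by metis
    have n1: "norm (xh t + p t, \<alpha>\<^sup>2 * \<nu>) \<le> R" for t
      using norm_Pair_le[of "xh t + p t" "\<alpha>\<^sup>2 * \<nu>"] B[of t] \<rho>_nonneg by (simp add: R_def)
    have n2: "norm (xh t, 0::real) \<le> R" for t
      using norm_xh_le[of t] by (simp add: R_def norm_Pair)
    have n3: "norm (0 :: real ^ ('m + 'm), \<alpha>\<^sup>2 * \<nu>) \<le> R" "norm (0 :: (real ^ ('m + 'm)) \<times> real) \<le> R"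
      using \<rho>_nonneg by (simp_all add: R_def norm_Pair)
    have 1: "vanishing (\<lambda>t. F (xh t + p t, \<alpha>\<^sup>2 * \<nu>))"
    proof (rule vanishing_bound[OF q])
      show "norm (F (xh t + p t, \<alpha>\<^sup>2 * \<nu>)) \<le> K * norm (xh t + p t)" for t
        using K(3)[OF n1 n3(1)] F0[OF \<alpha>(2)] by (simp add: norm_Pair)
    qed
    have 2: "vanishing (\<lambda>t. F (xh t, 0))"
    proof (rule vanishing_bound[OF xh_vanishing])
      show "norm (F (xh t, 0)) \<le> K * norm (xh t)" for t
        using K(3)[OF n2 n3(2), of t] F_0 by (simp add: norm_Pair zero_prod_def)
    qed
    have 3: "vanishing (\<lambda>t. frechet_derivative F (at (xh t, 0)) (p t, 0))"
    proof (rule vanishing_bound[OF p])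
      show "norm (frechet_derivative F (at (xh t, 0)) (p t, 0)) \<le> K * norm (p t)" for t
        using K(2)[OF n2, of t "(p t, 0)"] by (simp add: norm_Pair)
    qed
    have "vanishing (\<lambda>t. (1 / \<alpha> ^ 3) *\<^sub>R (F (xh t + p t, \<alpha>\<^sup>2 * \<nu>) - F (xh t, 0)
        - frechet_derivative F (at (xh t, 0)) (p t, 0))
       - (1 / \<alpha>) *\<^sub>R (\<nu> *\<^sub>R DF (xh t, 0) (0, 1) + (1 / 2) *\<^sub>R D2F (xh t) (\<phi>\<^sub>2 t) (\<phi>\<^sub>2 t)))"
      by (intro vanishing_diff vanishing_scaleR 1 2 3 forcing_vanishing')
    moreover have "apply_bcontfun (remainder \<alpha> v) = (\<lambda>t. (1 / \<alpha> ^ 3) *\<^sub>R (F (xh t + p t, \<alpha>\<^sup>2 * \<nu>) - F (xh t, 0)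
        - frechet_derivative F (at (xh t, 0)) (p t, 0))
       - (1 / \<alpha>) *\<^sub>R (\<nu> *\<^sub>R DF (xh t, 0) (0, 1) + (1 / 2) *\<^sub>R D2F (xh t) (\<phi>\<^sub>2 t) (\<phi>\<^sub>2 t)))"
      using \<alpha> \<alpha>0 by (intro ext) (simp add: remainder_apply rescaled_remainder_def p_def DF_def D2F_def add.assoc)
    ultimately show "vanishing (apply_bcontfun (remainder \<alpha> v))" by simp
  qed
qed

text \<open>A non-integrable function has integral 0, so the nonvanishing of
  \<open>a\<^sub>2\<close> and \<open>b\<^sub>2\<close> itself delivers integrability of both
  integrands.\<close>

lemma melnikov_integrals:
  "integrable lborel (\<lambda>t. (symplectic_J *v \<phi>\<^sub>2 t) \<bullet> DF (xh t, 0) (0, 1))"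
  "(LINT t|lborel. (symplectic_J *v \<phi>\<^sub>2 t) \<bullet> DF (xh t, 0) (0, 1)) = - a\<^sub>2"
  "integrable lborel (\<lambda>t. (symplectic_J *v \<phi>\<^sub>2 t) \<bullet> D2F (xh t) (\<phi>\<^sub>2 t) (\<phi>\<^sub>2 t))"
  "(LINT t|lborel. (symplectic_J *v \<phi>\<^sub>2 t) \<bullet> D2F (xh t) (\<phi>\<^sub>2 t) (\<phi>\<^sub>2 t)) = - 2 * b\<^sub>2"
proof -
  show 1: "(LINT t|lborel. (symplectic_J *v \<phi>\<^sub>2 t) \<bullet> DF (xh t, 0) (0, 1)) = - a\<^sub>2"
    using a2 by (simp add: f_parameter_derivative)
  show 2: "(LINT t|lborel. (symplectic_J *v \<phi>\<^sub>2 t) \<bullet> D2F (xh t) (\<phi>\<^sub>2 t) (\<phi>\<^sub>2 t)) = - 2 * b\<^sub>2"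
    using b2 by (simp add: second_derivative_f)
  show "integrable lborel (\<lambda>t. (symplectic_J *v \<phi>\<^sub>2 t) \<bullet> DF (xh t, 0) (0, 1))"
    using 1 a2_nz not_integrable_integral_eq by force
  show "integrable lborel (\<lambda>t. (symplectic_J *v \<phi>\<^sub>2 t) \<bullet> D2F (xh t) (\<phi>\<^sub>2 t) (\<phi>\<^sub>2 t))"
    using 2 b2_nz not_integrable_integral_eq by force
qed

section \<open>The bordered nonlinear equation and its multiplier\<close>

definition \<kappa> :: real where "\<kappa> = weighted_inner P1 P2 / weighted_inner P2 P2"

text \<open>Gram-Schmidt applied to \<open>\<phi>\<^sub>1\<close>, so that
  \<open>\<phi>\<^sub>2\<close>, in terms of which \<open>a\<^sub>2\<close> and
  \<open>b\<^sub>2\<close> are given, stays as it is.\<close>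

definition \<eta> :: "real \<Rightarrow>\<^sub>C (real ^ ('m + 'm))" where "\<eta> = P1 - \<kappa> *\<^sub>R P2"

lemma weighted_inner_P2_pos: "weighted_inner P2 P2 > 0"
proof -
  have "\<exists>t. P2 t \<noteq> 0" using basis_facts(5)[of 0 1] by (auto simp: apply_P2)
  then show ?thesis using weighted_inner_self_pos[of "apply_bcontfun P2"] by auto
qed

lemma weighted_inner_\<eta>:
  "weighted_inner (apply_bcontfun u) \<eta> = weighted_inner (apply_bcontfun u) P1 - \<kappa> * weighted_inner (apply_bcontfun u) P2"
proof -
  interpret bounded_linear "\<lambda>w. weighted_inner (apply_bcontfun u) (apply_bcontfun w)"
    by (rule bounded_linear_weighted_inner) auto
  show ?thesis by (simp only: \<eta>_def diff scaleR real_scaleR_def)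
qed

lemma weighted_inner_sym: "weighted_inner u w = weighted_inner w u"
  by (simp add: weighted_inner_def inner_commute)

lemma \<eta>_orthogonal: "weighted_inner \<eta> P2 = 0"
  using weighted_inner_\<eta>[of P2] weighted_inner_P2_pos weighted_inner_sym[of "apply_bcontfun \<eta>"]
    weighted_inner_sym[of "apply_bcontfun P1" "apply_bcontfun P2"]
  by (simp add: \<kappa>_def)

lemma \<eta>_apply: "\<eta> t = \<phi>\<^sub>1 t - \<kappa> *\<^sub>R \<phi>\<^sub>2 t"
  by (simp add: \<eta>_def apply_P1 apply_P2)

lemma variational_equation:
  obtains b where "degenerate_variational_equation (jacobian (\<lambda>x. f x 0) (at 0)) (\<lambda>t v. DF (xh t, 0) (v, 0)) b
      ((*v) symplectic_J) \<eta> P2"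
proof -
  obtain b where b: "asymptotically_hyperbolic (jacobian (\<lambda>x. f x 0) (at 0)) (\<lambda>t v. DF (xh t, 0) (v, 0)) b"
    using linearization_asymptotically_hyperbolic by blast
  show thesis
  proof (rule that[of b], rule degenerate_variational_equation.intro[OF b],
      rule degenerate_variational_equation_axioms.intro)
    show "linear ((*v) (symplectic_J :: real ^ ('m + 'm) ^ ('m + 'm)))" by simp
    show "(symplectic_J *v u) \<bullet> (symplectic_J *v v) = u \<bullet> v" for u v :: "real ^ ('m + 'm)"
      by (rule symplectic_J_inner)
    show "(symplectic_J *v DF (xh t, 0) (u, 0)) \<bullet> v + (symplectic_J *v u) \<bullet> DF (xh t, 0) (v, 0) = 0" for t u v
      unfolding DF_def by (rule hamiltonian_linearization_adjoint[OF H]) (simp add: F_def[abs_def])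
    show "(apply_bcontfun P2 has_vector_derivative DF (xh t, 0) (P2 t, 0)) (at t)" for t
      unfolding apply_P2 by (rule basis_facts(3))
    show "(apply_bcontfun \<eta> has_vector_derivative DF (xh t, 0) (\<eta> t, 0)) (at t)" for t
    proof -
      have "((\<lambda>t. \<phi>\<^sub>1 t - \<kappa> *\<^sub>R \<phi>\<^sub>2 t) has_vector_derivative
          DF (xh t, 0) (\<phi>\<^sub>1 t, 0) - \<kappa> *\<^sub>R DF (xh t, 0) (\<phi>\<^sub>2 t, 0)) (at t)"
        by (intro has_vector_derivative_diff basis_facts
            bounded_linear.has_vector_derivative[OF bounded_linear_scaleR_right])
      moreover have "apply_bcontfun \<eta> = (\<lambda>t. \<phi>\<^sub>1 t - \<kappa> *\<^sub>R \<phi>\<^sub>2 t)" by (rule ext) (rule \<eta>_apply)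
      moreover have "DF (xh t, 0) (\<phi>\<^sub>1 t, 0) - \<kappa> *\<^sub>R DF (xh t, 0) (\<phi>\<^sub>2 t, 0) = DF (xh t, 0) (\<phi>\<^sub>1 t - \<kappa> *\<^sub>R \<phi>\<^sub>2 t, 0)"
        using linear_diff[OF linear_DF, of "(xh t, 0)" "(\<phi>\<^sub>1 t, 0)" "\<kappa> *\<^sub>R (\<phi>\<^sub>2 t, 0)"] linear_scale[OF linear_DF, of "(xh t, 0)" \<kappa> "(\<phi>\<^sub>2 t, 0)"]
        by simp
      ultimately show ?thesis by (simp only:)
    qed
    show "\<exists>c d. \<forall>t. y t = c *\<^sub>R \<eta> t + d *\<^sub>R P2 t"
      if y: "\<And>t. (y has_vector_derivative DF (xh t, 0) (y t, 0)) (at t)" "bounded (range y)" for y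
    proof -
      obtain c d where "\<And>t. y t = c *\<^sub>R \<phi>\<^sub>1 t + d *\<^sub>R \<phi>\<^sub>2 t" using basis_facts(6)[OF y] by blast
      then have "\<forall>t. y t = c *\<^sub>R \<eta> t + (d + c * \<kappa>) *\<^sub>R P2 t"
        by (simp add: \<eta>_apply apply_P2 algebra_simps)
      then show ?thesis by blast
    qed
    show "\<exists>t. \<eta> t \<noteq> 0" using basis_facts(5)[of 1 "- \<kappa>"] by (auto simp: \<eta>_apply)
    show "\<exists>t. P2 t \<noteq> 0" using basis_facts(5)[of 0 1] by (auto simp: apply_P2)
    show "weighted_inner \<eta> P2 = 0" by (rule \<eta>_orthogonal)
  qed
qed

text \<open>\<open>\<phi>\<^sub>1\<close> and \<open>\<eta>\<close> differ by a multiple of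
  \<open>\<phi>\<^sub>2\<close>, which is orthogonal to \<open>\<eta>\<close>. Since
  \<open>\<phi>\<^sub>1\<close> is the field along \<open>xh\<close>, positivity here is the
  nondegeneracy behind the energy argument.\<close>

lemma weighted_inner_\<phi>1_\<eta>: "weighted_inner \<phi>\<^sub>1 \<eta> > 0"
proof -
  have "\<exists>t. \<eta> t \<noteq> 0" using basis_facts(5)[of 1 "- \<kappa>"] by (auto simp: \<eta>_apply)
  then have "weighted_inner \<eta> \<eta> > 0" using weighted_inner_self_pos[of \<eta>] by auto
  moreover have "weighted_inner \<eta> \<eta> = weighted_inner \<eta> P1"
    unfolding weighted_inner_\<eta> \<eta>_orthogonal by simp
  ultimately show ?thesis using weighted_inner_sym[of \<phi>\<^sub>1 "apply_bcontfun \<eta>"] by (simp add: apply_P1)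
qed

text \<open>Only the multiplier of the first solvability condition is left over here; it cannot be
  removed by adjusting \<open>v\<close>, because \<open>\<phi>\<^sub>1\<close> merely generates time translations.\<close>

lemma bordered_solution:
  "\<exists>r \<alpha>1. \<alpha>1 > 0 \<and> \<alpha>1 \<le> 1 \<and> (\<forall>\<alpha>. \<alpha> \<noteq> 0 \<longrightarrow> \<bar>\<alpha>\<bar> < \<alpha>1 \<longrightarrow> F (0, \<alpha>\<^sup>2 * \<nu>) = 0 \<and>
     (\<exists>(v :: real \<Rightarrow>\<^sub>C (real ^ ('m + 'm))) d. vanishing (apply_bcontfun v) \<and> norm v \<le> r \<and>
       (\<forall>t. ((\<lambda>t. xh t + \<alpha> *\<^sub>R \<phi>\<^sub>2 t + \<alpha>\<^sup>2 *\<^sub>R apply_bcontfun v t) has_vector_derivative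
          F (xh t + \<alpha> *\<^sub>R \<phi>\<^sub>2 t + \<alpha>\<^sup>2 *\<^sub>R apply_bcontfun v t, \<alpha>\<^sup>2 * \<nu>)
            - (d * cauchy_weight t) *\<^sub>R (symplectic_J *v \<eta> t)) (at t))))"
proof -
  obtain b where "degenerate_variational_equation (jacobian (\<lambda>x. f x 0) (at 0)) (\<lambda>t v. DF (xh t, 0) (v, 0)) b
      ((*v) symplectic_J) \<eta> P2"
    using variational_equation by blast
  then interpret V: degenerate_variational_equation "jacobian (\<lambda>x. f x 0) (at 0)" "\<lambda>t v. DF (xh t, 0) (v, 0)" b
      "(*v) symplectic_J" \<eta> P2 .
  show ?thesis
  proof (rule V.fredholm_right_inverse, goal_cases)
    case W: (1 W)
    define l where "l w = weighted_inner P2 (apply_bcontfun w)" for w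
    obtain \<alpha>0 where \<alpha>0: "\<alpha>0 > 0" "\<alpha>0 \<le> 1" "\<And>\<alpha>. \<bar>\<alpha>\<bar> < \<alpha>0 \<Longrightarrow> F (0, \<alpha>\<^sup>2 * \<nu>) = 0"
      "\<And>\<alpha> v. \<alpha> \<noteq> 0 \<Longrightarrow> \<bar>\<alpha>\<bar> < \<alpha>0 \<Longrightarrow> vanishing (apply_bcontfun v) \<Longrightarrow> vanishing (apply_bcontfun (remainder \<alpha> v))"
      using remainder_vanishing by metis
    obtain C where C: "\<And>\<alpha>. \<alpha> \<noteq> 0 \<Longrightarrow> \<bar>\<alpha>\<bar> \<le> 1 \<Longrightarrow> norm (remainder \<alpha> 0) \<le> C"
      using remainder_zero_bound by metis
    define U where "U = {v :: real \<Rightarrow>\<^sub>C (real ^ ('m + 'm)). vanishing (apply_bcontfun v)}"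
    have subU: "subspace U"
    proof (rule subspaceI)
      show "0 \<in> U" by (simp add: U_def vanishing_def zero_bcontfun.rep_eq[abs_def])
      show "x + y \<in> U" if "x \<in> U" "y \<in> U" for x y
        using vanishing_add that by (simp add: U_def plus_bcontfun.rep_eq[abs_def])
      show "c *\<^sub>R x \<in> U" if "x \<in> U" for c x
        using vanishing_scaleR that by (simp add: U_def scaleR_bcontfun.rep_eq[abs_def])
    qed
    have forcing_van: "vanishing (apply_bcontfun forcing)"
      unfolding forcing_apply by (rule forcing_vanishing')
    have lin_split: "(symplectic_J *v P2 t) \<bullet> forcing t =
        \<nu> * ((symplectic_J *v \<phi>\<^sub>2 t) \<bullet> DF (xh t, 0) (0, 1))
        + (1 / 2) * ((symplectic_J *v \<phi>\<^sub>2 t) \<bullet> D2F (xh t) (\<phi>\<^sub>2 t) (\<phi>\<^sub>2 t))" for t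
      by (simp add: forcing_apply apply_P2 inner_add_right)
    \<comment> \<open>The lowest-order solvability condition: the two Melnikov integrals combine to
      \<open>- \<nu> a\<^sub>2 - b\<^sub>2\<close>.\<close>
    have lg: "l (W forcing) = 0"
    proof -
      have "integrable lborel (\<lambda>t. (symplectic_J *v P2 t) \<bullet> forcing t)"
        unfolding lin_split using melnikov_integrals(1,3) by simp
      from W(4)[OF forcing_van this] have "l (W forcing) * weighted_inner P2 P2 = \<nu> * (- a\<^sub>2) + (1 / 2) * (- 2 * b\<^sub>2)"
        unfolding lin_split l_def using melnikov_integrals by simp
      also have "\<dots> = 0" using a2_nz by (simp add: \<nu>_def)
      finally show ?thesis using weighted_inner_P2_pos by simp
    qed
    \<comment> \<open>The same quadratic integral without the factor 1/2, that is,
      \<open>- 2 b\<^sub>2\<close>.\<close>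
    have lh: "l (W (hessian_operator P2)) \<noteq> 0"
    proof -
      have "vanishing (apply_bcontfun (hessian_operator P2))"
        using D2F_vanishing[of P2] by (simp add: hessian_operator_apply[abs_def])
      from W(4)[OF this] have "l (W (hessian_operator P2)) * weighted_inner P2 P2 = - 2 * b\<^sub>2"
        unfolding l_def using melnikov_integrals(3,4) by (simp add: hessian_operator_apply apply_P2)
      then show ?thesis using b2_nz by auto
    qed
    have "\<exists>r \<alpha>1. \<alpha>1 > 0 \<and> (\<forall>\<alpha>. \<alpha> \<noteq> 0 \<longrightarrow> \<bar>\<alpha>\<bar> < \<alpha>1 \<longrightarrow> (\<exists>v\<in>U. norm v \<le> r \<and>
        l (W (forcing + \<alpha> *\<^sub>R remainder \<alpha> v)) = 0 \<and> (\<exists>c. v = W (forcing + \<alpha> *\<^sub>R remainder \<alpha> v) + c *\<^sub>R P2)))"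
    proof (rule lyapunov_schmidt_fixed_point[OF W(1) bounded_linear_hessian_operator])
      show "bounded_linear l" unfolding l_def by (rule bounded_linear_weighted_inner) auto
      show "closed U" unfolding U_def by (rule closed_vanishing)
      show "subspace U" by (rule subU)
      show "forcing \<in> U" using forcing_van by (simp add: U_def)
      show "P2 \<in> U" using \<phi>2_vanishing by (simp add: U_def apply_P2)
      show "W v \<in> U" if "v \<in> U" for v using W(3) that by (simp add: U_def)
      show "\<alpha>0 > 0" by (rule \<alpha>0(1))
      show "remainder \<alpha> v \<in> U" if "\<alpha> \<noteq> 0" "\<bar>\<alpha>\<bar> < \<alpha>0" "v \<in> U" for \<alpha> v using \<alpha>0(4) that by (simp add: U_def)
      show "l (W forcing) = 0" by (rule lg)
      show "l (W (hessian_operator P2)) \<noteq> 0" by (rule lh)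
      show "norm (remainder \<alpha> 0) \<le> C" if "\<alpha> \<noteq> 0" "\<bar>\<alpha>\<bar> < \<alpha>0" for \<alpha> using C that \<alpha>0(2) by simp
      show "\<exists>L\<ge>0. \<forall>\<alpha> v v'. \<alpha> \<noteq> 0 \<longrightarrow> \<bar>\<alpha>\<bar> < \<alpha>0 \<longrightarrow> norm v \<le> r \<longrightarrow> norm v' \<le> r \<longrightarrow>
         norm ((remainder \<alpha> v - hessian_operator v) - (remainder \<alpha> v' - hessian_operator v')) \<le> L * \<bar>\<alpha>\<bar> * norm (v - v')" for r
      proof -
        obtain L where L: "L \<ge> 0" "\<And>\<alpha> v v'. \<alpha> \<noteq> 0 \<Longrightarrow> \<bar>\<alpha>\<bar> \<le> 1 \<Longrightarrow> norm v \<le> r \<Longrightarrow> norm v' \<le> r \<Longrightarrow>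
           norm ((remainder \<alpha> v - hessian_operator v) - (remainder \<alpha> v' - hessian_operator v')) \<le> L * \<bar>\<alpha>\<bar> * norm (v - v')"
          using remainder_lipschitz[of r] by metis
        show ?thesis using \<alpha>0(2) by (intro exI[of _ L] conjI allI impI L) simp_all
      qed
    qed
    then obtain r \<alpha>1 where \<alpha>1: "\<alpha>1 > 0"
      and sol: "\<And>\<alpha>. \<alpha> \<noteq> 0 \<Longrightarrow> \<bar>\<alpha>\<bar> < \<alpha>1 \<Longrightarrow> \<exists>v\<in>U. norm v \<le> r \<and>
        l (W (forcing + \<alpha> *\<^sub>R remainder \<alpha> v)) = 0 \<and> (\<exists>c. v = W (forcing + \<alpha> *\<^sub>R remainder \<alpha> v) + c *\<^sub>R P2)"
      by blast
    have main: "\<exists>(v :: real \<Rightarrow>\<^sub>C (real ^ ('m + 'm))) d. vanishing (apply_bcontfun v) \<and> norm v \<le> r \<and>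
         (\<forall>t. ((\<lambda>t. xh t + \<alpha> *\<^sub>R \<phi>\<^sub>2 t + \<alpha>\<^sup>2 *\<^sub>R apply_bcontfun v t) has_vector_derivative
            F (xh t + \<alpha> *\<^sub>R \<phi>\<^sub>2 t + \<alpha>\<^sup>2 *\<^sub>R apply_bcontfun v t, \<alpha>\<^sup>2 * \<nu>)
              - (d * cauchy_weight t) *\<^sub>R (symplectic_J *v \<eta> t)) (at t))"
      if \<alpha>: "\<alpha> \<noteq> 0" "\<bar>\<alpha>\<bar> < min \<alpha>0 \<alpha>1" for \<alpha>
    proof -
      have \<alpha>le: "\<bar>\<alpha>\<bar> \<le> 1" using \<alpha> \<alpha>0(2) by simp
      obtain v c where v: "v \<in> U" "norm v \<le> r" "l (W (forcing + \<alpha> *\<^sub>R remainder \<alpha> v)) = 0"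
        "v = W (forcing + \<alpha> *\<^sub>R remainder \<alpha> v) + c *\<^sub>R P2"
        using sol[OF \<alpha>(1)] \<alpha>(2) by auto
      define w where "w = W (forcing + \<alpha> *\<^sub>R remainder \<alpha> v)"
      \<comment> \<open>The correction enters the orbit as \<open>\<alpha>\<^sup>2 v\<close>, so the
        multiplier of its equation is scaled by \<open>\<alpha>\<^sup>2\<close>. The multiplier
        belonging to \<open>P2\<close> is already 0 by \<open>v(3)\<close>.\<close>
      define d where "d = \<alpha>\<^sup>2 * weighted_inner \<eta> w"
      have "((\<lambda>t. xh t + \<alpha> *\<^sub>R \<phi>\<^sub>2 t + \<alpha>\<^sup>2 *\<^sub>R apply_bcontfun v t) has_vector_derivative
            F (xh t + \<alpha> *\<^sub>R \<phi>\<^sub>2 t + \<alpha>\<^sup>2 *\<^sub>R apply_bcontfun v t, \<alpha>\<^sup>2 * \<nu>)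
              - (d * cauchy_weight t) *\<^sub>R (symplectic_J *v \<eta> t)) (at t)" for t
      proof -
        let ?A = "\<lambda>u. DF (xh t, 0) (u, 0)"
        let ?Y = "F (xh t + \<alpha> *\<^sub>R \<phi>\<^sub>2 t + \<alpha>\<^sup>2 *\<^sub>R v t, \<alpha>\<^sup>2 * \<nu>) - F (xh t, 0) - ?A (\<alpha> *\<^sub>R \<phi>\<^sub>2 t + \<alpha>\<^sup>2 *\<^sub>R v t)"
        have linA: "linear ?A" by (rule V.A_linear)
        have w': "(apply_bcontfun w has_vector_derivative ?A (w t) + (forcing t + \<alpha> *\<^sub>R remainder \<alpha> v t
            - weighted_inner \<eta> w *\<^sub>R V.weighted_J \<eta> t)) (at t)"
          using W(2)[of "forcing + \<alpha> *\<^sub>R remainder \<alpha> v" t] v(3) unfolding w_def[symmetric] l_def by simp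
        have vw: "apply_bcontfun v = (\<lambda>t. w t + c *\<^sub>R \<phi>\<^sub>2 t)"
        proof
          have "v = w + c *\<^sub>R P2" unfolding w_def by (rule v(4))
          from arg_cong[OF this, of apply_bcontfun] show "apply_bcontfun v t = w t + c *\<^sub>R \<phi>\<^sub>2 t" for t
            by (simp add: apply_P2)
        qed
        have "((\<lambda>t. w t + c *\<^sub>R \<phi>\<^sub>2 t) has_vector_derivative ?A (w t) + (forcing t + \<alpha> *\<^sub>R remainder \<alpha> v t
            - weighted_inner \<eta> w *\<^sub>R V.weighted_J \<eta> t) + c *\<^sub>R ?A (\<phi>\<^sub>2 t)) (at t)"
          by (intro has_vector_derivative_add w' bounded_linear.has_vector_derivative[OF bounded_linear_scaleR_right] basis_facts(3))
        moreover have "?A (v t) = ?A (w t) + c *\<^sub>R ?A (\<phi>\<^sub>2 t)"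
          unfolding vw linear_add[OF linA] linear_scale[OF linA] ..
        ultimately have v': "(apply_bcontfun v has_vector_derivative ?A (v t) + (forcing t + \<alpha> *\<^sub>R remainder \<alpha> v t
            - weighted_inner \<eta> w *\<^sub>R V.weighted_J \<eta> t)) (at t)"
          by (simp add: vw add_ac)
        have "((\<lambda>t. xh t + \<alpha> *\<^sub>R \<phi>\<^sub>2 t + \<alpha>\<^sup>2 *\<^sub>R v t) has_vector_derivative
            F (xh t, 0) + \<alpha> *\<^sub>R ?A (\<phi>\<^sub>2 t) + \<alpha>\<^sup>2 *\<^sub>R (?A (v t) + (forcing t + \<alpha> *\<^sub>R remainder \<alpha> v t
            - weighted_inner \<eta> w *\<^sub>R V.weighted_J \<eta> t))) (at t)"
          by (intro has_vector_derivative_add xh_derivative v' basis_facts(3)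
              bounded_linear.has_vector_derivative[OF bounded_linear_scaleR_right])
        \<comment> \<open>An exact identity, since the remainder was defined by solving it for
          \<open>S\<close>; no smallness is involved.\<close>
        moreover have "\<alpha>\<^sup>2 *\<^sub>R (forcing t + \<alpha> *\<^sub>R remainder \<alpha> v t) = ?Y"
        proof -
          have "remainder \<alpha> v t = (1 / \<alpha> ^ 3) *\<^sub>R ?Y - (1 / \<alpha>) *\<^sub>R forcing t"
            by (simp add: remainder_apply[OF \<alpha>(1) \<alpha>le] rescaled_remainder_def forcing_apply DF_def D2F_def)
          then have "\<alpha>\<^sup>2 *\<^sub>R (forcing t + \<alpha> *\<^sub>R remainder \<alpha> v t) =
              \<alpha>\<^sup>2 *\<^sub>R (forcing t + ((\<alpha> * (1 / \<alpha> ^ 3)) *\<^sub>R ?Y - (\<alpha> * (1 / \<alpha>)) *\<^sub>R forcing t))"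
            by (simp only: scaleR_diff_right scaleR_scaleR)
          also have "\<dots> = (\<alpha>\<^sup>2 * (\<alpha> * (1 / \<alpha> ^ 3))) *\<^sub>R ?Y" using \<alpha>(1) by simp
          also have "\<alpha>\<^sup>2 * (\<alpha> * (1 / \<alpha> ^ 3)) = 1" using \<alpha>(1) by (simp add: power3_eq_cube power2_eq_square)
          finally show ?thesis by simp
        qed
        moreover have "?A (\<alpha> *\<^sub>R \<phi>\<^sub>2 t + \<alpha>\<^sup>2 *\<^sub>R v t) = \<alpha> *\<^sub>R ?A (\<phi>\<^sub>2 t) + \<alpha>\<^sup>2 *\<^sub>R ?A (v t)"
          unfolding linear_add[OF linA] linear_scale[OF linA] ..
        moreover have "(d * cauchy_weight t) *\<^sub>R (symplectic_J *v \<eta> t) = \<alpha>\<^sup>2 *\<^sub>R (weighted_inner \<eta> w *\<^sub>R V.weighted_J \<eta> t)"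
          by (simp add: d_def V.weighted_J_apply)
        ultimately show ?thesis
          by (simp only: scaleR_add_right scaleR_diff_right) (simp add: algebra_simps)
      qed
      then show ?thesis using v(1,2) unfolding U_def by blast
    qed
    have "\<forall>\<alpha>. \<alpha> \<noteq> 0 \<longrightarrow> \<bar>\<alpha>\<bar> < min \<alpha>0 \<alpha>1 \<longrightarrow> F (0, \<alpha>\<^sup>2 * \<nu>) = 0"
      using \<alpha>0(3) by simp
    with main show ?case
      by (intro exI[of _ r] exI[of _ "min \<alpha>0 \<alpha>1"] conjI[of "min \<alpha>0 \<alpha>1 > 0"] conjI[of "min \<alpha>0 \<alpha>1 \<le> 1"])
        (use \<alpha>0(1,2) \<alpha>1 in simp_all)
  qed
qed

lemma spatial_gradient_F: "F z = symplectic_J *v spatial_gradient H z"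
  by (simp add: F_def hamiltonian_field_eq[OF H])

text \<open>Along a solution of the bordered equation \<open>x' = F(x, \<mu>) - d \<rho> J \<eta>\<close> the energy changes at
  the rate \<open>d \<rho> \<langle>F(x, \<mu>), \<eta>\<rangle>\<close>, but it has the same limit at both ends.\<close>

lemma multiplier_zero:
  fixes x :: "real \<Rightarrow> real ^ ('m + 'm)"
  assumes x: "\<And>t. (x has_vector_derivative F (x t, \<mu>) - (d * cauchy_weight t) *\<^sub>R (symplectic_J *v \<eta> t)) (at t)"
    and van: "vanishing x" and nz: "weighted_inner (\<lambda>t. F (x t, \<mu>)) \<eta> \<noteq> 0"
  shows "d = 0"
proof -
  have xc: "continuous_on UNIV x"
    using x has_vector_derivative_continuous continuous_at_imp_continuous_on by blast
  have Fc: "continuous_on UNIV (\<lambda>t. F (x t, \<mu>))"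
    by (intro analytic_map_continuous_on[OF F_analytic] continuous_on_Pair xc continuous_on_const)
  define k where "k t = d * (cauchy_weight t * (F (x t, \<mu>) \<bullet> \<eta> t))" for t
  have Fb: "bounded (range (\<lambda>t. F (x t, \<mu>)))"
  proof -
    obtain B where B: "\<And>t. norm (x t) \<le> B"
      using vanishing_continuous_bounded[OF xc van] unfolding bounded_iff by auto
    have B0: "B \<ge> 0" using order_trans[OF norm_ge_zero B] .
    obtain K where K: "\<And>y z. norm y \<le> B + \<bar>\<mu>\<bar> \<Longrightarrow> norm z \<le> B + \<bar>\<mu>\<bar> \<Longrightarrow> norm (F y - F z) \<le> K * norm (y - z)" "K \<ge> 0"
      using analytic_map_lipschitz[OF F_analytic, of "B + \<bar>\<mu>\<bar>"] by metis
    have "norm (F (x t, \<mu>)) \<le> K * (B + \<bar>\<mu>\<bar>)" for t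
    proof -
      have n: "norm (x t, \<mu>) \<le> B + \<bar>\<mu>\<bar>" using norm_Pair_le[of "x t" \<mu>] B[of t] by simp
      have "norm (F (x t, \<mu>) - F (0, 0)) \<le> K * norm ((x t, \<mu>) - (0, 0))"
        using n B0 by (intro K(1)) (auto simp: norm_Pair)
      also have "\<dots> \<le> K * (B + \<bar>\<mu>\<bar>)" using n K(2) by (intro mult_left_mono) auto
      finally show ?thesis by (simp add: F_0)
    qed
    then show ?thesis unfolding bounded_iff by blast
  qed
  have int: "integrable lborel (\<lambda>t. cauchy_weight t * (F (x t, \<mu>) \<bullet> \<eta> t))"
    by (rule weighted_inner_integrable[OF Fc Fb]) auto
  have "(LINT t|lborel. k t) = 0"
  proof (rule integral_derivative_vanishing[of "\<lambda>t. H (x t, \<mu>) - H (0, \<mu>)"])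
    show "integrable lborel k" unfolding k_def using int by simp
    show "continuous_on UNIV k" unfolding k_def
      by (intro continuous_intros Fc continuous_cauchy_weight) auto
    show "((\<lambda>t. H (x t, \<mu>) - H (0, \<mu>)) has_vector_derivative k t) (at t)" for t
    proof -
      let ?x' = "F (x t, \<mu>) - (d * cauchy_weight t) *\<^sub>R (symplectic_J *v \<eta> t)"
      have "((\<lambda>t. (x t, \<mu>)) has_derivative (\<lambda>h. (h *\<^sub>R ?x', 0))) (at t)"
        using x[of t] unfolding has_vector_derivative_def by (intro has_derivative_Pair) auto
      moreover have "(H has_derivative frechet_derivative H (at (x t, \<mu>))) (at (x t, \<mu>))"
        using real_analytic_differentiable[OF H] frechet_derivative_works by blast
      ultimately have "((\<lambda>t. H (x t, \<mu>)) has_derivative (\<lambda>h. frechet_derivative H (at (x t, \<mu>)) (h *\<^sub>R ?x', 0))) (at t)"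
        by (rule has_derivative_compose)
      then have "((\<lambda>t. H (x t, \<mu>)) has_derivative (\<lambda>h. h *\<^sub>R (spatial_gradient H (x t, \<mu>) \<bullet> ?x'))) (at t)"
        by (simp only: spatial_gradient_inner[OF H] inner_scaleR_right real_scaleR_def)
      then have "((\<lambda>t. H (x t, \<mu>) - H (0, \<mu>)) has_vector_derivative spatial_gradient H (x t, \<mu>) \<bullet> ?x' - 0) (at t)"
        unfolding has_vector_derivative_def[symmetric]
        by (intro has_vector_derivative_diff has_vector_derivative_const)
      \<comment> \<open>The Hamiltonian part drops out because \<open>J\<close> times the gradient
        is orthogonal to the gradient. In the multiplier term, skew symmetry moves \<open>J\<close>
        from \<open>\<eta>\<close> to the gradient, which recovers \<open>F\<close>.\<close>
      moreover have "spatial_gradient H (x t, \<mu>) \<bullet> ?x' = k t"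
        unfolding inner_diff_right spatial_gradient_F symplectic_J_self k_def
        using symplectic_J_skew[of "spatial_gradient H (x t, \<mu>)" "\<eta> t"] by simp
      ultimately show ?thesis by simp
    qed
    have "((\<lambda>t. H (x t, \<mu>)) \<longlongrightarrow> H (0, \<mu>)) at_infinity"
    proof (rule tendsto_compose[where f = x and g = "\<lambda>y. H (y, \<mu>)", unfolded o_def])
      show "(x \<longlongrightarrow> 0) at_infinity" using van by (simp add: vanishing_def)
      have "continuous_on UNIV (\<lambda>y. H (y, \<mu>))"
        by (intro continuous_on_compose2[OF real_analytic_continuous_on[OF H, of UNIV]] continuous_intros) auto
      then show "((\<lambda>y. H (y, \<mu>)) \<longlongrightarrow> H (0, \<mu>)) (at 0)" by (simp add: continuous_on_def)
    qed
    then show "((\<lambda>t. H (x t, \<mu>) - H (0, \<mu>)) \<longlongrightarrow> 0) at_infinity" by (rule LIM_zero)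
  qed
  then have "d * weighted_inner (\<lambda>t. F (x t, \<mu>)) \<eta> = 0"
    unfolding k_def weighted_inner_def by simp
  then show ?thesis using nz by simp
qed

text \<open>For small \<open>\<alpha>\<close> the field along the new curve is within order
  \<open>\<alpha>\<close> of \<open>\<phi>\<^sub>1\<close>. Its pairing with \<open>\<eta>\<close>
  therefore stays positive, the multiplier is 0, and the bordered solution is a genuine
  orbit.\<close>

lemma homoclinic_branch:
  "\<exists>r \<alpha>1. \<alpha>1 > 0 \<and> (\<forall>\<alpha>. \<alpha> \<noteq> 0 \<longrightarrow> \<bar>\<alpha>\<bar> < \<alpha>1 \<longrightarrow>
     (\<exists>v. (\<forall>t. norm (v t) \<le> r) \<and>
       homoclinic_orbit (\<lambda>y. f y (\<nu> * \<alpha>\<^sup>2)) 0 (\<lambda>t. xh t + \<alpha> *\<^sub>R \<phi>\<^sub>2 t + \<alpha>\<^sup>2 *\<^sub>R v t)))"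
proof -
  obtain r \<alpha>0 where \<alpha>0: "\<alpha>0 > 0" "\<alpha>0 \<le> 1" 
    and sol: "\<And>\<alpha>. \<alpha> \<noteq> 0 \<Longrightarrow> \<bar>\<alpha>\<bar> < \<alpha>0 \<Longrightarrow> \<exists>(v :: real \<Rightarrow>\<^sub>C (real ^ ('m + 'm))) d.
       vanishing (apply_bcontfun v) \<and> norm v \<le> r \<and>
       (\<forall>t. ((\<lambda>t. xh t + \<alpha> *\<^sub>R \<phi>\<^sub>2 t + \<alpha>\<^sup>2 *\<^sub>R apply_bcontfun v t) has_vector_derivative
          F (xh t + \<alpha> *\<^sub>R \<phi>\<^sub>2 t + \<alpha>\<^sup>2 *\<^sub>R apply_bcontfun v t, \<alpha>\<^sup>2 * \<nu>)
            - (d * cauchy_weight t) *\<^sub>R (symplectic_J *v \<eta> t)) (at t))"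
    using bordered_solution by blast
  \<comment> \<open>The distance between the new orbit with its parameter and \<open>xh\<close> with
    parameter 0 is at most \<open>\<bar>\<alpha>\<bar> * c\<close>, so both stay in the ball of
    radius \<open>\<rho> + c\<close>.\<close>
  define c where "c = \<rho> + \<bar>r\<bar> + \<bar>\<nu>\<bar>"
  have c0: "c \<ge> 0" using \<rho>_nonneg by (simp add: c_def)
  obtain K where K: "K \<ge> 0" "\<And>y z. norm y \<le> \<rho> + c \<Longrightarrow> norm z \<le> \<rho> + c \<Longrightarrow> norm (F y - F z) \<le> K * norm (y - z)"
    using analytic_map_lipschitz[OF F_analytic, of "\<rho> + c"] by metis
  define Q where "Q = K * c * norm \<eta> * (LINT t|lborel. cauchy_weight t)"
  have I0: "(LINT t|lborel. cauchy_weight t) \<ge> 0"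
    using cauchy_weight_pos by (intro integral_nonneg_AE) (auto intro: less_imp_le)
  have Q0: "Q \<ge> 0" using K(1) c0 I0 by (simp add: Q_def)
  obtain t0 where t0: "xh t0 \<noteq> 0" using M2 by (auto simp: homoclinic_orbit_def)
  \<comment> \<open>The second entry keeps the perturbation of the pairing below its value for
    \<open>xh\<close>; the third keeps the orbit away from 0 at \<open>t0\<close>, so that it is not
    the equilibrium.\<close>
  define \<alpha>1 where "\<alpha>1 = min \<alpha>0 (min (weighted_inner \<phi>\<^sub>1 \<eta> / (Q + 1)) (norm (xh t0) / (c + 1)))"
  have \<alpha>1: "\<alpha>1 > 0" using \<alpha>0 weighted_inner_\<phi>1_\<eta> Q0 c0 t0 by (simp add: \<alpha>1_def)
  have "\<exists>v. (\<forall>t. norm (v t) \<le> r) \<and>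
       homoclinic_orbit (\<lambda>y. f y (\<nu> * \<alpha>\<^sup>2)) 0 (\<lambda>t. xh t + \<alpha> *\<^sub>R \<phi>\<^sub>2 t + \<alpha>\<^sup>2 *\<^sub>R v t)"
    if \<alpha>: "\<alpha> \<noteq> 0" "\<bar>\<alpha>\<bar> < \<alpha>1" for \<alpha>
  proof -
    have a0: "\<bar>\<alpha>\<bar> < \<alpha>0" and aQ: "\<bar>\<alpha>\<bar> < weighted_inner \<phi>\<^sub>1 \<eta> / (Q + 1)" and ac: "\<bar>\<alpha>\<bar> < norm (xh t0) / (c + 1)"
      using \<alpha>(2) by (auto simp: \<alpha>1_def)
    have a1: "\<bar>\<alpha>\<bar> \<le> 1" using a0 \<alpha>0(2) by simp
    have sq: "\<alpha>\<^sup>2 \<le> \<bar>\<alpha>\<bar>" using mult_left_le[OF a1, of "\<bar>\<alpha>\<bar>"] by (simp add: power2_eq_square flip: abs_mult)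
    obtain v :: "real \<Rightarrow>\<^sub>C (real ^ ('m + 'm))" and d where v: "vanishing (apply_bcontfun v)" "norm v \<le> r"
      "\<And>t. ((\<lambda>t. xh t + \<alpha> *\<^sub>R \<phi>\<^sub>2 t + \<alpha>\<^sup>2 *\<^sub>R apply_bcontfun v t) has_vector_derivative
          F (xh t + \<alpha> *\<^sub>R \<phi>\<^sub>2 t + \<alpha>\<^sup>2 *\<^sub>R apply_bcontfun v t, \<alpha>\<^sup>2 * \<nu>)
            - (d * cauchy_weight t) *\<^sub>R (symplectic_J *v \<eta> t)) (at t)"
      using sol[OF \<alpha>(1) a0] by blast
    define x where "x t = xh t + \<alpha> *\<^sub>R \<phi>\<^sub>2 t + \<alpha>\<^sup>2 *\<^sub>R apply_bcontfun v t" for t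
    have vr: "norm (v t) \<le> \<bar>r\<bar>" for t using norm_bounded[of v t] v(2) by simp
    have dx: "norm (x t - xh t) \<le> \<bar>\<alpha>\<bar> * (\<rho> + \<bar>r\<bar>)" for t
    proof -
      have "norm (x t - xh t) \<le> norm (\<alpha> *\<^sub>R \<phi>\<^sub>2 t) + norm (\<alpha>\<^sup>2 *\<^sub>R v t)"
        using norm_triangle_ineq[of "\<alpha> *\<^sub>R \<phi>\<^sub>2 t" "\<alpha>\<^sup>2 *\<^sub>R v t"] by (simp add: x_def)
      also have "\<dots> \<le> \<bar>\<alpha>\<bar> * \<rho> + \<bar>\<alpha>\<bar> * \<bar>r\<bar>"
        using norm_\<phi>2_le[of t] vr[of t] sq by (intro add_mono) (auto intro!: mult_mono)
      finally show ?thesis by (simp add: distrib_left)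
    qed
    have dz: "norm ((x t, \<alpha>\<^sup>2 * \<nu>) - (xh t, 0)) \<le> \<bar>\<alpha>\<bar> * c" for t
    proof -
      have "norm ((x t, \<alpha>\<^sup>2 * \<nu>) - (xh t, 0)) \<le> norm (x t - xh t) + \<alpha>\<^sup>2 * \<bar>\<nu>\<bar>"
        using norm_Pair_le[of "x t - xh t" "\<alpha>\<^sup>2 * \<nu>"] by (simp add: abs_mult)
      also have "\<dots> \<le> \<bar>\<alpha>\<bar> * (\<rho> + \<bar>r\<bar>) + \<bar>\<alpha>\<bar> * \<bar>\<nu>\<bar>"
        using dx[of t] sq by (intro add_mono mult_right_mono) auto
      finally show ?thesis by (simp add: c_def distrib_left)
    qed
    have dzc: "norm ((x t, \<alpha>\<^sup>2 * \<nu>) - (xh t, 0)) \<le> c" for t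
      using dz[of t] mult_right_mono[OF a1 c0] by linarith
    have nxh: "norm (xh t, 0::real) \<le> \<rho> + c" for t using norm_xh_le[of t] c0 by (simp add: norm_Pair)
    have nx: "norm (x t, \<alpha>\<^sup>2 * \<nu>) \<le> \<rho> + c" for t
      using norm_triangle_ineq[of "(xh t, 0)" "(x t, \<alpha>\<^sup>2 * \<nu>) - (xh t, 0)"] dzc[of t] norm_xh_le[of t]
      by (simp add: norm_Pair[of "xh t" 0])
    have dF: "norm (F (x t, \<alpha>\<^sup>2 * \<nu>) - F (xh t, 0)) \<le> K * (\<bar>\<alpha>\<bar> * c)" for t
      using order_trans[OF K(2)[OF nx[of t] nxh[of t]] mult_left_mono[OF dz[of t] K(1)]] .
    have xc: "continuous_on UNIV x" unfolding x_def
      by (intro continuous_intros xh_continuous continuous_\<phi>2) auto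
    have xvan: "vanishing x" unfolding x_def
      by (intro vanishing_add vanishing_scaleR xh_vanishing \<phi>2_vanishing v(1))
    have Fc: "continuous_on UNIV (\<lambda>t. F (x t, \<alpha>\<^sup>2 * \<nu>))"
      by (intro analytic_map_continuous_on[OF F_analytic] continuous_on_Pair xc continuous_on_const)
    have "weighted_inner (\<lambda>t. F (x t, \<alpha>\<^sup>2 * \<nu>)) \<eta> \<noteq> 0"
    proof -
      define g where "g t = (F (x t, \<alpha>\<^sup>2 * \<nu>) - \<phi>\<^sub>1 t) \<bullet> \<eta> t" for t
      have gc: "continuous_on UNIV g" unfolding g_def
        using continuous_on_apply_bcontfun[of UNIV P1] by (intro continuous_intros Fc) (auto simp: apply_P1)
      have gb: "\<bar>g t\<bar> \<le> K * (\<bar>\<alpha>\<bar> * c) * norm \<eta>" for t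
        unfolding g_def using dF[of t] \<phi>1_eq[of t] K(1) c0
        by (intro order_trans[OF Cauchy_Schwarz_ineq2] mult_mono norm_bounded) auto
      have int1: "integrable lborel (\<lambda>t. cauchy_weight t * (\<phi>\<^sub>1 t \<bullet> \<eta> t))"
        by (intro weighted_inner_integrable basis_facts(2) continuous_on_apply_bcontfun[of UNIV P1, unfolded apply_P1])
          auto
      note gi = cauchy_weight_integral_bound[OF gc gb]
      have "weighted_inner (\<lambda>t. F (x t, \<alpha>\<^sup>2 * \<nu>)) \<eta> =
          (LINT t|lborel. cauchy_weight t * (\<phi>\<^sub>1 t \<bullet> \<eta> t) + cauchy_weight t * g t)"
        unfolding weighted_inner_def by (rule Bochner_Integration.integral_cong) (simp_all add: g_def inner_diff_left algebra_simps)
      also have "\<dots> = weighted_inner \<phi>\<^sub>1 \<eta> + (LINT t|lborel. cauchy_weight t * g t)"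
        unfolding weighted_inner_def by (rule Bochner_Integration.integral_add[OF int1 gi(1)])
      finally have eq: "weighted_inner (\<lambda>t. F (x t, \<alpha>\<^sup>2 * \<nu>)) \<eta> = weighted_inner \<phi>\<^sub>1 \<eta> + (LINT t|lborel. cauchy_weight t * g t)" .
      have "\<bar>LINT t|lborel. cauchy_weight t * g t\<bar> \<le> \<bar>\<alpha>\<bar> * Q"
        using gi(2) by (simp add: Q_def mult_ac)
      also have "\<bar>\<alpha>\<bar> * Q \<le> \<bar>\<alpha>\<bar> * (Q + 1)" by (simp add: distrib_left)
      also have "\<dots> < weighted_inner \<phi>\<^sub>1 \<eta>" using aQ Q0 by (simp add: pos_less_divide_eq)
      finally show ?thesis unfolding eq by linarith
    qed
    moreover have "(x has_vector_derivative F (x t, \<alpha>\<^sup>2 * \<nu>) - (d * cauchy_weight t) *\<^sub>R (symplectic_J *v \<eta> t)) (at t)" for t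
      using v(3)[of t] unfolding x_def[abs_def] .
    ultimately have d0: "d = 0" using multiplier_zero[of x "\<alpha>\<^sup>2 * \<nu>" d] xvan by blast
    have "homoclinic_orbit (\<lambda>y. f y (\<nu> * \<alpha>\<^sup>2)) 0 x"
      unfolding homoclinic_orbit_def
    proof (intro conjI allI)
      show "(x has_vector_derivative f (x t) (\<nu> * \<alpha>\<^sup>2)) (at t)" for t
        using v(3)[of t] unfolding d0 f_eq_F x_def[abs_def] by (simp add: mult.commute)
      show "(x \<longlongrightarrow> 0) at_top" "(x \<longlongrightarrow> 0) at_bot"
        using xvan at_top_le_at_infinity at_bot_le_at_infinity unfolding vanishing_def by (auto intro: tendsto_mono)
      have "\<bar>\<alpha>\<bar> * (\<rho> + \<bar>r\<bar>) \<le> \<bar>\<alpha>\<bar> * (c + 1)" by (intro mult_left_mono) (auto simp: c_def)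
      also have "\<dots> < norm (xh t0)" using ac c0 by (simp add: pos_less_divide_eq)
      finally have "x t0 \<noteq> 0" using dx[of t0] by auto
      then show "\<exists>t. x t \<noteq> 0" by blast
    qed
    moreover have "\<forall>t. norm (v t) \<le> r" using norm_bounded v(2) order_trans by blast
    ultimately show ?thesis unfolding x_def[abs_def] by blast
  qed
  with \<alpha>1 show ?thesis by blast
qed

section \<open>The parabola of parameters and the bifurcation statement\<close>

lemma deriv_square: "deriv (\<lambda>\<alpha>. \<nu> * \<alpha>\<^sup>2) = (\<lambda>\<alpha>. 2 * \<nu> * \<alpha>)"
proof
  show "deriv (\<lambda>\<alpha>. \<nu> * \<alpha>\<^sup>2) x = 2 * \<nu> * x" for x
    by (rule DERIV_imp_deriv) (rule derivative_eq_intros refl | simp)+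
qed

lemma deriv_deriv_square: "deriv (deriv (\<lambda>\<alpha>. \<nu> * \<alpha>\<^sup>2)) 0 = 2 * \<nu>"
  unfolding deriv_square by (rule DERIV_imp_deriv) (rule derivative_eq_intros refl | simp)+

lemma saddle_node:
  "\<exists>I \<phi>. saddle_node_homoclinic f xh \<phi>\<^sub>2 I \<phi> \<and>
     (a\<^sub>2 * b\<^sub>2 < 0 \<longrightarrow> supercritical \<phi>) \<and> (a\<^sub>2 * b\<^sub>2 > 0 \<longrightarrow> subcritical \<phi>)"
proof -
  define \<phi> where "\<phi> = (\<lambda>\<alpha>. \<nu> * \<alpha>\<^sup>2)"
  obtain r \<alpha>1 where \<alpha>1: "\<alpha>1 > 0" and ex: "\<And>\<alpha>. \<alpha> \<noteq> 0 \<Longrightarrow> \<bar>\<alpha>\<bar> < \<alpha>1 \<Longrightarrow>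
     \<exists>v. (\<forall>t. norm (v t) \<le> r) \<and>
       homoclinic_orbit (\<lambda>y. f y (\<phi> \<alpha>)) 0 (\<lambda>t. xh t + \<alpha> *\<^sub>R \<phi>\<^sub>2 t + \<alpha>\<^sup>2 *\<^sub>R v t)"
    using homoclinic_branch unfolding \<phi>_def by blast
  have "\<forall>\<alpha>. \<exists>v. \<alpha> \<noteq> 0 \<longrightarrow> \<bar>\<alpha>\<bar> < \<alpha>1 \<longrightarrow> (\<forall>t. norm (v t) \<le> r) \<and>
       homoclinic_orbit (\<lambda>y. f y (\<phi> \<alpha>)) 0 (\<lambda>t. xh t + \<alpha> *\<^sub>R \<phi>\<^sub>2 t + \<alpha>\<^sup>2 *\<^sub>R v t)"
    using ex by simp
  from choice[OF this] obtain v where v': "\<forall>\<alpha>. \<alpha> \<noteq> 0 \<longrightarrow> \<bar>\<alpha>\<bar> < \<alpha>1 \<longrightarrow> (\<forall>t. norm (v \<alpha> t) \<le> r) \<and>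
       homoclinic_orbit (\<lambda>y. f y (\<phi> \<alpha>)) 0 (\<lambda>t. xh t + \<alpha> *\<^sub>R \<phi>\<^sub>2 t + \<alpha>\<^sup>2 *\<^sub>R v \<alpha> t)" ..
  then have v: "\<And>\<alpha> t. \<alpha> \<noteq> 0 \<Longrightarrow> \<bar>\<alpha>\<bar> < \<alpha>1 \<Longrightarrow> norm (v \<alpha> t) \<le> r"
    "\<And>\<alpha>. \<alpha> \<noteq> 0 \<Longrightarrow> \<bar>\<alpha>\<bar> < \<alpha>1 \<Longrightarrow>
      homoclinic_orbit (\<lambda>y. f y (\<phi> \<alpha>)) 0 (\<lambda>t. xh t + \<alpha> *\<^sub>R \<phi>\<^sub>2 t + \<alpha>\<^sup>2 *\<^sub>R v \<alpha> t)"
    by simp_all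
  \<comment> \<open>At \<open>\<alpha> = 0\<close> nothing is known about the chosen
    \<open>v\<close>; inserting \<open>xh\<close> there makes the equality with the original orbit
    hold as functions.\<close>
  define x where "x \<alpha> = (if \<alpha> = 0 then xh else (\<lambda>t. xh t + \<alpha> *\<^sub>R \<phi>\<^sub>2 t + \<alpha>\<^sup>2 *\<^sub>R v \<alpha> t))" for \<alpha>
  have \<nu>0: "\<nu> \<noteq> 0" using a2_nz b2_nz by (simp add: \<nu>_def)
  have hom: "homoclinic_orbit (\<lambda>y. f y (\<phi> \<alpha>)) 0 (x \<alpha>)" if "\<alpha> \<in> {- \<alpha>1<..<\<alpha>1}" for \<alpha>
    using that v(2)[of \<alpha>] M2 by (auto simp: x_def \<phi>_def)
  have close: "norm (x \<alpha> t - xh t - \<alpha> *\<^sub>R \<phi>\<^sub>2 t) \<le> \<bar>r\<bar> * sqrt (\<alpha> ^ 4 + \<bar>\<phi> \<alpha>\<bar> ^ 2)" if "\<bar>\<alpha>\<bar> < \<alpha>1" for \<alpha> t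
  proof (cases "\<alpha> = 0")
    case False
    have "norm (x \<alpha> t - xh t - \<alpha> *\<^sub>R \<phi>\<^sub>2 t) = \<alpha>\<^sup>2 * norm (v \<alpha> t)" using False by (simp add: x_def)
    also have "\<dots> \<le> \<alpha>\<^sup>2 * \<bar>r\<bar>" using v(1)[OF False that, of t] by (intro mult_left_mono) auto
    \<comment> \<open>The correction is of order \<open>\<alpha>\<^sup>2\<close>, which the first
      summand under the root alone dominates; the bound on \<open>v\<close> is the constant.\<close>
    also have "\<alpha>\<^sup>2 = sqrt (\<alpha> ^ 4)" by (rule real_sqrt_unique[symmetric]) (simp_all flip: power_mult)
    also have "sqrt (\<alpha> ^ 4) * \<bar>r\<bar> \<le> sqrt (\<alpha> ^ 4 + \<bar>\<phi> \<alpha>\<bar> ^ 2) * \<bar>r\<bar>"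
      by (intro mult_right_mono real_sqrt_le_mono) auto
    finally show ?thesis by (simp add: mult.commute)
  qed (simp add: x_def)
  have "saddle_node_homoclinic f xh \<phi>\<^sub>2 {- \<alpha>1<..<\<alpha>1} \<phi>"
    unfolding saddle_node_homoclinic_def
  proof (intro conjI ballI exI[of _ x])
    show "is_interval {- \<alpha>1<..<\<alpha>1}" by (rule is_interval_oo)
    show "\<phi> differentiable (at \<alpha>)" for \<alpha> unfolding \<phi>_def by (auto intro!: derivative_intros)
    show "deriv \<phi> differentiable (at 0)" unfolding \<phi>_def deriv_square by (auto intro!: derivative_intros)
    show "deriv \<phi> 0 = 0" by (simp add: \<phi>_def deriv_square)
    show "deriv (deriv \<phi>) 0 \<noteq> 0" using \<nu>0 by (simp add: \<phi>_def deriv_deriv_square)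
    show "\<exists>C. \<forall>\<^sub>F \<alpha> in nhds 0. \<forall>t. norm (x \<alpha> t - xh t - \<alpha> *\<^sub>R \<phi>\<^sub>2 t) \<le> C * sqrt (\<alpha> ^ 4 + \<bar>\<phi> \<alpha>\<bar> ^ 2)"
      unfolding eventually_nhds_metric using \<alpha>1 close
      by (intro exI[of _ "\<bar>r\<bar>"] exI[of _ \<alpha>1]) (simp add: dist_norm)
  qed (use \<alpha>1 hom in \<open>auto simp: \<phi>_def x_def\<close>)
  moreover have "\<nu> > 0" if "a\<^sub>2 * b\<^sub>2 < 0"
    using that by (auto simp: \<nu>_def mult_less_0_iff divide_less_0_iff)
  moreover have "\<nu> < 0" if "a\<^sub>2 * b\<^sub>2 > 0"
    using that by (auto simp: \<nu>_def zero_less_mult_iff zero_less_divide_iff)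
  ultimately show ?thesis
    by (intro exI[of _ "{- \<alpha>1<..<\<alpha>1}"] exI[of _ \<phi>])
      (auto simp: supercritical_def subcritical_def \<phi>_def deriv_deriv_square)
qed

end

theorem theorem2p14:
  fixes H :: "(real ^ ('m::finite + 'm)) \<times> real \<Rightarrow> real"
    and f :: "real ^ ('m + 'm) \<Rightarrow> real \<Rightarrow> real ^ ('m + 'm)"
    and xh \<phi>\<^sub>1 \<phi>\<^sub>2 :: "real \<Rightarrow> real ^ ('m + 'm)"
    and a\<^sub>2 b\<^sub>2 :: real
  assumes H: "real_analytic H"
    and f: "f = hamiltonian_field H"
    and equilibrium: "\<forall>\<^sub>F \<mu> in nhds 0. f 0 \<mu> = 0"
    and M1: "hyperbolic_saddle (\<lambda>x. f x 0) 0 CARD('m) CARD('m)"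
    and M2: "homoclinic_orbit (\<lambda>x. f x 0) 0 xh"
    and \<phi>1: "\<phi>\<^sub>1 = (\<lambda>t. vector_derivative xh (at t))"
    and M3: "two_element_basis
               (bounded_solutions (\<lambda>t. frechet_derivative (\<lambda>x. f x 0) (at (xh t)))) \<phi>\<^sub>1 \<phi>\<^sub>2"
    and a2: "a\<^sub>2 = - (LINT t|lborel.
               (symplectic_J *v \<phi>\<^sub>2 t) \<bullet> vector_derivative (\<lambda>\<mu>. f (xh t) \<mu>) (at 0))"
    and b2: "b\<^sub>2 = - (1/2) * (LINT t|lborel.
               (symplectic_J *v \<phi>\<^sub>2 t) \<bullet> second_derivative (\<lambda>x. f x 0) (xh t) (\<phi>\<^sub>2 t) (\<phi>\<^sub>2 t))"
    and "a\<^sub>2 \<noteq> 0" and "b\<^sub>2 \<noteq> 0"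
  shows "\<exists>I \<phi>. saddle_node_homoclinic f xh \<phi>\<^sub>2 I \<phi> \<and>
           (a\<^sub>2 * b\<^sub>2 < 0 \<longrightarrow> supercritical \<phi>) \<and> (a\<^sub>2 * b\<^sub>2 > 0 \<longrightarrow> subcritical \<phi>)"
  using degenerate_homoclinic.saddle_node[OF degenerate_homoclinic.intro[OF assms]] .

end
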